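(* Let $n\in\mathbb{N}$, let $K$ be a field of characteristic $0$, and let $W$ be the $n$-th Weyl algebra over $K$. Given any finitely generated left $W$-module $M$, there are only finitely many distinct characteristic varieties $\mathcal{V}^\omega(M)$ for $\omega$ varying in $\Omega$.
   Context: $\mathbb{N}=\{1,2,\dots\}$, $\mathbb{N}_0=\mathbb{N}\cup\{0\}$. $K[X,Y]=K[X_1,\dots,X_n,Y_1,\dots,Y_n]$. The $n$-th Weyl algebra $W$ is the $K$-subalgebra of $\mathrm{End}_K(K[X_1,\dots,X_n])$ generated by $\xi_i$ (multiplication by $X_i$) and $\partial_i=\partial/\partial X_i$, $1\le i\le n$. It has $K$-basis $\{\xi^\lambda\partial^\mu\mid\lambda,\mu\in\mathbb{N}_0^n\}$; for $w=\sum c_{\lambda\mu}\xi^\lambda\partial^\mu$ put $\mathrm{supp}(w)=\{(\lambda,\mu)\mid c_{\lambda\mu}\neq0\}$. Let $(\lambda|\mu)\in\mathbb{N}_0^{2n}$ denote concatenation and $\cdot$ the standard scalar product. For $\omega\in\mathbb{N}_0^{2n}$, $\deg^\omega(w)=\sup\{\omega\cdot(\lambda|\mu)\mid(\lambda,\mu)\in\mathrm{supp}(w)\}$ (so $\deg^\omega(0)=-\infty$). $\Omega=\{\omega\in\mathbb{N}_0^{2n}\mid\omega_i+\omega_{n+i}>0\text{ for }1\le i\le n\}$. For $\omega\in\Omega$, $W$ is filtered by $\mathrm{F}^\omega_iW=\{w\in W\mid\deg^\omega(w)\le i\}$, $i\in\mathbb{Z}$; the associated graded ring $\mathrm{G}^\omega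 W=\bigoplus_i\mathrm{F}^\omega_iW/\mathrm{F}^\omega_{i-1}W$ is commutative and is identified with $K[X,Y]$ by letting $X_i,Y_i$ correspond to the classes of $\xi_i,\partial_i$ in degrees $\omega_i,\omega_{n+i}$. A filtration $(\mathrm{F}_iM)_{i\in\mathbb{Z}}$ of $M$ over $W$ with the $\omega$-filtration is good if there are finitely many $m_j\in M$, $p_j\in\mathbb{Z}$ with $\mathrm{F}_iM=\sum_j\mathrm{F}^\omega_{i-p_j}W\,m_j$ for all $i$. $\mathrm{G}^\omega M=\bigoplus_i\mathrm{F}_iM/\mathrm{F}_{i-1}M$ is the associated graded $K[X,Y]$-module with respect to a good filtration of $M$. The $\omega$-characteristic variety is $\mathcal{V}^\omega(M)=\mathrm{Var}(0:\mathrm{G}^\omega M)$, the closed set of primes of $\mathrm{Spec}(K[X,Y])$ containing the annihilator of $\mathrm{G}^\omega M$; it does not depend on the good filtration. *)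

theory Defs
  imports
    "HOL-Library.Poly_Mapping"
    "HOL-Library.Extended_Real"
    "HOL-Algebra.Generated_Rings"
    "HOL-Algebra.AbelCoset"
    "HOL-Algebra.Module"
    "HOL-Algebra.Ideal"
    "HOL-Algebra.Product_Groups"
    "HOL-Algebra.Algebraic_Closure_Type"
begin

text \<open>
  The polynomial ring over \<open>'a\<close> in variables indexed by \<open>'i\<close>, as the monoid algebra of the
  exponents \<open>'i \<Rightarrow>\<^sub>0 nat\<close>. With \<open>n\<close> the cardinality of the finite type \<open>'n\<close>, the ring
  \<open>K[X]\<close> is \<open>('n, 'a) mpoly\<close> and \<open>K[X,Y]\<close> is \<open>('n + 'n, 'a) mpoly\<close>, where \<open>Inl i\<close> is the index
  of \<open>X\<^sub>i\<close> and \<open>Inr i\<close> that of \<open>Y\<^sub>i\<close>. Likewise an element of \<open>\<nat>\<^sub>0\<close> to the power \<open>2n\<close> is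
  indexed by \<open>'n + 'n\<close>, so that \<open>\<nu>\<close> stands for the concatenation \<open>(\<lambda>|\<mu>)\<close> with
  \<open>\<lambda>\<^sub>i = \<nu> (Inl i)\<close> and \<open>\<mu>\<^sub>i = \<nu> (Inr i)\<close>.
\<close>

type_synonym ('i, 'a) mpoly = "('i \<Rightarrow>\<^sub>0 nat) \<Rightarrow>\<^sub>0 'a"

type_synonym ('n, 'a) operator = "('n, 'a) mpoly \<Rightarrow> ('n, 'a) mpoly"

definition scale :: "'a::field \<Rightarrow> ('i, 'a) mpoly \<Rightarrow> ('i, 'a) mpoly"
  where "scale c p = Poly_Mapping.single 0 c * p"

definition end_ring :: "('n, 'a::field) operator ring"
  where "end_ring =
    \<lparr>carrier = {f. Vector_Spaces.linear scale scale f}, monoid.mult = (\<circ>), one = id,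
     zero = (\<lambda>p. 0), add = (\<lambda>f g p. f p + g p)\<rparr>"

definition xi :: "'n \<Rightarrow> ('n, 'a::field) operator"
  where "xi i p = Poly_Mapping.single (Poly_Mapping.single i 1) 1 * p"

definition partial :: "'n \<Rightarrow> ('n, 'a::field) operator"
  where "partial i p =
    (\<Sum>m\<in>Poly_Mapping.keys p. Poly_Mapping.single (m - Poly_Mapping.single i 1)
                  (of_nat (Poly_Mapping.lookup m i) * Poly_Mapping.lookup p m))"

text \<open>A subring containing all scalar operators is the same as a \<open>K\<close>-subalgebra.\<close>

definition weyl :: "('n, 'a::field) operator ring"
  where "weyl = end_ring
    \<lparr>carrier := generate_ring end_ring (range scale \<union> range xi \<union> range partial)\<rparr>"

text \<open>
  The fold makes sense for a family \<open>g\<close> of pairwise commuting operators; it is only applied to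
  \<open>xi\<close> and \<open>partial\<close>.
\<close>

definition op_power :: "('n::finite \<Rightarrow> ('n, 'a) operator) \<Rightarrow> ('n \<Rightarrow> nat) \<Rightarrow> ('n, 'a) operator"
  where "op_power g k = Finite_Set.fold (\<lambda>i f. (g i ^^ k i) \<circ> f) id UNIV"

text \<open>The operator \<open>\<xi>\<close> to the power \<open>\<lambda>\<close> composed with \<open>\<partial>\<close> to the power \<open>\<mu>\<close>, for \<open>\<nu> = (\<lambda>|\<mu>)\<close>.\<close>

definition weyl_monom :: "('n::finite + 'n \<Rightarrow>\<^sub>0 nat) \<Rightarrow> ('n, 'a::field) operator"
  where "weyl_monom \<nu> =
    op_power xi (\<lambda>i. Poly_Mapping.lookup \<nu> (Inl i)) \<circ>
    op_power partial (\<lambda>i. Poly_Mapping.lookup \<nu> (Inr i))"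

text \<open>
  The \<open>K\<close>-linear map from \<open>K[X,Y]\<close> to the Weyl algebra replacing each monomial by the
  corresponding element of the canonical basis. It is not multiplicative.
\<close>

definition normal_op :: "('n::finite + 'n, 'a::field) mpoly \<Rightarrow> ('n, 'a) operator"
  where "normal_op c =
    (\<lambda>p. \<Sum>\<nu>\<in>Poly_Mapping.keys c. scale (Poly_Mapping.lookup c \<nu>) (weyl_monom \<nu> p))"

definition weyl_coeffs :: "('n::finite, 'a::field) operator \<Rightarrow> ('n + 'n, 'a) mpoly"
  where "weyl_coeffs w = (THE c. normal_op c = w)"

definition supp :: "('n::finite, 'a::field) operator \<Rightarrow> ('n + 'n \<Rightarrow>\<^sub>0 nat) set"
  where "supp w = Poly_Mapping.keys (weyl_coeffs w)"

definition Omega :: "('n::finite + 'n \<Rightarrow> nat) set"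
  where "Omega = {\<omega>. \<forall>i. \<omega> (Inl i) + \<omega> (Inr i) > 0}"

definition wdot :: "('n::finite + 'n \<Rightarrow> nat) \<Rightarrow> ('n + 'n \<Rightarrow>\<^sub>0 nat) \<Rightarrow> nat"
  where "wdot \<omega> \<nu> = (\<Sum>j\<in>UNIV. \<omega> j * Poly_Mapping.lookup \<nu> j)"

text \<open>The supremum of the empty set in \<^typ>\<open>ereal\<close> is \<open>-\<infinity>\<close>, the degree of \<open>0\<close>.\<close>

definition wdeg :: "('n::finite + 'n \<Rightarrow> nat) \<Rightarrow> ('n, 'a::field) operator \<Rightarrow> ereal"
  where "wdeg \<omega> w = (SUP \<nu>\<in>supp w. ereal (real (wdot \<omega> \<nu>)))"

definition Fweyl :: "('n::finite + 'n \<Rightarrow> nat) \<Rightarrow> int \<Rightarrow> ('n, 'a::field) operator set"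
  where "Fweyl \<omega> i = {w \<in> carrier weyl. wdeg \<omega> w \<le> ereal (real_of_int i)}"

text \<open>The library's locale \<^locale>\<open>module\<close> without commutativity of the ring.\<close>

locale left_module = R?: ring R + M?: abelian_group M
  for R :: "('r, 'x) ring_scheme" (structure) and M :: "('r, 'm, 'y) module_scheme" (structure) +
  assumes smult_closed:
      "\<lbrakk>a \<in> carrier R; x \<in> carrier M\<rbrakk> \<Longrightarrow> a \<odot>\<^bsub>M\<^esub> x \<in> carrier M"
    and smult_l_distr:
      "\<lbrakk>a \<in> carrier R; b \<in> carrier R; x \<in> carrier M\<rbrakk> \<Longrightarrow>
       (a \<oplus> b) \<odot>\<^bsub>M\<^esub> x = a \<odot>\<^bsub>M\<^esub> x \<oplus>\<^bsub>M\<^esub> b \<odot>\<^bsub>M\<^esub> x"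
    and smult_r_distr:
      "\<lbrakk>a \<in> carrier R; x \<in> carrier M; y \<in> carrier M\<rbrakk> \<Longrightarrow>
       a \<odot>\<^bsub>M\<^esub> (x \<oplus>\<^bsub>M\<^esub> y) = a \<odot>\<^bsub>M\<^esub> x \<oplus>\<^bsub>M\<^esub> a \<odot>\<^bsub>M\<^esub> y"
    and smult_assoc1:
      "\<lbrakk>a \<in> carrier R; b \<in> carrier R; x \<in> carrier M\<rbrakk> \<Longrightarrow>
       (a \<otimes> b) \<odot>\<^bsub>M\<^esub> x = a \<odot>\<^bsub>M\<^esub> (b \<odot>\<^bsub>M\<^esub> x)"
    and smult_one:
      "x \<in> carrier M \<Longrightarrow> \<one> \<odot>\<^bsub>M\<^esub> x = x"

definition fin_generated :: "('r, 'x) ring_scheme \<Rightarrow> ('r, 'm, 'y) module_scheme \<Rightarrow> bool"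
  where "fin_generated R M \<longleftrightarrow>
    (\<exists>A. finite A \<and> A \<subseteq> carrier M \<and>
      (\<forall>m\<in>carrier M. \<exists>r\<in>A \<rightarrow> carrier R. m = (\<Oplus>\<^bsub>M\<^esub>a\<in>A. r a \<odot>\<^bsub>M\<^esub> a)))"

definition filtration ::
    "('n::finite + 'n \<Rightarrow> nat) \<Rightarrow> (('n, 'a::field) operator, 'm, 'y) module_scheme \<Rightarrow>
     (int \<Rightarrow> 'm set) \<Rightarrow> bool"
  where "filtration \<omega> M F \<longleftrightarrow>
    (\<forall>i. additive_subgroup (F i) M) \<and> (\<forall>i. F i \<subseteq> F (i + 1)) \<and> (\<Union>i. F i) = carrier M \<and>
    (\<forall>i j. \<forall>w\<in>Fweyl \<omega> i. \<forall>m\<in>F j. w \<odot>\<^bsub>M\<^esub> m \<in> F (i + j))"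

definition good_filtration ::
    "('n::finite + 'n \<Rightarrow> nat) \<Rightarrow> (('n, 'a::field) operator, 'm, 'y) module_scheme \<Rightarrow>
     (int \<Rightarrow> 'm set) \<Rightarrow> bool"
  where "good_filtration \<omega> M F \<longleftrightarrow>
    filtration \<omega> M F \<and>
    (\<exists>(k::nat) (m::nat \<Rightarrow> 'm) (p::nat \<Rightarrow> int).
      (\<forall>j<k. m j \<in> carrier M) \<and>
      (\<forall>i. F i = {\<Oplus>\<^bsub>M\<^esub>j\<in>{..<k}. w j \<odot>\<^bsub>M\<^esub> m j | w. \<forall>j<k. w j \<in> Fweyl \<omega> (i - p j)}))"

text \<open>
  An element of the associated graded group is a finitely supported family \<open>g\<close> of cosets, with
  \<open>g i\<close> in \<open>F i / F (i - 1)\<close>. The library's factor groups and direct sums are written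
  multiplicatively.
\<close>

definition gr_comp :: "('m, 'y) ring_scheme \<Rightarrow> (int \<Rightarrow> 'm set) \<Rightarrow> int \<Rightarrow> 'm set monoid"
  where "gr_comp M F i = (M\<lparr>carrier := F i\<rparr>) A_Mod (F (i - 1))"

definition gr :: "('m, 'y) ring_scheme \<Rightarrow> (int \<Rightarrow> 'm set) \<Rightarrow> (int \<Rightarrow> 'm set) monoid"
  where "gr M F = sum_group UNIV (gr_comp M F)"

text \<open>
  The product of the class of \<open>w\<close> in degree \<open>i\<close> with the class of \<open>m\<close> in degree \<open>j\<close> is the class of
  \<open>w \<odot> m\<close> in degree \<open>k = i + j\<close>; compare \<^const>\<open>rcoset_mult\<close>.
\<close>

definition coset_smult ::
    "('r, 'm, 'y) module_scheme \<Rightarrow> (int \<Rightarrow> 'm set) \<Rightarrow> int \<Rightarrow> 'r set \<Rightarrow> 'm set \<Rightarrow> 'm set"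
  where "coset_smult M F k A B = (\<Union>w\<in>A. \<Union>m\<in>B. F (k - 1) +>\<^bsub>M\<^esub> (w \<odot>\<^bsub>M\<^esub> m))"

text \<open>
  Here \<open>a\<close> ranges over the associated graded ring \<open>gr weyl (Fweyl \<omega>)\<close>; the product over \<open>i\<close> is the
  sum in \<open>F k / F (k - 1)\<close>.
\<close>

definition gr_smult ::
    "('n::finite + 'n \<Rightarrow> nat) \<Rightarrow> (('n, 'a::field) operator, 'm, 'y) module_scheme \<Rightarrow>
     (int \<Rightarrow> 'm set) \<Rightarrow> (int \<Rightarrow> ('n, 'a) operator set) \<Rightarrow> (int \<Rightarrow> 'm set) \<Rightarrow> (int \<Rightarrow> 'm set)"
  where "gr_smult \<omega> M F a g =
    (\<lambda>k. \<Otimes>\<^bsub>gr_comp M F k\<^esub>i\<in>{i. a i \<noteq> \<one>\<^bsub>gr_comp weyl (Fweyl \<omega>) i\<^esub>}.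
      coset_smult M F k (a i) (g (k - i)))"

definition hom_part ::
    "('n::finite + 'n \<Rightarrow> nat) \<Rightarrow> ('n + 'n, 'a::field) mpoly \<Rightarrow> int \<Rightarrow> ('n + 'n, 'a) mpoly"
  where "hom_part \<omega> f i =
    (\<Sum>\<nu>\<in>{\<nu>\<in>Poly_Mapping.keys f. int (wdot \<omega> \<nu>) = i}.
      Poly_Mapping.single \<nu> (Poly_Mapping.lookup f \<nu>))"

text \<open>
  The identification of \<open>K[X,Y]\<close> with the associated graded ring of the Weyl algebra. The
  \<open>K\<close>-algebra isomorphism taking \<open>X\<^sub>i\<close> and \<open>Y\<^sub>i\<close> to the classes of \<open>\<xi>\<^sub>i\<close> and \<open>\<partial>\<^sub>i\<close> in degrees
  \<open>\<omega> (Inl i)\<close> and \<open>\<omega> (Inr i)\<close> takes the monomial with exponent \<open>\<nu>\<close> to the class of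
  \<open>weyl_monom \<nu>\<close> in degree \<open>wdot \<omega> \<nu>\<close>.
\<close>

definition poly_to_gr ::
    "('n::finite + 'n \<Rightarrow> nat) \<Rightarrow> ('n + 'n, 'a::field) mpoly \<Rightarrow> int \<Rightarrow> ('n, 'a) operator set"
  where "poly_to_gr \<omega> f = (\<lambda>i. Fweyl \<omega> (i - 1) +>\<^bsub>weyl\<^esub> normal_op (hom_part \<omega> f i))"

text \<open>
  The record of modules extends that of rings, and
  its fields \<open>monoid.mult\<close> and \<open>one\<close> have no meaning for a module.
\<close>

definition gr_module ::
    "('n::finite + 'n \<Rightarrow> nat) \<Rightarrow> (('n, 'a::field) operator, 'm, 'y) module_scheme \<Rightarrow>
     (int \<Rightarrow> 'm set) \<Rightarrow> (('n + 'n, 'a) mpoly, int \<Rightarrow> 'm set) module"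
  where "gr_module \<omega> M F =
    \<lparr>carrier = carrier (gr M F), monoid.mult = undefined, one = undefined,
     zero = \<one>\<^bsub>gr M F\<^esub>, add = (\<otimes>\<^bsub>gr M F\<^esub>),
     module.smult = (\<lambda>f. gr_smult \<omega> M F (poly_to_gr \<omega> f))\<rparr>"

definition annihilator :: "('r, 'x) ring_scheme \<Rightarrow> ('r, 'm, 'y) module_scheme \<Rightarrow> 'r set"
  where "annihilator R M = {r \<in> carrier R. \<forall>x\<in>carrier M. r \<odot>\<^bsub>M\<^esub> x = \<zero>\<^bsub>M\<^esub>}"

definition Var :: "('r, 'x) ring_scheme \<Rightarrow> 'r set \<Rightarrow> 'r set set"
  where "Var R I = {P. primeideal P R \<and> I \<subseteq> P}"

text \<open>
  The result does not depend on the good filtration; a finitely generated module over the Weyl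
  algebra has one for every weight in \<^const>\<open>Omega\<close>.
\<close>

definition char_variety ::
    "('n::finite + 'n \<Rightarrow> nat) \<Rightarrow> (('n, 'a::field) operator, 'm, 'y) module_scheme \<Rightarrow>
     ('n + 'n, 'a) mpoly set set"
  where "char_variety \<omega> M =
    Var ring_of_type_algebra
      (annihilator ring_of_type_algebra
        (gr_module \<omega> M (SOME F. good_filtration \<omega> M F)))"

end

theory Submission
  imports Defs "HOL-Library.Product_Lexorder"
begin

text \<open>
  Present \<open>M\<close> by finitely many generators, so that \<open>M\<close> is a free module of rank \<open>k\<close> modulo a module of
  relations. For a weight \<open>\<omega>\<close> the degree filtration of the free module induces a good filtration of
  \<open>M\<close>, and the associated graded module is a free module of rank \<open>k\<close> over the polynomial ring
  modulo the submodule generated by the \<open>\<omega>\<close>-leading forms of the relations. It is therefore enough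
  that this module of leading forms takes finitely many values when \<open>\<omega>\<close> varies, which is an instance
  of the finiteness of the Groebner fan.

  Refine \<open>\<omega>\<close> to a total term order, and let \<open>S\<close> be the set of leading monomials of the relations; it
  is closed under multiplication by monomials. Three facts combine. The sets \<open>S\<close> form a finite family,
  by Dickson's lemma and because every nonzero relation involves a monomial of \<open>S\<close> while each monomial
  of \<open>S\<close> is the only one of \<open>S\<close> in a suitable, reduced, relation
  (\<open>finite_family_of_transversal_upsets\<close>, \<open>finite_initial_positions\<close>). The set \<open>S\<close> alone, without
  \<open>\<omega>\<close>, determines a finite Groebner basis of reduced relations, and each of them has only finitely many
  conceivable leading forms (\<open>finite_initial_bases\<close>). Finally, division with remainder shows that the
  leading forms of this Groebner basis generate all leading forms
  (\<open>weight_part_of_relation_in_span\<close>).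

  The noncommutative product enters through one estimate: the coefficient polynomial of a product of
  two operators differs from the product of their coefficient polynomials by terms of smaller
  \<open>\<omega>\<close>-weight, because \<open>\<omega>\<close> is positive on each pair \<open>\<xi>\<^sub>i\<close>, \<open>\<partial>\<^sub>i\<close> (\<open>star_diff_mult_weight_le\<close>).

  The good filtration in the definition of the characteristic variety is an arbitrary one. Two good
  filtrations contain each other up to a shift, so a form that annihilates one graded module has a power
  annihilating the other, and primes do not see the difference (\<open>Var_gr_annihilator_good\<close>).
\<close>

section \<open>Dickson's lemma and families of upward closed sets\<close>

text \<open>
  A decreasing sequence of natural numbers is eventually constant, so that of the two alternatives for
  a monotone subsequence the increasing one can always be had.
\<close>

lemma nat_seq_has_incseq_subseq:
  fixes s :: "nat \<Rightarrow> nat"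
  shows "\<exists>\<psi>::nat \<Rightarrow> nat. strict_mono \<psi> \<and> incseq (s \<circ> \<psi>)"
proof -
  obtain \<psi> :: "nat \<Rightarrow> nat" where \<psi>: "strict_mono \<psi>" "monoseq (\<lambda>n. s (\<psi> n))"
    using seq_monosub by blast
  show ?thesis
  proof (cases "incseq (s \<circ> \<psi>)")
    case True
    then show ?thesis using \<psi> by blast
  next
    case False
    then have dec: "s (\<psi> n) \<le> s (\<psi> m)" if "m \<le> n" for m n
      using \<psi>(2) that by (auto simp: monoseq_iff incseq_def decseq_def o_def)
    obtain k where k: "\<And>n. s (\<psi> k) \<le> s (\<psi> n)"
      using ex_has_least_nat[of "\<lambda>_. True" 0 "\<lambda>n. s (\<psi> n)"] by auto
    have "s (\<psi> (n + k)) = s (\<psi> k)" for n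
      using dec[of k "n + k"] k[of "n + k"] by simp
    then have "incseq (s \<circ> (\<lambda>n. \<psi> (n + k)))"
      by (simp add: incseq_def)
    moreover have "strict_mono (\<lambda>n. \<psi> (n + k))"
      using \<psi>(1) by (simp add: strict_mono_def)
    ultimately show ?thesis by blast
  qed
qed

lemma finitely_many_coordinates_incseq_subseq:
  fixes x :: "nat \<Rightarrow> 'b" and C :: "('b \<Rightarrow> nat) set"
  assumes "finite C"
  shows "\<exists>\<phi>::nat \<Rightarrow> nat. strict_mono \<phi> \<and> (\<forall>f\<in>C. incseq (\<lambda>n. f (x (\<phi> n))))"
  using assms
proof (induction C)
  case empty
  show ?case by (rule exI[of _ id]) (simp add: strict_mono_def)
next
  case (insert f C)
  then obtain \<phi> :: "nat \<Rightarrow> nat" where \<phi>: "strict_mono \<phi>" "\<And>g. g \<in> C \<Longrightarrow> incseq (\<lambda>n. g (x (\<phi> n)))"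
    by blast
  obtain \<psi> :: "nat \<Rightarrow> nat" where \<psi>: "strict_mono \<psi>" "incseq ((\<lambda>n. f (x (\<phi> n))) \<circ> \<psi>)"
    using nat_seq_has_incseq_subseq by blast
  have "incseq (\<lambda>n. g (x (\<phi> (\<psi> n))))" if "g \<in> C" for g
    using \<phi>(2)[OF that] \<psi>(1) by (auto simp: incseq_def strict_mono_less_eq)
  moreover have "incseq (\<lambda>n. f (x (\<phi> (\<psi> n))))"
    using \<psi>(2) by (simp add: o_def)
  moreover have "strict_mono (\<lambda>n. \<phi> (\<psi> n))"
    using \<phi>(1) \<psi>(1) by (simp add: strict_mono_def)
  ultimately show ?case
    by (intro exI[of _ "\<lambda>n. \<phi> (\<psi> n)"]) auto
qed

text \<open>
  For a quasi-order \<open>R\<close> this says that \<open>R\<close> is a well-quasi-order on \<open>B\<close>. A pair \<open>i < j\<close> as in the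
  definition is called good below.
\<close>

definition almost_full_on :: "('b \<Rightarrow> 'b \<Rightarrow> bool) \<Rightarrow> 'b set \<Rightarrow> bool"
  where "almost_full_on R B \<longleftrightarrow>
    (\<forall>x::nat \<Rightarrow> 'b. (\<forall>n. x n \<in> B) \<longrightarrow> (\<exists>i j. i < j \<and> R (x i) (x j)))"

text \<open>
  A pair of an exponent and an index is a monomial in a free module; the relation is divisibility of
  monomials, which forces the two indices to agree.
\<close>

definition pos_le :: "('i \<Rightarrow>\<^sub>0 nat) \<times> nat \<Rightarrow> ('i \<Rightarrow>\<^sub>0 nat) \<times> nat \<Rightarrow> bool"
  where "pos_le b b' \<longleftrightarrow> (\<exists>\<alpha>. b' = (\<alpha> + fst b, snd b))"

text \<open>
  Dickson's lemma for monomials in a free module of rank \<open>k\<close>. It is enough to pass to a subsequence on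
  which finitely many coordinate functions increase.
\<close>

lemma dickson:
  "almost_full_on (pos_le :: ('i::finite \<Rightarrow>\<^sub>0 nat) \<times> nat \<Rightarrow> _) (UNIV \<times> {..<k})"
  unfolding almost_full_on_def
proof (intro allI impI)
  fix x :: "nat \<Rightarrow> ('i \<Rightarrow>\<^sub>0 nat) \<times> nat"
  assume x: "\<forall>n. x n \<in> UNIV \<times> {..<k}"
  \<comment> \<open>An increasing position \<open>j\<close> for which \<open>k - j\<close> increases as well is constant.\<close>
  let ?C = "{snd, \<lambda>b. k - snd b} \<union> range (\<lambda>i b. Poly_Mapping.lookup (fst b) i)"
  obtain \<phi> :: "nat \<Rightarrow> nat" where \<phi>: "strict_mono \<phi>" "\<And>f. f \<in> ?C \<Longrightarrow> incseq (\<lambda>n. f (x (\<phi> n)))"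
    using finitely_many_coordinates_incseq_subseq[of ?C x] by auto
  have le: "f (x (\<phi> 0)) \<le> f (x (\<phi> 1))" if "f \<in> ?C" for f
    using \<phi>(2)[OF that] by (simp add: incseq_def)
  have "snd (x (\<phi> 1)) < k" "snd (x (\<phi> 0)) < k"
    using x by (auto simp: mem_Times_iff)
  then have "snd (x (\<phi> 1)) = snd (x (\<phi> 0))"
    using le[of snd] le[of "\<lambda>b. k - snd b"] by simp
  moreover have "fst (x (\<phi> 1)) = (fst (x (\<phi> 1)) - fst (x (\<phi> 0))) + fst (x (\<phi> 0))"
  proof (rule poly_mapping_eqI)
    fix i
    have "Poly_Mapping.lookup (fst (x (\<phi> 0))) i \<le> Poly_Mapping.lookup (fst (x (\<phi> 1))) i"
      by (rule le) blast
    then show "Poly_Mapping.lookup (fst (x (\<phi> 1))) i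
      = Poly_Mapping.lookup ((fst (x (\<phi> 1)) - fst (x (\<phi> 0))) + fst (x (\<phi> 0))) i"
      by (simp add: lookup_add lookup_minus)
  qed
  ultimately have "pos_le (x (\<phi> 0)) (x (\<phi> 1))"
    unfolding pos_le_def by (metis prod.collapse)
  moreover have "\<phi> 0 < \<phi> 1"
    using \<phi>(1) by (simp add: strict_mono_def)
  ultimately show "\<exists>i j. i < j \<and> pos_le (x i) (x j)" by blast
qed

text \<open>
  The common shape of the two Noetherian arguments below: if a finite set with property \<open>P\<close> can always
  be enlarged by an element above none of its members, the enlargements form a sequence without a good
  pair.
\<close>

lemma almost_full_no_infinite_extension:
  assumes af: "almost_full_on R B" and start: "P {}"
    and step: "\<And>D. \<lbrakk>finite D; D \<subseteq> B; P D\<rbrakk> \<Longrightarrow> \<exists>b\<in>B. (\<forall>d\<in>D. \<not> R d b) \<and> P (insert b D)"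
  shows False
proof -
  define pick where "pick D = (SOME b. b \<in> B \<and> (\<forall>d\<in>D. \<not> R d b) \<and> P (insert b D))" for D
  define F where "F n = rec_nat {} (\<lambda>_ D. insert (pick D) D) n" for n
  have F: "F 0 = {}" "\<And>n. F (Suc n) = insert (pick (F n)) (F n)"
    by (simp_all add: F_def)
  have pick: "pick D \<in> B \<and> (\<forall>d\<in>D. \<not> R d (pick D)) \<and> P (insert (pick D) D)"
    if "finite D" "D \<subseteq> B" "P D" for D
    unfolding pick_def by (rule someI_ex) (use step[OF that] in blast)
  have inv: "finite (F n) \<and> F n \<subseteq> B \<and> P (F n)" for n
    by (induction n) (use start pick in \<open>auto simp: F\<close>)
  have mem: "pick (F i) \<in> F j" if "i < j" for i j
    using that by (induction j) (auto simp: F less_Suc_eq)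
  obtain i j where "i < j" "R (pick (F i)) (pick (F j))"
    using af inv pick unfolding almost_full_on_def by meson
  then show False
    using pick[of "F j"] inv[of j] mem[of i j] by simp
qed

lemma almost_full_finite_base:
  assumes "almost_full_on R B" and "S \<subseteq> B"
  shows "\<exists>D\<subseteq>S. finite D \<and> (\<forall>b\<in>S. \<exists>d\<in>D. R d b)"
proof (rule ccontr)
  assume no_base: "\<not> ?thesis"
  show False
  proof (rule almost_full_no_infinite_extension[OF assms(1), of "\<lambda>D. D \<subseteq> S"])
    fix D assume "finite D" "D \<subseteq> S"
    then obtain b where "b \<in> S" "\<forall>d\<in>D. \<not> R d b"
      using no_base by blast
    then show "\<exists>b\<in>B. (\<forall>d\<in>D. \<not> R d b) \<and> insert b D \<subseteq> S"
      using \<open>D \<subseteq> S\<close> assms(2) by blast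
  qed simp
qed

text \<open>
  This is what makes the set of all initial modules finite. In the application the members of \<open>\<S>\<close> are
  the sets of leading positions of one vector space for various orders, and the members of \<open>\<T>\<close> are the
  supports of its nonzero vectors.

  If \<open>\<S>\<close> were infinite, one would keep a finite set \<open>D\<close> that is contained in infinitely many members and
  enlarge it forever: the upper closure \<open>U\<close> of \<open>D\<close> is properly contained in some such member \<open>S\<close>; a
  support \<open>T\<close> meeting \<open>S\<close> only in a point outside \<open>U\<close> avoids \<open>U\<close>; each of the infinitely many members
  meets the finite set \<open>T\<close>, hence one point of \<open>T\<close>, necessarily above no member of \<open>D\<close>, lies in
  infinitely many of them.
\<close>

lemma finite_family_of_transversal_upsets:
  assumes af: "almost_full_on R B"
    and upset: "\<And>S b b'. \<lbrakk>S \<in> \<S>; b \<in> S; b' \<in> B; R b b'\<rbrakk> \<Longrightarrow> b' \<in> S"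
    and sub: "\<And>S. S \<in> \<S> \<Longrightarrow> S \<subseteq> B"
    and supports: "\<And>T. T \<in> \<T> \<Longrightarrow> finite T \<and> T \<subseteq> B"
    and isolate: "\<And>S b. \<lbrakk>S \<in> \<S>; b \<in> S\<rbrakk> \<Longrightarrow> \<exists>T\<in>\<T>. T \<inter> S = {b}"
    and meet: "\<And>S T. \<lbrakk>S \<in> \<S>; T \<in> \<T>\<rbrakk> \<Longrightarrow> T \<inter> S \<noteq> {}"
  shows "finite \<S>"
proof (rule ccontr)
  assume inf: "infinite \<S>"
  show False
  proof (rule almost_full_no_infinite_extension[OF af, of "\<lambda>D. infinite {S\<in>\<S>. D \<subseteq> S}"])
    show "infinite {S\<in>\<S>. {} \<subseteq> S}" using inf by simp
  next
    fix D assume D: "finite D" "D \<subseteq> B" and infD: "infinite {S\<in>\<S>. D \<subseteq> S}"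
    define U where "U = {b\<in>B. \<exists>d\<in>D. R d b}"
    have U: "U \<subseteq> S" if "S \<in> \<S>" "D \<subseteq> S" for S
      using upset that by (auto simp: U_def)
    obtain S where S: "S \<in> \<S>" "D \<subseteq> S" "S \<noteq> U"
      using infD by (metis (mono_tags, lifting) finite.emptyI finite_insert finite_subset mem_Collect_eq
          singleton_iff subsetI)
    then obtain b where b: "b \<in> S" "b \<notin> U"
      using U by blast
    obtain T where T: "T \<in> \<T>" "T \<inter> S = {b}"
      using isolate S b by blast
    have "{S\<in>\<S>. D \<subseteq> S} \<subseteq> (\<Union>t\<in>T - U. {S\<in>\<S>. insert t D \<subseteq> S})"
    proof
      fix S' assume S': "S' \<in> {S\<in>\<S>. D \<subseteq> S}"
      then obtain t where t: "t \<in> T" "t \<in> S'"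
        using meet[of S' T] T(1) by blast
      have "T \<inter> U = {}"
        using U[OF S(1,2)] T(2) b(2) by auto
      then show "S' \<in> (\<Union>t\<in>T - U. {S\<in>\<S>. insert t D \<subseteq> S})"
        using t S' by auto
    qed
    then obtain t where "t \<in> T - U" "infinite {S\<in>\<S>. insert t D \<subseteq> S}"
      using infD supports[OF T(1)] by (meson finite_Diff finite_UN_I finite_subset)
    then show "\<exists>b\<in>B. (\<forall>d\<in>D. \<not> R d b) \<and> infinite {S\<in>\<S>. insert b D \<subseteq> S}"
      using supports[OF T(1)] by (auto simp: U_def)
  qed
qed

section \<open>Leading positions in a space of vectors\<close>

definition leading_positions :: "('b \<Rightarrow> 'w::linorder) \<Rightarrow> ('b \<Rightarrow> 'a::zero) set \<Rightarrow> 'b set"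
  where "leading_positions \<kappa> L = {b. \<exists>f\<in>L. f b \<noteq> 0 \<and> (\<forall>b'. f b' \<noteq> 0 \<longrightarrow> \<kappa> b' \<le> \<kappa> b)}"

lemma support_meets_leading_positions:
  fixes f :: "'b \<Rightarrow> 'a::zero"
  assumes "f \<in> L" and "finite {b. f b \<noteq> 0}" and "f b \<noteq> 0"
  shows "\<exists>b\<in>leading_positions \<kappa> L. f b \<noteq> 0 \<and> (\<forall>b'. f b' \<noteq> 0 \<longrightarrow> \<kappa> b' \<le> \<kappa> b)"
proof -
  have fin: "finite (\<kappa> ` {b. f b \<noteq> 0})" "\<kappa> ` {b. f b \<noteq> 0} \<noteq> {}"
    using assms by auto
  obtain b where "f b \<noteq> 0" "\<kappa> b = Max (\<kappa> ` {b. f b \<noteq> 0})"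
    using Max_in[OF fin] by auto
  then have "f b \<noteq> 0 \<and> (\<forall>b'. f b' \<noteq> 0 \<longrightarrow> \<kappa> b' \<le> \<kappa> b)"
    using fin by simp
  then show ?thesis
    using assms(1) by (auto simp: leading_positions_def)
qed

text \<open>
  The analogue of an element of a reduced Groebner basis: a vector with a given leading position whose
  support contains no other leading position. The other ones in the support of any vector with that
  leading position are smaller, and are cleared by subtracting their own reduced vectors.
\<close>

lemma reduced_vector_exists:
  fixes L :: "('b \<Rightarrow> 'a::field) set" and \<kappa> :: "'b \<Rightarrow> 'w::wellorder"
  assumes inj: "inj_on \<kappa> B"
    and sub: "\<And>f b. \<lbrakk>f \<in> L; f b \<noteq> 0\<rbrakk> \<Longrightarrow> b \<in> B"
    and fin: "\<And>f. f \<in> L \<Longrightarrow> finite {b. f b \<noteq> 0}"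
    and closed: "\<And>f g c. \<lbrakk>f \<in> L; g \<in> L\<rbrakk> \<Longrightarrow> (\<lambda>b. f b - c * g b) \<in> L"
    and b: "b \<in> leading_positions \<kappa> L"
  shows "\<exists>g\<in>L. g b = 1 \<and> (\<forall>b'\<in>leading_positions \<kappa> L. b' \<noteq> b \<longrightarrow> g b' = 0)"
  using b
proof (induction "\<kappa> b" arbitrary: b rule: less_induct)
  case (less b)
  obtain f where f: "f \<in> L" "f b \<noteq> 0" "\<And>b'. f b' \<noteq> 0 \<Longrightarrow> \<kappa> b' \<le> \<kappa> b"
    using less.prems by (auto simp: leading_positions_def)
  define E where "E = {b'. f b' \<noteq> 0 \<and> b' \<noteq> b \<and> b' \<in> leading_positions \<kappa> L}"
  have E: "finite E"
    using fin[OF f(1)] by (auto simp: E_def elim: rev_finite_subset)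
  have "\<kappa> b' < \<kappa> b" if "b' \<in> E" for b'
  proof -
    have "\<kappa> b' \<noteq> \<kappa> b"
      using inj_onD[OF inj, of b' b] sub[OF f(1)] f(2) that by (auto simp: E_def)
    then show ?thesis using f(3)[of b'] that by (auto simp: E_def)
  qed
  then have "\<exists>g. g \<in> L \<and> g b' = 1 \<and> (\<forall>b''\<in>leading_positions \<kappa> L. b'' \<noteq> b' \<longrightarrow> g b'' = 0)"
    if "b' \<in> E" for b'
    using less.hyps[of b'] that by (auto simp: E_def)
  then obtain g where g: "\<And>b'. b' \<in> E \<Longrightarrow> g b' \<in> L" "\<And>b'. b' \<in> E \<Longrightarrow> g b' b' = 1"
    "\<And>b' b''. \<lbrakk>b' \<in> E; b'' \<in> leading_positions \<kappa> L; b'' \<noteq> b'\<rbrakk> \<Longrightarrow> g b' b'' = 0"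
    by metis
  have lin: "(\<lambda>b. f b - (\<Sum>x\<in>Y. c x * g x b)) \<in> L" if "Y \<subseteq> E" for Y c
    using finite_subset[OF that E] that
  proof (induction Y)
    case empty
    show ?case using f(1) by simp
  next
    case (insert y Y)
    then have "(\<lambda>b. (f b - (\<Sum>x\<in>Y. c x * g x b)) - c y * g y b) \<in> L"
      by (intro closed g(1)) auto
    moreover have "(\<lambda>b. (f b - (\<Sum>x\<in>Y. c x * g x b)) - c y * g y b)
        = (\<lambda>b. f b - (\<Sum>x\<in>insert y Y. c x * g x b))"
      using insert.hyps by (simp add: algebra_simps)
    ultimately show ?case by simp
  qed
  define h where "h = (\<lambda>b. f b - (\<Sum>x\<in>E. f x * g x b))"
  have h: "h \<in> L" unfolding h_def by (rule lin) simp
  have hb: "h b = f b"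
    using g(3) less.prems by (auto simp: h_def E_def intro!: sum.neutral)
  have h0: "h b' = 0" if "b' \<in> leading_positions \<kappa> L" "b' \<noteq> b" for b'
  proof -
    have "(\<Sum>x\<in>E. f x * g x b') = (\<Sum>x\<in>E. if x = b' then f x else 0)"
      using g(2,3) that(1) by (intro sum.cong) auto
    also have "\<dots> = f b'"
      using E that by (auto simp: E_def)
    finally show ?thesis by (simp add: h_def)
  qed
  \<comment> \<open>The combination is \<open>h / f b\<close>, written so that the closure assumption applies.\<close>
  have "(\<lambda>b'. h b' - (1 - 1 / f b) * h b') \<in> L"
    by (intro closed h)
  moreover have "(\<lambda>b'. h b' - (1 - 1 / f b) * h b') = (\<lambda>b'. h b' / f b)"
    by (simp add: field_simps)
  ultimately show ?case
    using f(2) hb h0 by (intro bexI[of _ "\<lambda>b'. h b' / f b"]) auto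
qed

section \<open>The monomial basis of the Weyl algebra\<close>

lemma scale_single [simp]: "scale c (Poly_Mapping.single m d) = Poly_Mapping.single m (c * d)"
  by (simp add: scale_def mult_single)

lemma lookup_scale [simp]: "Poly_Mapping.lookup (scale c p) m = c * Poly_Mapping.lookup p m"
proof -
  have "scale c p = Poly_Mapping.map ((*) c) p"
    by (simp add: scale_def mult_map_scale_conv_mult)
  then show ?thesis by (simp add: Poly_Mapping.map.rep_eq when_def)
qed

lemma vector_space_scale: "vector_space (scale :: 'a::field \<Rightarrow> ('i, 'a) mpoly \<Rightarrow> _)"
  by unfold_locales (auto intro!: poly_mapping_eqI simp: lookup_add algebra_simps)

lemma scale_eq_mult: "scale c p * q = scale c (p * q)" "p * scale c q = scale c (p * q)"
  by (simp_all add: scale_def algebra_simps)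

lemma poly_eq_sum_monomials:
  assumes "finite N" and "Poly_Mapping.keys p \<subseteq> N"
  shows "p = (\<Sum>m\<in>N. Poly_Mapping.single m (Poly_Mapping.lookup p m))"
proof (rule poly_mapping_eqI)
  fix m
  have "Poly_Mapping.lookup (\<Sum>m\<in>N. Poly_Mapping.single m (Poly_Mapping.lookup p m)) m
    = (\<Sum>m'\<in>N. if m' = m then Poly_Mapping.lookup p m' else 0)"
    by (simp add: lookup_sum lookup_single when_def)
  also have "\<dots> = Poly_Mapping.lookup p m"
    using assms by (auto simp: in_keys_iff)
  finally show "Poly_Mapping.lookup p m
    = Poly_Mapping.lookup (\<Sum>m\<in>N. Poly_Mapping.single m (Poly_Mapping.lookup p m)) m" ..
qed

lemma additive_eqI:
  fixes F G :: "('i, 'a::field) mpoly \<Rightarrow> 'b::ab_group_add"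
  assumes "\<And>p q. F (p + q) = F p + F q" and "\<And>p q. G (p + q) = G p + G q"
    and "\<And>m c. F (Poly_Mapping.single m c) = G (Poly_Mapping.single m c)"
  shows "F p = G p"
proof -
  have sum: "F' (sum f N) = (\<Sum>m\<in>N. F' (f m))" if "finite N" "\<And>p q. F' (p + q) = F' p + F' q"
    for F' :: "('i, 'a) mpoly \<Rightarrow> 'b" and f :: "('i \<Rightarrow>\<^sub>0 nat) \<Rightarrow> ('i, 'a) mpoly" and N
    using that(1)
  proof (induction N)
    case empty
    have "F' 0 = F' 0 + F' 0" using that(2)[of 0 0] by simp
    then show ?case by simp
  qed (simp add: that(2))
  show ?thesis
    by (subst (1 2) poly_eq_sum_monomials[of "Poly_Mapping.keys p" p])
       (simp_all add: sum assms)
qed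

lemma lookup_partial:
  "Poly_Mapping.lookup (partial i p) m
    = of_nat (Suc (Poly_Mapping.lookup m i)) * Poly_Mapping.lookup p (m + Poly_Mapping.single i 1)"
proof -
  let ?e = "Poly_Mapping.single i (1::nat)"
  have "(of_nat (Poly_Mapping.lookup m' i) * Poly_Mapping.lookup p m' when m' - ?e = m)
    = (if m' = m + ?e then of_nat (Suc (Poly_Mapping.lookup m i)) * Poly_Mapping.lookup p m' else 0)" for m'
  proof (cases "Poly_Mapping.lookup m' i = 0")
    case True
    then show ?thesis
      by (auto simp: when_def lookup_add)
  next
    case False
    have "m' = (m' - ?e) + ?e"
      by (rule poly_mapping_eqI) (use False in \<open>auto simp: lookup_add lookup_minus lookup_single when_def\<close>)
    then have "m' - ?e = m \<longleftrightarrow> m' = m + ?e" by auto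
    then show ?thesis by (auto simp: when_def lookup_add)
  qed
  then have "Poly_Mapping.lookup (partial i p) m = (\<Sum>m'\<in>Poly_Mapping.keys p.
      if m' = m + ?e then of_nat (Suc (Poly_Mapping.lookup m i)) * Poly_Mapping.lookup p m' else 0)"
    by (simp add: partial_def lookup_sum lookup_single)
  then show ?thesis
    by (auto simp: in_keys_iff)
qed

lemma partial_add: "partial i (p + q) = partial i p + partial i q"
  by (rule poly_mapping_eqI) (simp add: lookup_partial lookup_add algebra_simps)

lemma partial_scale: "partial i (scale c p) = scale c (partial i p)"
  by (rule poly_mapping_eqI) (simp add: lookup_partial algebra_simps)

lemma partial_single:
  "partial i (Poly_Mapping.single m c)
    = Poly_Mapping.single (m - Poly_Mapping.single i 1) (of_nat (Poly_Mapping.lookup m i) * c)"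
  by (cases "c = 0") (simp_all add: partial_def)

lemma partial_commute: "partial i \<circ> partial j = partial j \<circ> partial i"
proof
  fix p
  show "(partial i \<circ> partial j) p = (partial j \<circ> partial i) p"
  proof (rule poly_mapping_eqI)
    fix m
    show "Poly_Mapping.lookup ((partial i \<circ> partial j) p) m = Poly_Mapping.lookup ((partial j \<circ> partial i) p) m"
      by (cases "i = j") (simp_all add: lookup_partial lookup_add lookup_single algebra_simps)
  qed
qed

lemma partial_monomial_mult:
  fixes c :: "'a::field"
  shows
  "partial i (Poly_Mapping.single l c * p)
    = Poly_Mapping.single (l - Poly_Mapping.single i 1) (of_nat (Poly_Mapping.lookup l i) * c) * p
      + Poly_Mapping.single l c * partial i p"
proof (rule additive_eqI[where p = p])
  fix m and d :: 'a
  let ?e = "Poly_Mapping.single i (1::nat)"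
  have 1: "Poly_Mapping.single (l + m - ?e) (of_nat (Poly_Mapping.lookup l i) * c * d)
      = Poly_Mapping.single (l - ?e + m) (of_nat (Poly_Mapping.lookup l i) * c * d)"
  proof (cases "Poly_Mapping.lookup l i = 0")
    case False
    then have "l + m - ?e = l - ?e + m"
      by (intro poly_mapping_eqI) (auto simp: lookup_add lookup_minus lookup_single when_def)
    then show ?thesis by simp
  qed simp
  have 2: "Poly_Mapping.single (l + m - ?e) (c * (of_nat (Poly_Mapping.lookup m i) * d))
      = Poly_Mapping.single (l + (m - ?e)) (c * (of_nat (Poly_Mapping.lookup m i) * d))"
  proof (cases "Poly_Mapping.lookup m i = 0")
    case False
    then have "l + m - ?e = l + (m - ?e)"
      by (intro poly_mapping_eqI) (auto simp: lookup_add lookup_minus lookup_single when_def)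
    then show ?thesis by simp
  qed simp
  show "partial i (Poly_Mapping.single l c * Poly_Mapping.single m d)
    = Poly_Mapping.single (l - ?e) (of_nat (Poly_Mapping.lookup l i) * c) * Poly_Mapping.single m d
      + Poly_Mapping.single l c * partial i (Poly_Mapping.single m d)"
  proof -
    have "partial i (Poly_Mapping.single l c * Poly_Mapping.single m d)
      = Poly_Mapping.single (l + m - ?e) (of_nat (Poly_Mapping.lookup l i) * c * d)
        + Poly_Mapping.single (l + m - ?e) (c * (of_nat (Poly_Mapping.lookup m i) * d))"
      by (simp add: mult_single partial_single lookup_add single_add[symmetric] algebra_simps)
    then show ?thesis
      unfolding 1 2 by (simp add: mult_single partial_single)
  qed
qed (simp_all add: partial_add algebra_simps)

lemma funpow_commute:
  assumes "f \<circ> g = g \<circ> f"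
  shows "(f ^^ a) \<circ> (g ^^ b) = (g ^^ b) \<circ> (f ^^ a)"
proof -
  have *: "(f ^^ a) \<circ> g = g \<circ> (f ^^ a)"
  proof (induction a)
    case (Suc a)
    have "(f ^^ Suc a) \<circ> g = f \<circ> ((f ^^ a) \<circ> g)" by (simp add: o_assoc)
    also have "\<dots> = (f \<circ> g) \<circ> (f ^^ a)" unfolding Suc by (simp add: o_assoc)
    also have "\<dots> = g \<circ> (f ^^ Suc a)" unfolding assms by (simp add: o_assoc)
    finally show ?case .
  qed simp
  show ?thesis
  proof (induction b)
    case (Suc b)
    have "(f ^^ a) \<circ> (g ^^ Suc b) = ((f ^^ a) \<circ> g) \<circ> (g ^^ b)" by (simp add: o_assoc)
    also have "\<dots> = g \<circ> ((f ^^ a) \<circ> (g ^^ b))" unfolding * by (simp add: o_assoc)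
    also have "\<dots> = (g ^^ Suc b) \<circ> (f ^^ a)" unfolding Suc by (simp add: o_assoc)
    finally show ?case .
  qed simp
qed

lemma op_power_Suc:
  assumes comm: "\<And>i j. g i \<circ> g j = g j \<circ> g i"
  shows "op_power g (k(i := Suc (k i))) = g i \<circ> op_power g k"
proof -
  let ?f = "\<lambda>k i h. (g i ^^ k i) \<circ> h"
  have cfc: "comp_fun_commute_on UNIV (?f k)" for k
  proof
    fix a b
    have "(g b ^^ k b) \<circ> (g a ^^ k a) = (g a ^^ k a) \<circ> (g b ^^ k b)"
      by (rule funpow_commute[OF comm])
    then show "?f k b \<circ> ?f k a = ?f k a \<circ> ?f k b"
      by (simp add: fun_eq_iff)
  qed
  have rec: "op_power g k = (g i ^^ k i) \<circ> Finite_Set.fold (?f k) id (UNIV - {i})" for k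
    unfolding op_power_def
    using comp_fun_commute_on.fold_rec[OF cfc[of k], of UNIV i id] by simp
  have "Finite_Set.fold (?f (k(i := Suc (k i)))) id (UNIV - {i}) = Finite_Set.fold (?f k) id (UNIV - {i})"
    by (rule Finite_Set.fold_cong[OF cfc cfc]) auto
  then show ?thesis
    by (simp add: rec[of k] rec[of "k(i := Suc (k i))"] o_assoc)
qed

lemma op_power_zero: "op_power g (\<lambda>_. 0) = id"
proof -
  have "Finite_Set.fold (\<lambda>i f. f) id A = id" for A :: "'c set"
    by (induction A rule: infinite_finite_induct)
       (simp_all add: comp_fun_commute_on.fold_insert[where S = UNIV] comp_fun_commute_on_def)
  then show ?thesis by (simp add: op_power_def)
qed

text \<open>
  By commutativity the order in which the fold composes the factors does not matter, so the power is
  built by prepending one factor at a time.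
\<close>

lemma op_power_induct:
  assumes comm: "\<And>i j. g i \<circ> g j = g j \<circ> g i"
    and zero: "P id (\<lambda>_. 0)"
    and step: "\<And>i h k. P h k \<Longrightarrow> P (g i \<circ> h) (k(i := Suc (k i)))"
  shows "P (op_power g k) k"
proof (induction "sum k UNIV" arbitrary: k rule: less_induct)
  case less
  show ?case
  proof (cases "k = (\<lambda>_. 0)")
    case True
    then show ?thesis using zero by (simp add: op_power_zero)
  next
    case False
    then obtain i where "k i \<noteq> 0" by auto
    then obtain a where a: "k i = Suc a" by (cases "k i") auto
    let ?k = "k(i := a)"
    have k: "k = ?k(i := Suc (?k i))" using a by auto
    have "sum ?k UNIV < sum k UNIV"
      by (rule sum_strict_mono_ex1) (auto simp: a)
    then have "P (op_power g ?k) ?k" by (rule less)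
    then have "P (g i \<circ> op_power g ?k) (?k(i := Suc (?k i)))" by (rule step)
    then show ?thesis using k op_power_Suc[of g ?k i, OF comm] by simp
  qed
qed

definition exponent :: "('i::finite \<Rightarrow> nat) \<Rightarrow> 'i \<Rightarrow>\<^sub>0 nat"
  where "exponent = Poly_Mapping.Abs_poly_mapping"

lemma lookup_exponent [simp]: "Poly_Mapping.lookup (exponent k) = k"
  by (simp add: exponent_def)

lemma exponent_Suc: "exponent (k(i := Suc (k i))) = Poly_Mapping.single i 1 + exponent k"
  by (rule poly_mapping_eqI) (auto simp: lookup_add lookup_single when_def)

lemma xi_commute: "xi i \<circ> xi j = xi j \<circ> xi i"
  by (simp add: fun_eq_iff xi_def mult.left_commute)

lemma op_power_xi:
  fixes p :: "('n::finite, 'a::field) mpoly"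
  shows "op_power xi k p = Poly_Mapping.single (exponent k) 1 * p"
proof -
  have "\<forall>p::('n, 'a) mpoly. op_power xi k p = Poly_Mapping.single (exponent k) 1 * p"
  proof (rule op_power_induct[where g = xi, OF xi_commute, where P = "\<lambda>h k. \<forall>p::('n, 'a) mpoly. h p = Poly_Mapping.single (exponent k) 1 * p"])
    have "exponent (\<lambda>_. 0) = (0 :: 'n \<Rightarrow>\<^sub>0 nat)" by (rule poly_mapping_eqI) simp
    then show "\<forall>p::('n, 'a) mpoly. id p = Poly_Mapping.single (exponent (\<lambda>_. 0)) 1 * p" by simp
  qed (simp add: exponent_Suc xi_def mult.assoc[symmetric] mult_single)
  then show ?thesis ..
qed

text \<open>
  The coefficient \<open>c m\<close> is a product of falling factorials. Only its vanishing is recorded: in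
  characteristic \<open>0\<close> it vanishes exactly when the monomial is differentiated too often. This is what
  separates the basis elements in \<open>normal_op_eq_zeroD\<close>.
\<close>

lemma op_power_partial_monomial:
  "\<exists>c. (\<forall>m. op_power partial k (Poly_Mapping.single m (1::'a::field_char_0)) = Poly_Mapping.single (m - exponent k) (c m)
    \<and> (c m \<noteq> 0 \<longleftrightarrow> (\<forall>i. k i \<le> Poly_Mapping.lookup m i)))"
proof (rule op_power_induct[where g = partial, OF partial_commute, where P = "\<lambda>h k. \<exists>c. (\<forall>m. h (Poly_Mapping.single m (1::'a)) = Poly_Mapping.single (m - exponent k) (c m)
    \<and> (c m \<noteq> 0 \<longleftrightarrow> (\<forall>i. k i \<le> Poly_Mapping.lookup m i)))"])
  have "exponent (\<lambda>_. 0) = (0 :: 'b \<Rightarrow>\<^sub>0 nat)" by (rule poly_mapping_eqI) simp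
  then show "\<exists>c. (\<forall>m. id (Poly_Mapping.single m (1::'a)) = Poly_Mapping.single (m - exponent (\<lambda>_::'b. 0)) (c m)
    \<and> (c m \<noteq> 0 \<longleftrightarrow> (\<forall>i::'b. 0 \<le> Poly_Mapping.lookup m i)))"
    by (intro exI[of _ "\<lambda>_. 1"]) simp
next
  fix i :: 'b and h :: "('b, 'a) operator" and k
  assume "\<exists>c. (\<forall>m. h (Poly_Mapping.single m (1::'a)) = Poly_Mapping.single (m - exponent k) (c m)
    \<and> (c m \<noteq> 0 \<longleftrightarrow> (\<forall>i. k i \<le> Poly_Mapping.lookup m i)))"
  then obtain c where c: "\<And>m. h (Poly_Mapping.single m (1::'a)) = Poly_Mapping.single (m - exponent k) (c m)"
    "\<And>m. c m \<noteq> 0 \<longleftrightarrow> (\<forall>i. k i \<le> Poly_Mapping.lookup m i)"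
    by blast
  have "m - exponent k - Poly_Mapping.single i 1 = m - exponent (k(i := Suc (k i)))" for m
    by (rule poly_mapping_eqI) (auto simp: lookup_minus lookup_single when_def)
  moreover have "(of_nat (Poly_Mapping.lookup m i - k i) * c m \<noteq> 0)
      \<longleftrightarrow> (\<forall>j. (k(i := Suc (k i))) j \<le> Poly_Mapping.lookup m j)" for m
    using c(2)[of m] by (auto simp: Suc_le_eq intro: order_less_imp_le)
  ultimately show "\<exists>c. (\<forall>m. (partial i \<circ> h) (Poly_Mapping.single m (1::'a))
      = Poly_Mapping.single (m - exponent (k(i := Suc (k i)))) (c m)
    \<and> (c m \<noteq> 0 \<longleftrightarrow> (\<forall>j. (k(i := Suc (k i))) j \<le> Poly_Mapping.lookup m j)))"
    by (intro exI[of _ "\<lambda>m. of_nat (Poly_Mapping.lookup m i - k i) * c m"])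
       (simp add: c(1) partial_single lookup_minus)
qed

lemma weyl_monom_eq:
  "weyl_monom \<nu> p = Poly_Mapping.single (exponent (\<lambda>i. Poly_Mapping.lookup \<nu> (Inl i))) 1 *
    op_power partial (\<lambda>i. Poly_Mapping.lookup \<nu> (Inr i)) p"
  by (simp add: weyl_monom_def op_power_xi)

lemma xi_weyl_monom:
  fixes p :: "('n::finite, 'a::field) mpoly"
  shows "xi i (weyl_monom \<nu> p) = weyl_monom (Poly_Mapping.single (Inl i) 1 + \<nu>) p"
proof -
  have "(\<lambda>j. Poly_Mapping.lookup (Poly_Mapping.single (Inl i) 1 + \<nu>) (Inl j))
      = (\<lambda>j. Poly_Mapping.lookup \<nu> (Inl j))(i := Suc (Poly_Mapping.lookup \<nu> (Inl i)))"
    by (auto simp: lookup_add lookup_single when_def)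
  moreover have "(\<lambda>j. Poly_Mapping.lookup (Poly_Mapping.single (Inl i) 1 + \<nu>) (Inr j))
      = (\<lambda>j. Poly_Mapping.lookup \<nu> (Inr j))"
    by (auto simp: lookup_add lookup_single when_def)
  ultimately show ?thesis
    unfolding weyl_monom_def
    using op_power_Suc[where g = "xi :: 'n \<Rightarrow> ('n, 'a) operator", OF xi_commute, of "\<lambda>j. Poly_Mapping.lookup \<nu> (Inl j)" i]
    by simp
qed

text \<open>
  Moving \<open>\<partial>\<^sub>i\<close> to the right past \<open>\<xi>\<close> to the power \<open>\<lambda>\<close> costs the commutator, a multiple of a
  monomial with one \<open>\<xi>\<^sub>i\<close> and one \<open>\<partial>\<^sub>i\<close> fewer than the main term.
\<close>

lemma partial_weyl_monom:
  fixes p :: "('n::finite, 'a::field) mpoly"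
  shows "partial i (weyl_monom \<nu> p) = weyl_monom (Poly_Mapping.single (Inr i) 1 + \<nu>) p
    + scale (of_nat (Poly_Mapping.lookup \<nu> (Inl i))) (weyl_monom (\<nu> - Poly_Mapping.single (Inl i) 1) p)"
proof -
  let ?l = "\<lambda>\<nu> j. Poly_Mapping.lookup \<nu> (Inl j)" and ?r = "\<lambda>\<nu> j. Poly_Mapping.lookup \<nu> (Inr j)"
  let ?q = "op_power partial (?r \<nu>) p"
  have 1: "?l (Poly_Mapping.single (Inr i) 1 + \<nu>) = ?l \<nu>"
      "?r (\<nu> - Poly_Mapping.single (Inl i) 1) = ?r \<nu>"
      "exponent (?l (\<nu> - Poly_Mapping.single (Inl i) 1)) = exponent (?l \<nu>) - Poly_Mapping.single i 1"
      "?r (Poly_Mapping.single (Inr i) 1 + \<nu>) = (?r \<nu>)(i := Suc (?r \<nu> i))"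
    by (auto intro!: poly_mapping_eqI simp: lookup_add lookup_minus lookup_single when_def)
  have "partial i (weyl_monom \<nu> p)
      = Poly_Mapping.single (exponent (?l \<nu>) - Poly_Mapping.single i 1) (of_nat (?l \<nu> i)) * ?q
        + Poly_Mapping.single (exponent (?l \<nu>)) 1 * partial i ?q"
    by (simp add: weyl_monom_eq partial_monomial_mult)
  also have "partial i ?q = op_power partial (?r (Poly_Mapping.single (Inr i) 1 + \<nu>)) p"
    using op_power_Suc[where g = "partial :: 'n \<Rightarrow> ('n, 'a) operator", OF partial_commute, of "?r \<nu>" i] unfolding 1 by simp
  also have "Poly_Mapping.single (exponent (?l \<nu>) - Poly_Mapping.single i 1) (of_nat (?l \<nu> i)) * ?q
     = scale (of_nat (?l \<nu> i)) (weyl_monom (\<nu> - Poly_Mapping.single (Inl i) 1) p)"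
    unfolding weyl_monom_eq 1 by (simp add: scale_eq_mult(1)[symmetric])
  finally show ?thesis
    unfolding weyl_monom_eq[of "Poly_Mapping.single (Inr i) 1 + \<nu>"] 1 by (simp add: add.commute)
qed

lemma scale_simps [simp]:
  "scale 0 p = 0" "scale 1 p = p" "scale c (p + q) = scale c p + scale c q" "scale c 0 = 0"
  "scale c (scale d p) = scale (c * d) p" "scale (- c) p = - scale c p" "scale c (- p) = - scale c p"
  by (rule poly_mapping_eqI, simp add: lookup_add lookup_uminus algebra_simps)+

lemma scale_add_left: "scale (c + d) p = scale c p + scale d p"
  by (rule poly_mapping_eqI) (simp add: lookup_add algebra_simps)

lemma scale_sum: "scale c (sum f A) = (\<Sum>x\<in>A. scale c (f x))"
  by (induction A rule: infinite_finite_induct) simp_all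

lemma normal_op_superset:
  assumes "finite N" and "Poly_Mapping.keys c \<subseteq> N"
  shows "normal_op c p = (\<Sum>\<nu>\<in>N. scale (Poly_Mapping.lookup c \<nu>) (weyl_monom \<nu> p))"
  unfolding normal_op_def
  by (rule sum.mono_neutral_left) (use assms in \<open>auto simp: in_keys_iff\<close>)

lemma normal_op_single: "normal_op (Poly_Mapping.single \<nu> c) p = scale c (weyl_monom \<nu> p)"
  by (subst normal_op_superset[of "{\<nu>}"]) auto

lemma normal_op_add: "normal_op (c + d) p = normal_op c p + normal_op d p"
proof -
  let ?N = "Poly_Mapping.keys c \<union> Poly_Mapping.keys d"
  have "normal_op (c + d) p = (\<Sum>\<nu>\<in>?N. scale (Poly_Mapping.lookup (c + d) \<nu>) (weyl_monom \<nu> p))"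
    by (rule normal_op_superset) (auto simp: Poly_Mapping.keys_add)
  moreover have "normal_op c p = (\<Sum>\<nu>\<in>?N. scale (Poly_Mapping.lookup c \<nu>) (weyl_monom \<nu> p))"
    "normal_op d p = (\<Sum>\<nu>\<in>?N. scale (Poly_Mapping.lookup d \<nu>) (weyl_monom \<nu> p))"
    by (rule normal_op_superset; auto)+
  ultimately show ?thesis
    by (simp add: lookup_add scale_add_left sum.distrib)
qed

lemma normal_op_scale: "normal_op (scale k c) p = scale k (normal_op c p)"
  by (subst (1 2) normal_op_superset[of "Poly_Mapping.keys c"])
     (auto simp: in_keys_iff scale_sum)

lemma normal_op_zero [simp]: "normal_op 0 p = 0"
  by (simp add: normal_op_def)

lemma normal_op_uminus: "normal_op (- c) p = - normal_op c p"
  using normal_op_scale[of "- 1" c p] by simp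

lemma normal_op_sum: "normal_op (sum f A) p = (\<Sum>x\<in>A. normal_op (f x) p)"
  by (induction A rule: infinite_finite_induct) (simp_all add: normal_op_add)

lemma normal_op_one [simp]: "normal_op 1 p = p"
proof -
  have "weyl_monom 0 p = p"
    by (simp add: weyl_monom_def op_power_zero)
  then show ?thesis
    using normal_op_single[of 0 1 p] by simp
qed

lemma xi_linear: "xi i (p + q) = xi i p + xi i q" "xi i (scale c p) = scale c (xi i p)"
  by (simp_all add: xi_def algebra_simps scale_eq_mult)

lemma weyl_monom_linear:
  fixes p q :: "('n::finite, 'a::field) mpoly"
  shows "weyl_monom \<nu> (p + q) = weyl_monom \<nu> p + weyl_monom \<nu> q"
    and "weyl_monom \<nu> (scale c p) = scale c (weyl_monom \<nu> p)"
proof -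
  let ?P = "\<lambda>(h :: ('n, 'a) operator) k. (\<forall>p q. h (p + q) = h p + h q) \<and> (\<forall>c p. h (scale c p) = scale c (h p))"
  have "?P (op_power xi k) k" for k
    by (rule op_power_induct[where g = "xi :: 'n \<Rightarrow> ('n, 'a) operator" and P = ?P, OF xi_commute])
       (simp_all add: xi_linear)
  moreover have "?P (op_power partial k) k" for k
    by (rule op_power_induct[where g = "partial :: 'n \<Rightarrow> ('n, 'a) operator" and P = ?P, OF partial_commute])
       (simp_all add: partial_add partial_scale)
  ultimately show "weyl_monom \<nu> (p + q) = weyl_monom \<nu> p + weyl_monom \<nu> q"
    "weyl_monom \<nu> (scale c p) = scale c (weyl_monom \<nu> p)"
    by (simp_all add: weyl_monom_def)
qed

lemma normal_op_linear:
  "normal_op f (p + q) = normal_op f p + normal_op f q"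
  "normal_op f (scale c p) = scale c (normal_op f p)"
  by (simp_all add: normal_op_def weyl_monom_linear sum.distrib scale_sum mult.commute)

lemma xi_normal_op:
  fixes p :: "('n::finite, 'a::field) mpoly"
  shows "xi i (normal_op g p) = normal_op (Poly_Mapping.single (Poly_Mapping.single (Inl i) 1) 1 * g) p"
  by (rule additive_eqI[where p = g])
     (simp_all add: normal_op_add xi_linear algebra_simps normal_op_single xi_weyl_monom mult_single)

text \<open>
  On coefficient polynomials, left multiplication by \<open>\<partial>\<^sub>i\<close> is multiplication by \<open>Y\<^sub>i\<close> plus the
  derivation with respect to \<open>X\<^sub>i\<close>, which explains why the product of the Weyl algebra is the commutative
  product up to terms of lower weight.
\<close>

lemma partial_normal_op:
  fixes p :: "('n::finite, 'a::field) mpoly"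
  shows "partial i (normal_op g p)
    = normal_op (Poly_Mapping.single (Poly_Mapping.single (Inr i) 1) 1 * g + partial (Inl i) g) p"
  by (rule additive_eqI[where p = g])
     (simp_all add: normal_op_add partial_add partial_scale algebra_simps normal_op_single
       partial_weyl_monom mult_single partial_single)

text \<open>
  Linear independence of the monomials \<open>\<xi>\<^sup>\<lambda>\<partial>\<^sup>\<mu>\<close>. Choose \<open>(\<lambda>|\<mu>)\<close> in the support with \<open>\<mu>\<close> of least total
  degree and apply the operator to \<open>X\<^sup>\<mu>\<close>. The terms with another exponent of \<open>\<partial>\<close> kill it, because that
  exponent has at least the same degree and so exceeds \<open>\<mu>\<close> somewhere; the remaining ones give distinct
  monomials \<open>X\<^sup>\<lambda>\<close> with nonzero coefficients.
\<close>

lemma normal_op_eq_zeroD: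
  fixes c :: "('n::finite + 'n, 'a::field_char_0) mpoly"
  assumes "\<And>p. normal_op c p = 0"
  shows "c = 0"
proof (rule ccontr)
  assume "c \<noteq> 0"
  let ?l = "\<lambda>\<nu> i. Poly_Mapping.lookup \<nu> (Inl i :: 'n + 'n)"
    and ?r = "\<lambda>\<nu> i. Poly_Mapping.lookup \<nu> (Inr i :: 'n + 'n)"
  let ?size = "\<lambda>\<nu>. sum (?r \<nu>) (UNIV :: 'n set)"
  obtain \<nu> where \<nu>: "\<nu> \<in> Poly_Mapping.keys c" "\<And>\<nu>'. \<nu>' \<in> Poly_Mapping.keys c \<Longrightarrow> ?size \<nu> \<le> ?size \<nu>'"
    using ex_has_least_nat[of "\<lambda>\<nu>. \<nu> \<in> Poly_Mapping.keys c" _ ?size] \<open>c \<noteq> 0\<close>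
    by (metis all_not_in_conv keys_eq_empty)
  let ?m = "exponent (?r \<nu>)"
  have summand: "\<exists>d. Poly_Mapping.lookup (weyl_monom \<nu>' (Poly_Mapping.single ?m 1)) (exponent (?l \<nu>))
      = (if \<nu>' = \<nu> then d else 0 :: 'a) \<and> d \<noteq> 0" if \<nu>': "\<nu>' \<in> Poly_Mapping.keys c" for \<nu>'
  proof -
    obtain cf where cf: "\<And>m. op_power partial (?r \<nu>') (Poly_Mapping.single m (1::'a))
        = Poly_Mapping.single (m - exponent (?r \<nu>')) (cf m)"
      "\<And>m. cf m \<noteq> 0 \<longleftrightarrow> (\<forall>i. ?r \<nu>' i \<le> Poly_Mapping.lookup m i)"
      using op_power_partial_monomial by metis
    have w: "weyl_monom \<nu>' (Poly_Mapping.single ?m 1)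
        = Poly_Mapping.single (exponent (?l \<nu>') + (?m - exponent (?r \<nu>'))) (cf ?m)"
      by (simp add: weyl_monom_eq cf(1) mult_single)
    show ?thesis
    proof (cases "\<forall>i. ?r \<nu>' i \<le> ?r \<nu> i")
      case True
      have eq: "?r \<nu>' = ?r \<nu>"
      proof (rule ccontr)
        assume "?r \<nu>' \<noteq> ?r \<nu>"
        then obtain i where "?r \<nu>' i \<noteq> ?r \<nu> i" by auto
        then have "?r \<nu>' i < ?r \<nu> i" using True le_neq_implies_less by blast
        then have "?size \<nu>' < ?size \<nu>"
          using True by (intro sum_strict_mono_ex1) auto
        then show False using \<nu>(2)[OF \<nu>'] by simp
      qed
      have nz: "cf ?m \<noteq> 0" using cf(2)[of ?m] True by simp
      have "\<nu>' = \<nu> \<longleftrightarrow> exponent (?l \<nu>') = exponent (?l \<nu>)"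
      proof
        assume *: "exponent (?l \<nu>') = exponent (?l \<nu>)"
        show "\<nu>' = \<nu>"
        proof (rule poly_mapping_eqI)
          fix j
          show "Poly_Mapping.lookup \<nu>' j = Poly_Mapping.lookup \<nu> j"
            using fun_cong[OF eq] arg_cong[OF *, of "\<lambda>x. Poly_Mapping.lookup x"]
            by (cases j) (auto dest: fun_cong)
        qed
      qed simp
      then show ?thesis
        using nz by (intro exI[of _ "cf ?m"]) (auto simp: w eq lookup_single when_def)
    next
      case False
      then have "cf ?m = 0" "\<nu>' \<noteq> \<nu>" using cf(2)[of ?m] by auto
      then show ?thesis by (intro exI[of _ 1]) (simp add: w)
    qed
  qed
  obtain d where d: "\<And>\<nu>'. \<nu>' \<in> Poly_Mapping.keys c \<Longrightarrow>
      Poly_Mapping.lookup (weyl_monom \<nu>' (Poly_Mapping.single ?m 1)) (exponent (?l \<nu>))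
      = (if \<nu>' = \<nu> then d \<nu>' else 0 :: 'a) \<and> d \<nu>' \<noteq> 0"
    using summand by metis
  have "Poly_Mapping.lookup (normal_op c (Poly_Mapping.single ?m 1)) (exponent (?l \<nu>))
      = (\<Sum>\<nu>'\<in>Poly_Mapping.keys c. if \<nu>' = \<nu> then Poly_Mapping.lookup c \<nu> * d \<nu> else 0)"
    unfolding normal_op_def lookup_sum by (rule sum.cong) (auto simp: d)
  also have "\<dots> = Poly_Mapping.lookup c \<nu> * d \<nu>"
    using \<nu>(1) by simp
  finally show False
    using assms[of "Poly_Mapping.single ?m 1"] \<nu>(1) d[OF \<nu>(1)] by (auto simp: in_keys_iff)
qed

lemma inj_normal_op: "inj (normal_op :: ('n::finite + 'n, 'a::field_char_0) mpoly \<Rightarrow> _)"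
proof (rule injI)
  fix c d :: "('n + 'n, 'a) mpoly"
  assume "normal_op c = normal_op d"
  then have "normal_op (c + - d) p = 0" for p
    unfolding normal_op_add normal_op_uminus by simp
  then have "c + - d = 0" by (rule normal_op_eq_zeroD)
  then show "c = d" by simp
qed

lemma weyl_coeffs_normal_op [simp]:
  "weyl_coeffs (normal_op c :: ('n::finite, 'a::field_char_0) operator) = c"
  unfolding weyl_coeffs_def by (rule the_equality) (auto dest: injD[OF inj_normal_op])

section \<open>Weights and the product of the Weyl algebra\<close>

text \<open>
  The coefficient polynomials of the operators of \<open>\<omega>\<close>-degree at most \<open>i\<close>; see \<open>Fweyl_eq\<close>.
\<close>

definition weight_le :: "('n::finite + 'n \<Rightarrow> nat) \<Rightarrow> int \<Rightarrow> ('n + 'n, 'a::field) mpoly set"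
  where "weight_le \<omega> i = {f. \<forall>\<nu>\<in>Poly_Mapping.keys f. int (wdot \<omega> \<nu>) \<le> i}"

lemma wdot_add [simp]: "wdot \<omega> (\<mu> + \<nu>) = wdot \<omega> \<mu> + wdot \<omega> \<nu>"
  by (simp add: wdot_def lookup_add algebra_simps sum.distrib)

lemma wdot_single [simp]: "wdot \<omega> (Poly_Mapping.single j a) = \<omega> j * a"
proof -
  have "wdot \<omega> (Poly_Mapping.single j a) = (\<Sum>k\<in>UNIV. if k = j then \<omega> j * a else 0)"
    unfolding wdot_def by (rule sum.cong) (auto simp: lookup_single when_def)
  then show ?thesis by simp
qed

lemma weight_le_zero [simp]: "0 \<in> weight_le \<omega> i"
  by (simp add: weight_le_def)

lemma weight_le_add: "f \<in> weight_le \<omega> i \<Longrightarrow> g \<in> weight_le \<omega> i \<Longrightarrow> f + g \<in> weight_le \<omega> i"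
  unfolding weight_le_def using Poly_Mapping.keys_add[of f g] by blast

lemma weight_le_uminus: "f \<in> weight_le \<omega> i \<Longrightarrow> - f \<in> weight_le \<omega> i"
  by (auto simp: weight_le_def in_keys_iff)

lemma weight_le_diff: "f \<in> weight_le \<omega> i \<Longrightarrow> g \<in> weight_le \<omega> i \<Longrightarrow> f - g \<in> weight_le \<omega> i"
  using weight_le_add[of f \<omega> i "- g"] weight_le_uminus by force

lemma weight_le_scale: "f \<in> weight_le \<omega> i \<Longrightarrow> scale c f \<in> weight_le \<omega> i"
  by (auto simp: weight_le_def in_keys_iff)

lemma weight_le_sum: "(\<And>x. x \<in> A \<Longrightarrow> f x \<in> weight_le \<omega> i) \<Longrightarrow> sum f A \<in> weight_le \<omega> i"
  by (induction A rule: infinite_finite_induct) (auto simp: weight_le_add)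

lemma weight_le_mono: "f \<in> weight_le \<omega> i \<Longrightarrow> i \<le> j \<Longrightarrow> f \<in> weight_le \<omega> j"
  by (force simp: weight_le_def)

lemma weight_le_mult:
  assumes "f \<in> weight_le \<omega> i" and "g \<in> weight_le \<omega> j"
  shows "f * g \<in> weight_le \<omega> (i + j)"
  unfolding weight_le_def
proof (safe)
  fix \<nu> assume "\<nu> \<in> Poly_Mapping.keys (f * g)"
  then obtain a b where "\<nu> = a + b" "a \<in> Poly_Mapping.keys f" "b \<in> Poly_Mapping.keys g"
    using Poly_Mapping.keys_mult[of f g] by blast
  then show "int (wdot \<omega> \<nu>) \<le> i + j"
    using assms by (force simp: weight_le_def)
qed

lemma weight_le_single: "int (wdot \<omega> \<nu>) \<le> i \<Longrightarrow> Poly_Mapping.single \<nu> c \<in> weight_le \<omega> i"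
  by (auto simp: weight_le_def split: if_splits)

lemma weight_le_monomial_mult:
  "g \<in> weight_le \<omega> j \<Longrightarrow> Poly_Mapping.single \<nu> c * g \<in> weight_le \<omega> (int (wdot \<omega> \<nu>) + j)"
  by (rule weight_le_mult[OF weight_le_single]) simp

lemma weight_le_partial:
  assumes "g \<in> weight_le \<omega> j"
  shows "partial k g \<in> weight_le \<omega> (j - int (\<omega> k))"
  unfolding weight_le_def
proof (safe)
  fix \<nu> assume "\<nu> \<in> Poly_Mapping.keys (partial k g)"
  then have "\<nu> + Poly_Mapping.single k 1 \<in> Poly_Mapping.keys g"
    by (simp add: in_keys_iff lookup_partial)
  then show "int (wdot \<omega> \<nu>) \<le> j - int (\<omega> k)"
    using assms unfolding weight_le_def by fastforce
qed

text \<open>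
  The polynomial \<open>r\<close> collects the commutators. Each of them loses a pair \<open>\<xi>\<^sub>i\<close>, \<open>\<partial>\<^sub>i\<close>, whose weight is
  positive for every \<open>\<omega>\<close> in \<open>Omega\<close>.
\<close>

lemma weyl_monom_normal_op:
  fixes \<nu> :: "'n::finite + 'n \<Rightarrow>\<^sub>0 nat" and g :: "('n + 'n, 'a::field) mpoly"
  shows "\<exists>r. (\<forall>p. weyl_monom \<nu> (normal_op g p) = normal_op (Poly_Mapping.single \<nu> 1 * g + r) p) \<and>
    (\<forall>\<omega>\<in>Omega. \<forall>j. g \<in> weight_le \<omega> j \<longrightarrow> r \<in> weight_le \<omega> (int (wdot \<omega> \<nu>) + j - 1))"
proof -
  define Q where "Q h \<nu> \<longleftrightarrow> (\<exists>r. (\<forall>p. h (normal_op g p) = normal_op (Poly_Mapping.single \<nu> 1 * g + r) p) \<and>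
    (\<forall>\<omega>\<in>Omega. \<forall>j. g \<in> weight_le \<omega> j \<longrightarrow> r \<in> weight_le \<omega> (int (wdot \<omega> \<nu>) + j - 1)))"
    for h :: "('n, 'a) operator" and \<nu>
  define e :: "('n \<Rightarrow> nat) \<Rightarrow> ('n \<Rightarrow> nat) \<Rightarrow> 'n + 'n \<Rightarrow>\<^sub>0 nat"
    where "e l m = exponent (case_sum l m)" for l m
  have e_Inl: "e (l(i := Suc (l i))) m = Poly_Mapping.single (Inl i) 1 + e l m"
    and e_Inr: "e l (m(i := Suc (m i))) = Poly_Mapping.single (Inr i) 1 + e l m" for l m i
    by (rule poly_mapping_eqI; auto simp: e_def lookup_add lookup_single when_def split: sum.split)+
  have Q_id: "Q id (e (\<lambda>_. 0) (\<lambda>_. 0))"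
  proof -
    have "e (\<lambda>_. 0) (\<lambda>_. 0) = 0"
      by (rule poly_mapping_eqI) (simp add: e_def split: sum.split)
    then show ?thesis
      unfolding Q_def by (intro exI[of _ 0]) simp
  qed
  have Q_xi: "Q (xi i \<circ> h) (Poly_Mapping.single (Inl i) 1 + \<nu>)" if Q: "Q h \<nu>" for i h \<nu>
  proof -
    let ?X = "Poly_Mapping.single (Poly_Mapping.single (Inl i) 1) (1::'a)"
    obtain r where r: "\<And>p. h (normal_op g p) = normal_op (Poly_Mapping.single \<nu> 1 * g + r) p"
      "\<And>\<omega> j. \<omega> \<in> Omega \<Longrightarrow> g \<in> weight_le \<omega> j \<Longrightarrow> r \<in> weight_le \<omega> (int (wdot \<omega> \<nu>) + j - 1)"
      using Q by (auto simp: Q_def)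
    have "?X * r \<in> weight_le \<omega> (int (wdot \<omega> (Poly_Mapping.single (Inl i) 1 + \<nu>)) + j - 1)"
      if "\<omega> \<in> Omega" "g \<in> weight_le \<omega> j" for \<omega> j
      using weight_le_monomial_mult[OF r(2)[OF that], of "Poly_Mapping.single (Inl i) 1" 1]
      by (simp add: algebra_simps)
    then show ?thesis
      unfolding Q_def
      by (intro exI[of _ "?X * r"])
         (simp add: r(1) xi_normal_op distrib_left mult.assoc[symmetric] mult_single)
  qed
  have Q_partial: "Q (partial i \<circ> h) (Poly_Mapping.single (Inr i) 1 + \<nu>)" if Q: "Q h \<nu>" for i h \<nu>
  proof -
    let ?Y = "Poly_Mapping.single (Poly_Mapping.single (Inr i) 1) (1::'a)"
    obtain r where r: "\<And>p. h (normal_op g p) = normal_op (Poly_Mapping.single \<nu> 1 * g + r) p"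
      "\<And>\<omega> j. \<omega> \<in> Omega \<Longrightarrow> g \<in> weight_le \<omega> j \<Longrightarrow> r \<in> weight_le \<omega> (int (wdot \<omega> \<nu>) + j - 1)"
      using Q by (auto simp: Q_def)
    let ?s = "?Y * r + partial (Inl i) (Poly_Mapping.single \<nu> 1 * g + r)"
    have "?s \<in> weight_le \<omega> (int (wdot \<omega> (Poly_Mapping.single (Inr i) 1 + \<nu>)) + j - 1)"
      if \<omega>: "\<omega> \<in> Omega" and j: "g \<in> weight_le \<omega> j" for \<omega> j
    proof (rule weight_le_add)
      show "?Y * r \<in> weight_le \<omega> (int (wdot \<omega> (Poly_Mapping.single (Inr i) 1 + \<nu>)) + j - 1)"
        using weight_le_monomial_mult[OF r(2)[OF that], of "Poly_Mapping.single (Inr i) 1" 1]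
        by (simp add: algebra_simps)
      have "Poly_Mapping.single \<nu> 1 * g + r \<in> weight_le \<omega> (int (wdot \<omega> \<nu>) + j)"
        by (intro weight_le_add weight_le_monomial_mult j weight_le_mono[OF r(2)[OF that]]) simp
      then have "partial (Inl i) (Poly_Mapping.single \<nu> 1 * g + r)
          \<in> weight_le \<omega> (int (wdot \<omega> \<nu>) + j - int (\<omega> (Inl i)))"
        by (rule weight_le_partial)
      moreover have "0 < \<omega> (Inl i) + \<omega> (Inr i)"
        using \<omega> by (simp add: Omega_def)
      ultimately show "partial (Inl i) (Poly_Mapping.single \<nu> 1 * g + r)
          \<in> weight_le \<omega> (int (wdot \<omega> (Poly_Mapping.single (Inr i) 1 + \<nu>)) + j - 1)"
        by (elim weight_le_mono) (simp, linarith)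
    qed
    then show ?thesis
      unfolding Q_def
      by (intro exI[of _ ?s])
         (simp add: r(1) partial_normal_op distrib_left mult.assoc[symmetric] mult_single add.assoc)
  qed
  let ?l = "\<lambda>i. Poly_Mapping.lookup \<nu> (Inl i)" and ?r = "\<lambda>i. Poly_Mapping.lookup \<nu> (Inr i)"
  have "Q (op_power partial ?r) (e (\<lambda>_. 0) ?r)"
    by (rule op_power_induct[where g = "partial :: 'n \<Rightarrow> ('n, 'a) operator"
        and P = "\<lambda>h k. Q h (e (\<lambda>_. 0) k)", OF partial_commute Q_id]) (simp only: e_Inr Q_partial)
  then have "Q (op_power xi ?l \<circ> op_power partial ?r) (e ?l ?r)"
    by (intro op_power_induct[where g = "xi :: 'n \<Rightarrow> ('n, 'a) operator"
        and P = "\<lambda>h k. Q (h \<circ> op_power partial ?r) (e k ?r)", OF xi_commute])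
       (simp_all only: e_Inl Q_xi o_assoc[symmetric] id_o)
  moreover have "e ?l ?r = \<nu>"
    by (rule poly_mapping_eqI) (simp add: e_def split: sum.split)
  ultimately show ?thesis
    unfolding Q_def weyl_monom_def by simp
qed

definition star :: "('n::finite + 'n, 'a::field_char_0) mpoly \<Rightarrow> ('n + 'n, 'a) mpoly \<Rightarrow> ('n + 'n, 'a) mpoly"
  where "star f g = weyl_coeffs (normal_op f \<circ> normal_op g)"

lemma
  fixes f g :: "('n::finite + 'n, 'a::field_char_0) mpoly"
  shows normal_op_star: "normal_op (star f g) = normal_op f \<circ> normal_op g" (is ?mult)
    and star_diff_mult_weight_le: "\<lbrakk>\<omega> \<in> Omega; f \<in> weight_le \<omega> i; g \<in> weight_le \<omega> j\<rbrakk> \<Longrightarrow> star f g - f * g \<in> weight_le \<omega> (i + j - 1)"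
proof -
  obtain r where r: "\<And>\<nu> p. weyl_monom \<nu> (normal_op g p) = normal_op (Poly_Mapping.single \<nu> 1 * g + r \<nu>) p"
    "\<And>\<nu> \<omega> j. \<omega> \<in> Omega \<Longrightarrow> g \<in> weight_le \<omega> j \<Longrightarrow> r \<nu> \<in> weight_le \<omega> (int (wdot \<omega> \<nu>) + j - 1)"
    using weyl_monom_normal_op[of _ g] by metis
  let ?s = "\<Sum>\<nu>\<in>Poly_Mapping.keys f. scale (Poly_Mapping.lookup f \<nu>) (r \<nu>)"
  have f: "f = (\<Sum>\<nu>\<in>Poly_Mapping.keys f. Poly_Mapping.single \<nu> (Poly_Mapping.lookup f \<nu>))"
    by (rule poly_eq_sum_monomials) auto
  have fg: "f * g = (\<Sum>\<nu>\<in>Poly_Mapping.keys f. scale (Poly_Mapping.lookup f \<nu>) (Poly_Mapping.single \<nu> 1 * g))"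
    by (subst f) (simp add: sum_distrib_right scale_eq_mult(1)[symmetric])
  have "normal_op f (normal_op g p) = normal_op (f * g + ?s) p" for p
  proof -
    have "normal_op f (normal_op g p)
        = (\<Sum>\<nu>\<in>Poly_Mapping.keys f. scale (Poly_Mapping.lookup f \<nu>) (normal_op (Poly_Mapping.single \<nu> 1 * g + r \<nu>) p))"
      unfolding normal_op_def[of f] r(1) ..
    then show ?thesis
      unfolding fg by (simp add: normal_op_add normal_op_sum normal_op_scale sum.distrib)
  qed
  then have "normal_op f \<circ> normal_op g = normal_op (f * g + ?s)"
    by (simp add: fun_eq_iff)
  then have star: "star f g = f * g + ?s" "?mult"
    by (simp_all add: star_def)
  show ?mult by (rule star)
  assume \<omega>: "\<omega> \<in> Omega" and f: "f \<in> weight_le \<omega> i" and g: "g \<in> weight_le \<omega> j"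
  have "scale (Poly_Mapping.lookup f \<nu>) (r \<nu>) \<in> weight_le \<omega> (i + j - 1)" if "\<nu> \<in> Poly_Mapping.keys f" for \<nu>
    using f that by (intro weight_le_scale weight_le_mono[OF r(2)[OF \<omega> g]]) (auto simp: weight_le_def)
  then show "star f g - f * g \<in> weight_le \<omega> (i + j - 1)"
    by (simp add: star(1) weight_le_sum)
qed

section \<open>Operators and their coefficient polynomials\<close>

lemma carrier_end_ring_iff:
  "f \<in> carrier end_ring \<longleftrightarrow> (\<forall>p q. f (p + q) = f p + f q) \<and> (\<forall>c p. f (scale c p) = scale c (f p))"
  by (simp add: end_ring_def Vector_Spaces.linear_iff vector_space_scale)

lemma end_ring_simps [simp]:
  "monoid.mult end_ring = (\<circ>)" "one end_ring = id" "zero end_ring = (\<lambda>p. 0)"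
  "add end_ring = (\<lambda>f g p. f p + g p)"
  by (simp_all add: end_ring_def)

lemma end_ring_a_inv:
  fixes f :: "('n, 'a::field) operator"
  assumes "f \<in> carrier end_ring"
  shows "\<ominus>\<^bsub>end_ring\<^esub> f = (\<lambda>p. - f p)"
proof -
  have neg: "(\<lambda>p. - g p) \<in> carrier end_ring" if "g \<in> carrier end_ring" for g :: "('n, 'a) operator"
    using that by (auto simp: carrier_end_ring_iff)
  interpret abelian_group "end_ring :: ('n, 'a) operator ring"
  proof (rule abelian_groupI)
    fix g :: "('n, 'a) operator" assume "g \<in> carrier end_ring"
    then show "\<exists>h\<in>carrier end_ring. h \<oplus>\<^bsub>end_ring\<^esub> g = \<zero>\<^bsub>end_ring\<^esub>"
      using neg by (intro bexI[of _ "\<lambda>p. - g p"]) auto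
  qed (auto simp: carrier_end_ring_iff algebra_simps)
  show ?thesis
    by (rule minus_equality) (use assms neg in auto)
qed

lemma normal_op_in_end_ring: "normal_op c \<in> carrier end_ring"
  by (simp add: carrier_end_ring_iff normal_op_linear)

text \<open>
  The operators in normal form contain the generators and are closed under the ring operations, since
  \<open>partial_normal_op\<close> and \<open>star\<close> bring any product into normal form.
\<close>

lemma carrier_weyl:
  "carrier (weyl :: ('n::finite, 'a::field_char_0) operator ring) = range normal_op"
proof -
  let ?G = "generate_ring end_ring (range scale \<union> range xi \<union> range partial) :: ('n, 'a) operator set"
  have "h \<in> range normal_op" if "h \<in> ?G" for h
    using that
  proof (induction h rule: generate_ring.induct)
    case one
    show ?case by (rule range_eqI[of _ _ 1]) auto
  next
    case (incl h)
    then consider c where "h = scale c" | i where "h = xi i" | i where "h = partial i" by auto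
    then show ?case
    proof cases
      case 1
      have "scale c p = normal_op (scale c 1) p" for p :: "('n, 'a) mpoly"
        by (simp only: normal_op_scale normal_op_one)
      then show ?thesis using 1 by blast
    next
      case 2
      have "xi i p = normal_op (Poly_Mapping.single (Poly_Mapping.single (Inl i) 1) 1 * 1) p" for p :: "('n, 'a) mpoly"
        by (simp only: xi_normal_op[symmetric] normal_op_one)
      then show ?thesis using 2 by blast
    next
      case 3
      have "partial i p = normal_op (Poly_Mapping.single (Poly_Mapping.single (Inr i) 1) 1 * 1 + partial (Inl i) 1) p"
        for p :: "('n, 'a) mpoly"
        by (simp only: partial_normal_op[symmetric] normal_op_one)
      then show ?thesis using 3 by blast
    qed
  next
    case (a_inv h)
    then obtain c where "h = normal_op c" by auto
    moreover have "\<ominus>\<^bsub>end_ring\<^esub> normal_op c = normal_op (- c)"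
      unfolding end_ring_a_inv[OF normal_op_in_end_ring] by (simp add: normal_op_uminus fun_eq_iff)
    ultimately have "\<ominus>\<^bsub>end_ring\<^esub> h = normal_op (- c)" by simp
    then show ?case by auto
  next
    case (eng_add h1 h2)
    then obtain c d where "h1 = normal_op c" "h2 = normal_op d" by auto
    then have "h1 \<oplus>\<^bsub>end_ring\<^esub> h2 = normal_op (c + d)"
      by (simp add: normal_op_add fun_eq_iff)
    then show ?case by auto
  next
    case (eng_mult h1 h2)
    then obtain c d where "h1 = normal_op c" "h2 = normal_op d" by auto
    then have "h1 \<otimes>\<^bsub>end_ring\<^esub> h2 = normal_op (star c d)"
      by (simp add: normal_op_star)
    then show ?case by auto
  qed
  moreover have "normal_op c \<in> ?G" for c
  proof -
    have comp: "g \<circ> h \<in> ?G" if "g \<in> ?G" "h \<in> ?G" for g h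
      using generate_ring.eng_mult[OF that] by simp
    have id: "id \<in> ?G" using generate_ring.one[of end_ring] by simp
    have scale: "scale c \<in> ?G" and xi: "xi i \<in> ?G" and partial: "partial i \<in> ?G" for c i
      by (rule generate_ring.incl; blast)+
    have "op_power xi k \<in> ?G" for k
      by (rule op_power_induct[where g = "xi :: 'n \<Rightarrow> ('n, 'a) operator" and P = "\<lambda>h k. h \<in> ?G", OF xi_commute id])
        (intro comp xi)
    moreover have "op_power partial k \<in> ?G" for k
      by (rule op_power_induct[where g = "partial :: 'n \<Rightarrow> ('n, 'a) operator" and P = "\<lambda>h k. h \<in> ?G", OF partial_commute id])
        (intro comp partial)
    ultimately have monom: "weyl_monom \<nu> \<in> ?G" for \<nu>
      unfolding weyl_monom_def by (intro comp)
    have "(\<lambda>p. \<Sum>\<nu>\<in>N. scale (d \<nu>) (weyl_monom \<nu> p)) \<in> ?G" if "finite N" for N d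
      using that
    proof (induction N)
      case empty
      have "scale 0 = (\<lambda>p :: ('n, 'a) mpoly. 0)" by auto
      then show ?case using scale[of 0] by simp
    next
      case (insert \<nu> N)
      have "scale (d \<nu>) \<circ> weyl_monom \<nu> \<in> ?G"
        by (intro comp scale monom)
      from generate_ring.eng_add[OF this insert.IH] show ?case
        using insert.hyps by (simp add: o_def)
    qed
    then show ?thesis by (simp add: normal_op_def)
  qed
  ultimately have "?G = range normal_op" by (intro subset_antisym subsetI) (blast, fast)
  then show ?thesis by (simp add: weyl_def)
qed

lemma normal_op_in_weyl [simp]:
  "normal_op (c :: ('n::finite + 'n, 'a::field_char_0) mpoly) \<in> carrier weyl"
  unfolding carrier_weyl by (rule rangeI)

lemma weyl_simps:
  "monoid.mult weyl = (\<circ>)" "one weyl = id" "zero weyl = (\<lambda>p. 0)" "add weyl = (\<lambda>f g p. f p + g p)"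
  by (simp_all add: weyl_def)

lemma normal_op_weyl_ring:
  fixes f g :: "('n::finite + 'n, 'a::field_char_0) mpoly"
  shows "normal_op f \<oplus>\<^bsub>weyl\<^esub> normal_op g = normal_op (f + g)"
    and "normal_op f \<otimes>\<^bsub>weyl\<^esub> normal_op g = normal_op (star f g)"
    and "\<one>\<^bsub>weyl\<^esub> = normal_op (1 :: ('n + 'n, 'a) mpoly)"
    and "\<zero>\<^bsub>weyl\<^esub> = normal_op (0 :: ('n + 'n, 'a) mpoly)"
proof -
  show "normal_op f \<oplus>\<^bsub>weyl\<^esub> normal_op g = normal_op (f + g)"
    unfolding weyl_simps by (rule ext) (simp add: normal_op_add)
  show "normal_op f \<otimes>\<^bsub>weyl\<^esub> normal_op g = normal_op (star f g)"
    unfolding weyl_simps normal_op_star ..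
  show "\<one>\<^bsub>weyl\<^esub> = normal_op (1 :: ('n + 'n, 'a) mpoly)"
    unfolding weyl_simps by (rule ext) simp
  show "\<zero>\<^bsub>weyl\<^esub> = normal_op (0 :: ('n + 'n, 'a) mpoly)"
    unfolding weyl_simps by (rule ext) simp
qed

lemma Fweyl_eq:
  "Fweyl \<omega> i = (normal_op ` weight_le \<omega> i :: ('n::finite, 'a::field_char_0) operator set)"
proof -
  have iff: "normal_op c \<in> Fweyl \<omega> i \<longleftrightarrow> c \<in> weight_le \<omega> i" for c :: "('n + 'n, 'a) mpoly"
  proof -
    have "normal_op c \<in> Fweyl \<omega> i
        \<longleftrightarrow> (\<forall>\<nu>\<in>Poly_Mapping.keys c. real (wdot \<omega> \<nu>) \<le> real_of_int i)"
      unfolding Fweyl_def wdeg_def supp_def weyl_coeffs_normal_op SUP_le_iff mem_Collect_eq ereal_less_eq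
      by (simp only: normal_op_in_weyl simp_thms)
    also have "\<dots> \<longleftrightarrow> c \<in> weight_le \<omega> i"
    proof -
      have "real (wdot \<omega> \<nu>) \<le> real_of_int i \<longleftrightarrow> int (wdot \<omega> \<nu>) \<le> i" for \<nu>
        by linarith
      then show ?thesis unfolding weight_le_def by blast
    qed
    finally show ?thesis .
  qed
  have range: "Fweyl \<omega> i \<subseteq> (range normal_op :: ('n, 'a) operator set)"
    unfolding Fweyl_def carrier_weyl by blast
  show ?thesis
  proof (intro subset_antisym subsetI)
    fix w :: "('n, 'a) operator" assume w: "w \<in> Fweyl \<omega> i"
    then obtain c where "w = normal_op c" using range by blast
    then show "w \<in> normal_op ` weight_le \<omega> i" using w iff by simp
  next
    fix w :: "('n, 'a) operator" assume "w \<in> normal_op ` weight_le \<omega> i"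
    then show "w \<in> Fweyl \<omega> i" using iff by (elim imageE) simp
  qed
qed

section \<open>Homogeneous parts\<close>

lemma lookup_hom_part:
  "Poly_Mapping.lookup (hom_part \<omega> f i) \<nu> = (if int (wdot \<omega> \<nu>) = i then Poly_Mapping.lookup f \<nu> else 0)"
proof -
  have "Poly_Mapping.lookup (hom_part \<omega> f i) \<nu>
    = (\<Sum>\<nu>'\<in>{\<nu>'\<in>Poly_Mapping.keys f. int (wdot \<omega> \<nu>') = i}. if \<nu>' = \<nu> then Poly_Mapping.lookup f \<nu>' else 0)"
    by (simp add: hom_part_def lookup_sum lookup_single when_def)
  also have "\<dots> = (if int (wdot \<omega> \<nu>) = i then Poly_Mapping.lookup f \<nu> else 0)"
    by (auto simp: in_keys_iff)
  finally show ?thesis .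
qed

lemma hom_part_weight_le: "hom_part \<omega> f i \<in> weight_le \<omega> i"
  by (auto simp: weight_le_def in_keys_iff lookup_hom_part split: if_splits)

lemma finite_hom_part: "finite {i. hom_part \<omega> f i \<noteq> 0}"
proof (rule finite_subset)
  show "{i. hom_part \<omega> f i \<noteq> 0} \<subseteq> (\<lambda>\<nu>. int (wdot \<omega> \<nu>)) ` Poly_Mapping.keys f"
  proof
    fix i assume "i \<in> {i. hom_part \<omega> f i \<noteq> 0}"
    then have "Poly_Mapping.keys (hom_part \<omega> f i) \<noteq> {}" by simp
    then obtain \<nu> where "\<nu> \<in> Poly_Mapping.keys (hom_part \<omega> f i)"
      by blast
    then show "i \<in> (\<lambda>\<nu>. int (wdot \<omega> \<nu>)) ` Poly_Mapping.keys f"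
      by (auto simp: in_keys_iff lookup_hom_part split: if_splits)
  qed
qed simp

lemma sum_hom_part: "(\<Sum>i\<in>{i. hom_part \<omega> f i \<noteq> 0}. hom_part \<omega> f i) = f"
proof (rule poly_mapping_eqI)
  fix \<nu>
  have "(\<Sum>i\<in>{i. hom_part \<omega> f i \<noteq> 0}. Poly_Mapping.lookup (hom_part \<omega> f i) \<nu>)
    = (\<Sum>i\<in>{i. hom_part \<omega> f i \<noteq> 0}. if i = int (wdot \<omega> \<nu>) then Poly_Mapping.lookup f \<nu> else 0)"
    by (rule sum.cong) (auto simp: lookup_hom_part)
  also have "\<dots> = (if hom_part \<omega> f (int (wdot \<omega> \<nu>)) \<noteq> 0 then Poly_Mapping.lookup f \<nu> else 0)"
    by (simp add: sum.delta finite_hom_part)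
  also have "\<dots> = Poly_Mapping.lookup f \<nu>"
  proof (cases "hom_part \<omega> f (int (wdot \<omega> \<nu>)) = 0")
    case True
    then have "Poly_Mapping.lookup (hom_part \<omega> f (int (wdot \<omega> \<nu>))) \<nu> = 0" by simp
    then show ?thesis unfolding lookup_hom_part by simp
  qed simp
  finally show "Poly_Mapping.lookup (\<Sum>i\<in>{i. hom_part \<omega> f i \<noteq> 0}. hom_part \<omega> f i) \<nu> = Poly_Mapping.lookup f \<nu>"
    by (simp add: lookup_sum)
qed

section \<open>The annihilator of the associated graded module\<close>

text \<open>
  Each component of the associated graded group is such a quotient.
\<close>

lemma factor_group_of_additive_subgroups:
  fixes M (structure)
  assumes "abelian_group M" and H: "additive_subgroup H M" and N: "additive_subgroup N M" and "N \<subseteq> H"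
  shows "comm_group (M\<lparr>carrier := H\<rparr> A_Mod N)"
    and "carrier (M\<lparr>carrier := H\<rparr> A_Mod N) = (\<lambda>m. N +> m) ` H"
    and "\<one>\<^bsub>M\<lparr>carrier := H\<rparr> A_Mod N\<^esub> = N"
proof -
  interpret abelian_group M by fact
  have H': "subgroup H (add_monoid M)" and N': "subgroup N (add_monoid M)"
    using H N by (simp_all add: additive_subgroup_def)
  have eq: "M\<lparr>carrier := H\<rparr> A_Mod N = ((add_monoid M)\<lparr>carrier := H\<rparr>) Mod N"
    by (simp add: A_FactGroup_def)
  interpret G: comm_group "(add_monoid M)\<lparr>carrier := H\<rparr>"
  proof (rule group.group_comm_groupI)
    show "group ((add_monoid M)\<lparr>carrier := H\<rparr>)"
      using H' a_group by (rule subgroup.subgroup_is_group)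
  qed (use subgroup.subset[OF H'] in \<open>auto intro: a_comm\<close>)
  have "subgroup N ((add_monoid M)\<lparr>carrier := H\<rparr>)"
    by (rule group.subgroup_incl[OF a_group N' H' \<open>N \<subseteq> H\<close>])
  then show "comm_group (M\<lparr>carrier := H\<rparr> A_Mod N)"
    unfolding eq by (rule G.abelian_FactGroup)
  show "carrier (M\<lparr>carrier := H\<rparr> A_Mod N) = (\<lambda>m. N +> m) ` H"
    by (simp add: eq carrier_FactGroup a_r_coset_def r_coset_def)
  show "\<one>\<^bsub>M\<lparr>carrier := H\<rparr> A_Mod N\<^esub> = N"
    by (simp add: eq)
qed

text \<open>
  Inside this locale operators are replaced by their coefficient polynomials, acting through \<open>act\<close>.
  The action is additive but it is compatible with \<open>star\<close> instead of the commutative product.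
\<close>

locale weyl_module = left_module weyl M
  for M :: "(('n::finite, 'a::field_char_0) operator, 'm) module"
begin

definition act :: "('n + 'n, 'a) mpoly \<Rightarrow> 'm \<Rightarrow> 'm"
  where "act f m = normal_op f \<odot>\<^bsub>M\<^esub> m"

lemma act_closed [simp]: "m \<in> carrier M \<Longrightarrow> act f m \<in> carrier M"
  by (simp add: act_def smult_closed)

lemma act_add: "m \<in> carrier M \<Longrightarrow> act (f + g) m = act f m \<oplus>\<^bsub>M\<^esub> act g m"
  unfolding act_def normal_op_weyl_ring(1)[symmetric] by (simp add: smult_l_distr)

lemma act_add_right:
  "\<lbrakk>x \<in> carrier M; y \<in> carrier M\<rbrakk> \<Longrightarrow> act f (x \<oplus>\<^bsub>M\<^esub> y) = act f x \<oplus>\<^bsub>M\<^esub> act f y"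
  unfolding act_def by (simp add: smult_r_distr)

lemma act_star: "m \<in> carrier M \<Longrightarrow> act (star f g) m = act f (act g m)"
  unfolding act_def normal_op_weyl_ring(2)[symmetric] by (simp add: smult_assoc1)

lemma act_one [simp]: "m \<in> carrier M \<Longrightarrow> act 1 m = m"
  unfolding act_def normal_op_weyl_ring(3)[symmetric] by (simp add: smult_one)

lemma act_zero [simp]: "m \<in> carrier M \<Longrightarrow> act 0 m = \<zero>\<^bsub>M\<^esub>"
  using act_add[of m 0 0] M.add.l_cancel_one[of "act 0 m" "act 0 m"] by simp

lemma act_zero_right [simp]: "act f \<zero>\<^bsub>M\<^esub> = \<zero>\<^bsub>M\<^esub>"
  using act_add_right[of "\<zero>\<^bsub>M\<^esub>" "\<zero>\<^bsub>M\<^esub>" f] M.add.l_cancel_one[of "act f \<zero>\<^bsub>M\<^esub>" "act f \<zero>\<^bsub>M\<^esub>"] by simp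

lemma act_finsum:
  "\<lbrakk>finite J; x \<in> J \<rightarrow> carrier M\<rbrakk> \<Longrightarrow> act f (\<Oplus>\<^bsub>M\<^esub>j\<in>J. x j) = (\<Oplus>\<^bsub>M\<^esub>j\<in>J. act f (x j))"
  by (induction J rule: finite_induct) (auto simp: act_add_right Pi_iff)

lemma filtrationD:
  assumes "filtration \<omega> M F"
  shows "additive_subgroup (F i) M" and "m \<in> F i \<Longrightarrow> m \<in> carrier M"
    and "i \<le> j \<Longrightarrow> F i \<subseteq> F j" and "m \<in> carrier M \<Longrightarrow> \<exists>i. m \<in> F i"
    and "\<lbrakk>f \<in> weight_le \<omega> i; m \<in> F j\<rbrakk> \<Longrightarrow> act f m \<in> F (i + j)"
proof -
  show "additive_subgroup (F i) M"
    using assms by (simp add: filtration_def)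
  show "m \<in> F i \<Longrightarrow> m \<in> carrier M" "m \<in> carrier M \<Longrightarrow> \<exists>i. m \<in> F i"
    using assms by (auto simp: filtration_def)
  have "F i \<subseteq> F (i + int k)" for k
  proof (induction k)
    case (Suc k)
    have "F (i + int k) \<subseteq> F (i + int k + 1)"
      using assms by (simp add: filtration_def)
    then show ?case using Suc by (simp add: algebra_simps)
  qed simp
  then show "i \<le> j \<Longrightarrow> F i \<subseteq> F j"
    by (metis zle_iff_zadd)
  have "\<forall>i j. \<forall>w\<in>Fweyl \<omega> i. \<forall>m\<in>F j. w \<odot>\<^bsub>M\<^esub> m \<in> F (i + j)"
    using assms by (simp add: filtration_def)
  then show "\<lbrakk>f \<in> weight_le \<omega> i; m \<in> F j\<rbrakk> \<Longrightarrow> act f m \<in> F (i + j)"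
    unfolding act_def Fweyl_eq by blast
qed

lemma coset_eqI:
  assumes H: "additive_subgroup H M" and "x \<in> carrier M" and "h \<in> H" and "y = h \<oplus>\<^bsub>M\<^esub> x"
  shows "H +>\<^bsub>M\<^esub> y = H +>\<^bsub>M\<^esub> x"
proof -
  have H': "subgroup H (add_monoid M)"
    using H by (simp add: additive_subgroup_def)
  have "y \<in> H +>\<^bsub>M\<^esub> x"
    using assms(3,4) unfolding a_r_coset_def' by blast
  then show ?thesis
    using M.a_repr_independence[OF _ assms(2) H'] by simp
qed

text \<open>
  The union of cosets in the definition of the product is a single coset, because changing either
  representative by an element of lower degree changes the product by an element of lower degree.
\<close>

lemma coset_smult_eq:
  assumes F: "filtration \<omega> M F" and f: "f \<in> weight_le \<omega> i" and m: "m \<in> F j"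
  shows "coset_smult M F (i + j) (Fweyl \<omega> (i - 1) +>\<^bsub>weyl\<^esub> normal_op f) (F (j - 1) +>\<^bsub>M\<^esub> m)
    = F (i + j - 1) +>\<^bsub>M\<^esub> act f m"
proof -
  note F' = filtrationD[OF F]
  interpret H: additive_subgroup "F (i + j - 1)" M by (rule F'(1))
  let ?A = "Fweyl \<omega> (i - 1) +>\<^bsub>weyl\<^esub> normal_op f" and ?B = "F (j - 1) +>\<^bsub>M\<^esub> m"
  have A: "?A = (\<lambda>u. normal_op (u + f)) ` weight_le \<omega> (i - 1)"
    unfolding a_r_coset_def' Fweyl_eq by (auto simp: normal_op_weyl_ring(1))
  have B: "?B = (\<lambda>v. v \<oplus>\<^bsub>M\<^esub> m) ` F (j - 1)"
    unfolding a_r_coset_def' by auto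
  have eq: "F (i + j - 1) +>\<^bsub>M\<^esub> (normal_op (u + f) \<odot>\<^bsub>M\<^esub> (v \<oplus>\<^bsub>M\<^esub> m)) = F (i + j - 1) +>\<^bsub>M\<^esub> act f m"
    if u: "u \<in> weight_le \<omega> (i - 1)" and v: "v \<in> F (j - 1)" for u v
  proof (rule coset_eqI[where h = "act u v \<oplus>\<^bsub>M\<^esub> act f v \<oplus>\<^bsub>M\<^esub> act u m"])
    have c: "v \<in> carrier M" "m \<in> carrier M" using v m F'(2) by auto
    show "act f m \<in> carrier M" using c by simp
    have "v \<in> F j" using F'(3)[of "j - 1" j] v by auto
    then have "act u v \<in> F (i + j - 1)" using F'(5)[OF u \<open>v \<in> F j\<close>] by (simp add: algebra_simps)
    moreover have "act f v \<in> F (i + j - 1)" using F'(5)[OF f v] by (simp add: algebra_simps)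
    moreover have "act u m \<in> F (i + j - 1)" using F'(5)[OF u m] by (simp add: algebra_simps)
    ultimately show "act u v \<oplus>\<^bsub>M\<^esub> act f v \<oplus>\<^bsub>M\<^esub> act u m \<in> F (i + j - 1)"
      by simp
    show "normal_op (u + f) \<odot>\<^bsub>M\<^esub> (v \<oplus>\<^bsub>M\<^esub> m) = act u v \<oplus>\<^bsub>M\<^esub> act f v \<oplus>\<^bsub>M\<^esub> act u m \<oplus>\<^bsub>M\<^esub> act f m"
      using c act_add[of "v \<oplus>\<^bsub>M\<^esub> m" u f]
      by (simp add: act_def[symmetric] act_add act_add_right M.a_ac)
  qed (rule F'(1))
  have "0 \<in> weight_le \<omega> (i - 1)" "\<zero>\<^bsub>M\<^esub> \<in> F (j - 1)"
    using additive_subgroup.zero_closed[OF F'(1)] by auto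
  then have "weight_le \<omega> (i - 1) \<noteq> ({} :: ('n + 'n, 'a) mpoly set)" "F (j - 1) \<noteq> {}"
    by blast+
  then show ?thesis
    unfolding coset_smult_def A B using eq by simp
qed

lemma gr_comp_props:
  assumes F: "filtration \<omega> M F"
  shows "comm_group (gr_comp M F i)" and "carrier (gr_comp M F i) = (\<lambda>m. F (i - 1) +>\<^bsub>M\<^esub> m) ` F i"
    and "\<one>\<^bsub>gr_comp M F i\<^esub> = F (i - 1)"
  unfolding gr_comp_def
  using factor_group_of_additive_subgroups[OF M.abelian_group_axioms, of "F i" "F (i - 1)"]
    filtrationD(1,3)[OF F] by simp_all

lemma carrier_gr:
  assumes F: "filtration \<omega> M F"
  shows "carrier (gr M F) = {g. (\<forall>i. g i \<in> (\<lambda>m. F (i - 1) +>\<^bsub>M\<^esub> m) ` F i) \<and> finite {i. g i \<noteq> F (i - 1)}}"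
proof -
  have "group (gr_comp M F i)" for i
    using gr_comp_props(1)[OF F] by (simp add: comm_group_def)
  then have "carrier (gr M F) = {g \<in> \<Pi>\<^sub>E i\<in>UNIV. carrier (gr_comp M F i). finite {i \<in> UNIV. g i \<noteq> \<one>\<^bsub>gr_comp M F i\<^esub>}}"
    unfolding gr_def by (intro carrier_sum_group)
  then show ?thesis
    by (simp add: gr_comp_props[OF F] PiE_def Pi_def)
qed

lemma coset_zero: "additive_subgroup H M \<Longrightarrow> H +>\<^bsub>M\<^esub> \<zero>\<^bsub>M\<^esub> = H"
  by (rule M.a_coset_add_zero) (rule additive_subgroup.a_subset)

lemma coset_eq_self_iff:
  assumes "additive_subgroup H M" and "x \<in> carrier M"
  shows "H +>\<^bsub>M\<^esub> x = H \<longleftrightarrow> x \<in> H"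
proof -
  have H': "subgroup H (add_monoid M)"
    using assms(1) by (simp add: additive_subgroup_def)
  show ?thesis
    using M.a_coset_join1[OF _ assms(2) H'] M.a_coset_join2[OF assms(2) H'] by blast
qed

lemma one_gr_comp_weyl: "\<one>\<^bsub>gr_comp weyl (Fweyl \<omega>) i\<^esub> = Fweyl \<omega> (i - 1)"
  by (simp add: gr_comp_def A_FactGroup_def)

lemma weyl_coset_eq_self:
  assumes "Fweyl \<omega> i +>\<^bsub>weyl\<^esub> normal_op f = (Fweyl \<omega> i :: ('n, 'a) operator set)"
  shows "f \<in> weight_le \<omega> i"
proof -
  have "normal_op (0 + f) \<in> Fweyl \<omega> i +>\<^bsub>weyl\<^esub> normal_op f"
    unfolding a_r_coset_def' Fweyl_eq normal_op_weyl_ring(1)[symmetric]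
    by (rule UN_I[of "normal_op 0"]) auto
  then have "normal_op f \<in> normal_op ` weight_le \<omega> i"
    unfolding assms unfolding Fweyl_eq by simp
  then show ?thesis using injD[OF inj_normal_op] by blast
qed

text \<open>
  A polynomial kills the graded module when each of its homogeneous parts lowers the degree by one more
  than it should. For the inclusion from left to right one tests against families concentrated in a
  single degree; then each component of the product has only one factor that can be nontrivial.
\<close>

lemma annihilator_gr_module:
  assumes F: "filtration \<omega> M F"
  shows "annihilator ring_of_type_algebra (gr_module \<omega> M F)
    = {f. \<forall>i j. \<forall>m\<in>F j. act (hom_part \<omega> f i) m \<in> F (i + j - 1)}"
proof (intro subset_antisym subsetI)
  note F' = filtrationD[OF F]
  define a where "a f i = Fweyl \<omega> (i - 1) +>\<^bsub>weyl\<^esub> normal_op (hom_part \<omega> f i)" for f :: "('n + 'n, 'a) mpoly" and i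
  have a: "poly_to_gr \<omega> f = a f" for f
    by (simp add: poly_to_gr_def a_def fun_eq_iff)
  have fin: "finite {i. a f i \<noteq> \<one>\<^bsub>gr_comp weyl (Fweyl \<omega>) i\<^esub>}" for f
  proof (rule finite_subset[OF _ finite_hom_part])
    have "Fweyl \<omega> j +>\<^bsub>weyl\<^esub> normal_op (0 :: ('n + 'n, 'a) mpoly) = Fweyl \<omega> j" for j
      unfolding a_r_coset_def' Fweyl_eq by (auto simp: normal_op_weyl_ring(1))
    then show "{i. a f i \<noteq> \<one>\<^bsub>gr_comp weyl (Fweyl \<omega>) i\<^esub>} \<subseteq> {i. hom_part \<omega> f i \<noteq> 0}"
      unfolding one_gr_comp_weyl a_def by auto
  qed
  have smult: "coset_smult M F k (a f i) (F (k - i - 1) +>\<^bsub>M\<^esub> m) = F (k - 1) +>\<^bsub>M\<^esub> act (hom_part \<omega> f i) m"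
    if "m \<in> F (k - i)" for f i k m
    using coset_smult_eq[OF F hom_part_weight_le[of \<omega> f i] that] by (simp add: a_def)
  {
    fix f assume "f \<in> annihilator ring_of_type_algebra (gr_module \<omega> M F)"
    then have ann: "gr_smult \<omega> M F (a f) g = \<one>\<^bsub>gr M F\<^esub>" if "g \<in> carrier (gr M F)" for g
      using that by (simp add: annihilator_def gr_module_def a)
    show "f \<in> {f. \<forall>i j. \<forall>m\<in>F j. act (hom_part \<omega> f i) m \<in> F (i + j - 1)}"
    proof (intro CollectI allI ballI)
      fix i j m assume m: "m \<in> F j"
      then have mc: "m \<in> carrier M" by (rule F'(2))
      let ?k = "i + j"
      define g where "g = (\<lambda>l. if l = j then F (j - 1) +>\<^bsub>M\<^esub> m else F (l - 1))"
      have "F (l - 1) \<in> (\<lambda>m. F (l - 1) +>\<^bsub>M\<^esub> m) ` F l" for l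
        using coset_zero[OF F'(1)] additive_subgroup.zero_closed[OF F'(1)]
        by (intro image_eqI[where x = "\<zero>\<^bsub>M\<^esub>"]) auto
      moreover have "finite {l. g l \<noteq> F (l - 1)}"
        by (rule finite_subset[of _ "{j}"]) (auto simp: g_def)
      ultimately have "g \<in> carrier (gr M F)"
        unfolding carrier_gr[OF F] using m by (auto simp: g_def)
      from fun_cong[OF ann[OF this], of ?k]
      have prod: "(\<Otimes>\<^bsub>gr_comp M F ?k\<^esub>l\<in>{l. a f l \<noteq> \<one>\<^bsub>gr_comp weyl (Fweyl \<omega>) l\<^esub>}.
          coset_smult M F ?k (a f l) (g (?k - l))) = F (?k - 1)"
        by (simp add: gr_smult_def gr_def gr_comp_props(3)[OF F])
      interpret G: comm_group "gr_comp M F ?k" by (rule gr_comp_props(1)[OF F])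
      have "coset_smult M F ?k (a f l) (g (?k - l))
        = (if l = i then F (?k - 1) +>\<^bsub>M\<^esub> act (hom_part \<omega> f i) m else \<one>\<^bsub>gr_comp M F ?k\<^esub>)" for l
      proof (cases "l = i")
        case True
        then show ?thesis using smult[of m ?k i f] m by (simp add: g_def)
      next
        case False
        have "g (?k - l) = F (?k - l - 1) +>\<^bsub>M\<^esub> \<zero>\<^bsub>M\<^esub>"
          using False coset_zero[OF F'(1)] by (simp add: g_def)
        then show ?thesis
          using False smult[of "\<zero>\<^bsub>M\<^esub>" ?k l f] additive_subgroup.zero_closed[OF F'(1)]
          by (simp add: coset_zero[OF F'(1)] gr_comp_props(3)[OF F])
      qed
      note prod = prod[unfolded this]
      show "act (hom_part \<omega> f i) m \<in> F (?k - 1)"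
      proof (cases "a f i = \<one>\<^bsub>gr_comp weyl (Fweyl \<omega>) i\<^esub>")
        case True
        then have "hom_part \<omega> f i \<in> weight_le \<omega> (i - 1)"
          unfolding one_gr_comp_weyl a_def by (rule weyl_coset_eq_self)
        from F'(5)[OF this m] show ?thesis by (simp add: algebra_simps)
      next
        case False
        have "act (hom_part \<omega> f i) m \<in> F ?k"
          using F'(5)[OF hom_part_weight_le m] .
        then have "F (?k - 1) +>\<^bsub>M\<^esub> act (hom_part \<omega> f i) m \<in> carrier (gr_comp M F ?k)"
          unfolding gr_comp_props(2)[OF F] by blast
        then have "F (?k - 1) +>\<^bsub>M\<^esub> act (hom_part \<omega> f i) m = F (?k - 1)"
          using prod G.finprod_singleton_swap[OF _ fin, of i f "\<lambda>_. F (?k - 1) +>\<^bsub>M\<^esub> act (hom_part \<omega> f i) m"] False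
          by simp
        then show ?thesis
          using coset_eq_self_iff[OF F'(1)] mc by simp
      qed
    qed
  }
  {
    fix f assume "f \<in> {f. \<forall>i j. \<forall>m\<in>F j. act (hom_part \<omega> f i) m \<in> F (i + j - 1)}"
    then have f: "act (hom_part \<omega> f i) m \<in> F (i + j - 1)" if "m \<in> F j" for i j m
      using that by simp
    have "gr_smult \<omega> M F (a f) g = \<one>\<^bsub>gr M F\<^esub>" if g: "g \<in> carrier (gr M F)" for g
    proof
      fix k
      interpret G: comm_group "gr_comp M F k" by (rule gr_comp_props(1)[OF F])
      have "coset_smult M F k (a f i) (g (k - i)) = \<one>\<^bsub>gr_comp M F k\<^esub>" for i
      proof -
        obtain m where m: "m \<in> F (k - i)" "g (k - i) = F (k - i - 1) +>\<^bsub>M\<^esub> m"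
          using g unfolding carrier_gr[OF F] by auto
        have "act (hom_part \<omega> f i) m \<in> F (k - 1)"
          using f[OF m(1), of i] by simp
        then have "F (k - 1) +>\<^bsub>M\<^esub> act (hom_part \<omega> f i) m = F (k - 1)"
          using coset_eq_self_iff[OF F'(1)] F'(2) by blast
        then show ?thesis
          using smult[OF m(1)] m(2) by (simp add: gr_comp_props(3)[OF F])
      qed
      then show "gr_smult \<omega> M F (a f) g k = \<one>\<^bsub>gr M F\<^esub> k"
        by (simp add: gr_smult_def gr_def)
    qed
    then show "f \<in> annihilator ring_of_type_algebra (gr_module \<omega> M F)"
      by (simp add: annihilator_def gr_module_def a ring_of_type_algebra_def)
  }
qed

end

section \<open>Independence of the good filtration\<close>

definition homogeneous :: "('n::finite + 'n \<Rightarrow> nat) \<Rightarrow> int \<Rightarrow> ('n + 'n, 'a::field) mpoly \<Rightarrow> bool"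
  where "homogeneous \<omega> d f \<longleftrightarrow> (\<forall>\<nu>\<in>Poly_Mapping.keys f. int (wdot \<omega> \<nu>) = d)"

lemma homogeneous_hom_part: "homogeneous \<omega> i (hom_part \<omega> f i)"
  by (auto simp: homogeneous_def in_keys_iff lookup_hom_part split: if_splits)

lemma homogeneous_weight_le: "homogeneous \<omega> d f \<Longrightarrow> f \<in> weight_le \<omega> d"
  by (auto simp: homogeneous_def weight_le_def)

lemma homogeneous_mult:
  assumes "homogeneous \<omega> i f" and "homogeneous \<omega> j g"
  shows "homogeneous \<omega> (i + j) (f * g)"
  unfolding homogeneous_def
proof
  fix \<nu> assume "\<nu> \<in> Poly_Mapping.keys (f * g)"
  then obtain a b where "\<nu> = a + b" "a \<in> Poly_Mapping.keys f" "b \<in> Poly_Mapping.keys g"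
    using Poly_Mapping.keys_mult[of f g] by blast
  then show "int (wdot \<omega> \<nu>) = i + j"
    using assms by (simp add: homogeneous_def)
qed

lemma homogeneous_power: "homogeneous \<omega> d f \<Longrightarrow> homogeneous \<omega> (int N * d) (f ^ N)"
proof (induction N)
  case 0
  then show ?case by (simp add: homogeneous_def wdot_def)
next
  case (Suc N)
  then show ?case using homogeneous_mult[of \<omega> d f "int N * d" "f ^ N"] by (simp add: algebra_simps)
qed

lemma hom_part_homogeneous:
  assumes "homogeneous \<omega> d f"
  shows "hom_part \<omega> f i = (if i = d then f else 0)"
  using assms by (intro poly_mapping_eqI) (auto simp: lookup_hom_part homogeneous_def in_keys_iff)

lemma star_weight_le:
  fixes f g :: "('n::finite + 'n, 'a::field_char_0) mpoly"
  assumes "\<omega> \<in> Omega" and "f \<in> weight_le \<omega> i" and "g \<in> weight_le \<omega> j"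
  shows "star f g \<in> weight_le \<omega> (i + j)"
proof -
  have "star f g - f * g \<in> weight_le \<omega> (i + j)"
    using star_diff_mult_weight_le[OF assms] by (rule weight_le_mono) simp
  then have "(star f g - f * g) + f * g \<in> weight_le \<omega> (i + j)"
    by (intro weight_le_add weight_le_mult assms(2,3))
  then show ?thesis by simp
qed

lemma exists_weight_le: "\<exists>i\<ge>0. f \<in> weight_le \<omega> i"
proof (intro exI conjI)
  show "f \<in> weight_le \<omega> (int (\<Sum>\<nu>\<in>Poly_Mapping.keys f. wdot \<omega> \<nu>))"
    unfolding weight_le_def of_nat_le_iff by (auto intro: member_le_sum)
qed (simp only: of_nat_0_le_iff)

lemma common_bound:
  assumes "\<And>j. j < (k::nat) \<Longrightarrow> \<exists>i::int. \<forall>i'\<ge>i. P j i'"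
  shows "\<exists>i\<ge>0. \<forall>j<k. P j i"
proof -
  obtain b where b: "\<And>j i'. j < k \<Longrightarrow> b j \<le> i' \<Longrightarrow> P j i'"
    using assms by metis
  let ?i = "\<Sum>j<k. \<bar>b j\<bar>"
  have "b j \<le> ?i" if "j < k" for j
  proof -
    have "b j \<le> \<bar>b j\<bar>" by simp
    also have "\<dots> \<le> ?i" using that by (intro member_le_sum) auto
    finally show ?thesis .
  qed
  then show ?thesis
    using b by (intro exI[of _ ?i]) (auto intro: sum_nonneg)
qed

lemma primeideal_power:
  assumes P: "primeideal P (ring_of_type_algebra :: 'b::comm_ring_1 ring)" and "h ^ Suc N \<in> P"
  shows "h \<in> P"
  using assms(2)
proof (induction N)
  case (Suc N)
  have "h * h ^ Suc N \<in> P" using Suc.prems by simp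
  then have "h \<in> P \<or> h ^ Suc N \<in> P"
    using primeideal.I_prime[OF P, of h "h ^ Suc N"] by (simp add: ring_of_type_algebra_def)
  then show ?case using Suc.IH by blast
qed simp

lemma primeideal_sum:
  assumes P: "primeideal P (ring_of_type_algebra :: 'b::comm_ring_1 ring)" and "\<And>x. x \<in> A \<Longrightarrow> f x \<in> P"
  shows "sum f A \<in> P"
proof -
  have add: "additive_subgroup P (ring_of_type_algebra :: 'b ring)"
    using P by (simp add: primeideal_def ideal_def)
  have "0 \<in> P" "x \<in> P \<Longrightarrow> y \<in> P \<Longrightarrow> x + y \<in> P" for x y
    using additive_subgroup.zero_closed[OF add] additive_subgroup.a_closed[OF add, of x y]
    by (simp_all add: ring_of_type_algebra_def)
  then show ?thesis
    using assms(2) by (induction A rule: infinite_finite_induct) auto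
qed

context weyl_module
begin

text \<open>
  The description of the annihilator obtained in \<open>annihilator_gr_module\<close>.
\<close>

definition gr_annihilator :: "('n + 'n \<Rightarrow> nat) \<Rightarrow> (int \<Rightarrow> 'm set) \<Rightarrow> ('n + 'n, 'a) mpoly set"
  where "gr_annihilator \<omega> F = {f. \<forall>i j. \<forall>m\<in>F j. act (hom_part \<omega> f i) m \<in> F (i + j - 1)}"

text \<open>
  The sets that occur in the definition of a good filtration, in terms of coefficient polynomials.
\<close>

definition span_filtration ::
    "('n + 'n \<Rightarrow> nat) \<Rightarrow> nat \<Rightarrow> (nat \<Rightarrow> 'm) \<Rightarrow> (nat \<Rightarrow> int) \<Rightarrow> int \<Rightarrow> 'm set"
  where "span_filtration \<omega> k e p i =
    {\<Oplus>\<^bsub>M\<^esub>j\<in>{..<k}. act (w j) (e j) | w. \<forall>j<k. w j \<in> weight_le \<omega> (i - p j)}"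

lemma span_filtration_eq:
  assumes e: "\<And>j. j < k \<Longrightarrow> e j \<in> carrier M"
  shows "{\<Oplus>\<^bsub>M\<^esub>j\<in>{..<k}. w j \<odot>\<^bsub>M\<^esub> e j | w. \<forall>j<k. w j \<in> Fweyl \<omega> (i - p j)} = span_filtration \<omega> k e p i"
proof (intro subset_antisym subsetI)
  fix x assume "x \<in> {\<Oplus>\<^bsub>M\<^esub>j\<in>{..<k}. w j \<odot>\<^bsub>M\<^esub> e j | w. \<forall>j<k. w j \<in> Fweyl \<omega> (i - p j)}"
  then obtain w where w: "x = (\<Oplus>\<^bsub>M\<^esub>j\<in>{..<k}. w j \<odot>\<^bsub>M\<^esub> e j)" "\<forall>j<k. w j \<in> normal_op ` weight_le \<omega> (i - p j)"
    unfolding Fweyl_eq by blast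
  then obtain c where c: "\<And>j. j < k \<Longrightarrow> w j = normal_op (c j) \<and> c j \<in> weight_le \<omega> (i - p j)"
    unfolding image_iff by metis
  have "x = (\<Oplus>\<^bsub>M\<^esub>j\<in>{..<k}. act (c j) (e j))"
    unfolding w(1) by (rule M.finsum_cong') (use e c in \<open>auto simp: act_def[symmetric]\<close>)
  then show "x \<in> span_filtration \<omega> k e p i"
    unfolding span_filtration_def using c by blast
next
  fix x assume "x \<in> span_filtration \<omega> k e p i"
  then obtain c where c: "x = (\<Oplus>\<^bsub>M\<^esub>j\<in>{..<k}. act (c j) (e j))" "\<forall>j<k. c j \<in> weight_le \<omega> (i - p j)"
    unfolding span_filtration_def by blast
  then show "x \<in> {\<Oplus>\<^bsub>M\<^esub>j\<in>{..<k}. w j \<odot>\<^bsub>M\<^esub> e j | w. \<forall>j<k. w j \<in> Fweyl \<omega> (i - p j)}"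
    unfolding Fweyl_eq act_def by (intro CollectI exI[of _ "\<lambda>j. normal_op (c j)"]) blast
qed

lemma additive_subgroup_finsum:
  assumes H: "additive_subgroup H M" and "finite J" and "\<And>j. j \<in> J \<Longrightarrow> x j \<in> H"
  shows "(\<Oplus>\<^bsub>M\<^esub>j\<in>J. x j) \<in> H"
proof -
  interpret additive_subgroup H M by fact
  have sub: "H \<subseteq> carrier M" by (rule a_subset)
  show ?thesis
    using assms(2,3)
  proof (induction J)
    case (insert j J)
    then have "(\<Oplus>\<^bsub>M\<^esub>j\<in>insert j J. x j) = x j \<oplus>\<^bsub>M\<^esub> (\<Oplus>\<^bsub>M\<^esub>j\<in>J. x j)"
      using sub by (intro M.finsum_insert) auto
    then show ?case using insert by simp
  qed simp
qed

text \<open>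
  Any filtration absorbs a good one up to a shift: it suffices to catch the finitely many generators.
\<close>

lemma span_filtration_subset:
  assumes F: "filtration \<omega> M F" and e: "\<And>j. j < k \<Longrightarrow> e j \<in> carrier M"
  shows "\<exists>c\<ge>0. \<forall>i. span_filtration \<omega> k e p i \<subseteq> F (i + c)"
proof -
  note F' = filtrationD[OF F]
  have "\<exists>c\<ge>0. \<forall>j<k. e j \<in> F (p j + c)"
  proof (rule common_bound)
    fix j assume "j < k"
    then obtain q where "e j \<in> F q" using F'(4) e by blast
    then show "\<exists>i. \<forall>i'\<ge>i. e j \<in> F (p j + i')"
      using F'(3)[of q] by (intro exI[of _ "q - p j"]) (auto simp: subset_iff)
  qed
  then obtain c where c: "c \<ge> 0" "\<And>j. j < k \<Longrightarrow> e j \<in> F (p j + c)" by blast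
  have "span_filtration \<omega> k e p i \<subseteq> F (i + c)" for i
  proof
    fix x assume "x \<in> span_filtration \<omega> k e p i"
    then obtain w where w: "x = (\<Oplus>\<^bsub>M\<^esub>j\<in>{..<k}. act (w j) (e j))" "\<And>j. j < k \<Longrightarrow> w j \<in> weight_le \<omega> (i - p j)"
      unfolding span_filtration_def by blast
    have "act (w j) (e j) \<in> F (i + c)" if "j < k" for j
      using F'(5)[OF w(2)[OF that] c(2)[OF that]] by simp
    then show "x \<in> F (i + c)"
      unfolding w(1) by (intro additive_subgroup_finsum[OF F'(1)]) auto
  qed
  then show ?thesis using c(1) by blast
qed

text \<open>
  If the form \<open>h\<close> of degree \<open>d\<close> annihilates the first graded module, then the operator of \<open>h\<close> maps \<open>F j\<close>
  into \<open>F (d + j - 1)\<close>, so its \<open>N\<close>-th power gains \<open>N\<close> degrees. Passing from \<open>F'\<close> to \<open>F\<close> and back loses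
  \<open>2 c\<close> degrees, so \<open>N = 2 c + 1\<close> leaves a gain of one. The commutative power of \<open>h\<close> and the power of
  its operator differ by lower weight, which is harmless on the graded module.
\<close>

lemma power_of_annihilating_form:
  assumes \<omega>: "\<omega> \<in> Omega" and F: "filtration \<omega> M F" and F': "filtration \<omega> M F'"
    and c: "c \<ge> 0" "\<And>i. F i \<subseteq> F' (i + c)" "\<And>i. F' i \<subseteq> F (i + c)"
    and f: "f \<in> gr_annihilator \<omega> F"
  shows "\<exists>N. hom_part \<omega> f d ^ Suc N \<in> gr_annihilator \<omega> F'"
proof -
  note FD = filtrationD[OF F] and FD' = filtrationD[OF F']
  define h where "h = hom_part \<omega> f d"
  have hom: "homogeneous \<omega> d h" by (simp add: h_def homogeneous_hom_part)
  have drop: "act h m \<in> F (d + j - 1)" if "m \<in> F j" for m j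
    using f that by (simp add: gr_annihilator_def h_def)
  have drops: "(act h ^^ N) m \<in> F (j + int N * (d - 1))" if "m \<in> F j" for m j N
  proof (induction N)
    case (Suc N)
    then show ?case using drop[OF Suc] by (simp add: algebra_simps)
  qed (use that in simp)
  have approx: "\<exists>s. (\<forall>m\<in>carrier M. act s m = (act h ^^ N) m) \<and> h ^ N - s \<in> weight_le \<omega> (int N * d - 1)" for N
  proof (induction N)
    case 0
    show ?case by (intro exI[of _ 1]) simp
  next
    case (Suc N)
    then obtain s where s: "\<And>m. m \<in> carrier M \<Longrightarrow> act s m = (act h ^^ N) m"
      "h ^ N - s \<in> weight_le \<omega> (int N * d - 1)" by blast
    have "h ^ N \<in> weight_le \<omega> (int N * d)"
      by (intro homogeneous_weight_le homogeneous_power hom)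
    then have "h ^ N - (h ^ N - s) \<in> weight_le \<omega> (int N * d)"
      by (intro weight_le_diff weight_le_mono[OF s(2)]) simp_all
    then have sw: "s \<in> weight_le \<omega> (int N * d)" by simp
    have deg: "d + (int N * d - 1) = int (Suc N) * d - 1" "d + int N * d - 1 = int (Suc N) * d - 1"
      by (simp_all add: algebra_simps)
    have "h * (h ^ N - s) \<in> weight_le \<omega> (d + (int N * d - 1))"
      by (intro weight_le_mult homogeneous_weight_le hom s)
    moreover have "star h s - h * s \<in> weight_le \<omega> (d + int N * d - 1)"
      by (intro star_diff_mult_weight_le \<omega> homogeneous_weight_le hom sw)
    ultimately have "h * (h ^ N - s) - (star h s - h * s) \<in> weight_le \<omega> (int (Suc N) * d - 1)"
      unfolding deg by (rule weight_le_diff)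
    moreover have "h * (h ^ N - s) - (star h s - h * s) = h ^ Suc N - star h s"
      by (simp add: algebra_simps)
    ultimately have "h ^ Suc N - star h s \<in> weight_le \<omega> (int (Suc N) * d - 1)"
      by metis
    moreover have "act (star h s) m = (act h ^^ Suc N) m" if "m \<in> carrier M" for m
      using that s(1) by (simp add: act_star)
    ultimately show ?case by blast
  qed
  define N where "N = Suc (nat (2 * c))"
  have N: "int N = 2 * c + 1" using c(1) by (simp add: N_def)
  obtain s where s: "\<And>m. m \<in> carrier M \<Longrightarrow> act s m = (act h ^^ N) m"
      "h ^ N - s \<in> weight_le \<omega> (int N * d - 1)" using approx by blast
  have "act (hom_part \<omega> (h ^ N) i) m \<in> F' (i + j - 1)" if m: "m \<in> F' j" for i j m
  proof (cases "i = int N * d")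
    case False
    then have "hom_part \<omega> (h ^ N) i = 0"
      by (simp add: hom_part_homogeneous[OF homogeneous_power[OF hom]])
    then show ?thesis
      using FD'(2)[OF m] additive_subgroup.zero_closed[OF FD'(1)] by simp
  next
    case True
    have mc: "m \<in> carrier M" using FD'(2)[OF m] .
    have "(act h ^^ N) m \<in> F (j + c + int N * (d - 1))"
      using m c(3) by (intro drops) blast
    then have "(act h ^^ N) m \<in> F' (j + c + int N * (d - 1) + c)"
      using c(2) by blast
    moreover have "j + c + int N * (d - 1) + c = i + j - 1"
      using N True by (simp add: algebra_simps)
    ultimately have 1: "act s m \<in> F' (i + j - 1)"
      using s(1)[OF mc] by simp
    have 2: "act (h ^ N - s) m \<in> F' (i + j - 1)"
      using FD'(5)[OF s(2) m] True by (simp add: algebra_simps)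
    have "hom_part \<omega> (h ^ N) i = s + (h ^ N - s)"
      using True by (simp add: hom_part_homogeneous[OF homogeneous_power[OF hom]])
    then have "act (hom_part \<omega> (h ^ N) i) m = act s m \<oplus>\<^bsub>M\<^esub> act (h ^ N - s) m"
      using act_add[OF mc] by metis
    then show ?thesis
      using additive_subgroup.a_closed[OF FD'(1) 1 2] by simp
  qed
  then have "h ^ N \<in> gr_annihilator \<omega> F'" by (simp add: gr_annihilator_def)
  then show ?thesis unfolding N_def h_def by blast
qed

text \<open>
  A prime containing powers of all homogeneous parts of \<open>f\<close> contains \<open>f\<close>.
\<close>

lemma Var_gr_annihilator_mono:
  assumes "\<omega> \<in> Omega" and "filtration \<omega> M F" and "filtration \<omega> M F'"
    and "c \<ge> 0" "\<And>i. F i \<subseteq> F' (i + c)" "\<And>i. F' i \<subseteq> F (i + c)"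
  shows "Var ring_of_type_algebra (gr_annihilator \<omega> F') \<subseteq> Var ring_of_type_algebra (gr_annihilator \<omega> F)"
proof
  fix P assume P: "P \<in> Var ring_of_type_algebra (gr_annihilator \<omega> F')"
  then have prime: "primeideal P ring_of_type_algebra" and sub: "gr_annihilator \<omega> F' \<subseteq> P"
    by (simp_all add: Var_def)
  have "f \<in> P" if f: "f \<in> gr_annihilator \<omega> F" for f
  proof -
    have "hom_part \<omega> f d \<in> P" for d
      using power_of_annihilating_form[OF assms f, of d] sub primeideal_power[OF prime] by blast
    then have "(\<Sum>i\<in>{i. hom_part \<omega> f i \<noteq> 0}. hom_part \<omega> f i) \<in> P"
      by (intro primeideal_sum[OF prime])
    then show ?thesis by (simp add: sum_hom_part)
  qed
  then show "P \<in> Var ring_of_type_algebra (gr_annihilator \<omega> F)"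
    using prime by (auto simp: Var_def)
qed

lemma Var_gr_annihilator_good:
  assumes \<omega>: "\<omega> \<in> Omega" and good: "good_filtration \<omega> M F" "good_filtration \<omega> M F'"
  shows "Var ring_of_type_algebra (gr_annihilator \<omega> F) = Var ring_of_type_algebra (gr_annihilator \<omega> F')"
proof -
  have shift: "\<exists>c\<ge>0. \<forall>i. G i \<subseteq> G' (i + c)" if G: "good_filtration \<omega> M G" and G': "good_filtration \<omega> M G'" for G G'
  proof -
    obtain k :: nat and e p where e: "\<forall>j<k. e j \<in> carrier M"
      "\<And>i. G i = {\<Oplus>\<^bsub>M\<^esub>j\<in>{..<k}. w j \<odot>\<^bsub>M\<^esub> e j | w. \<forall>j<k. w j \<in> Fweyl \<omega> (i - p j)}"
      using G unfolding good_filtration_def by blast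
    have "G i = span_filtration \<omega> k e p i" for i
      using e(1) span_filtration_eq[of k e \<omega> i p] unfolding e(2) by blast
    then show ?thesis
      using span_filtration_subset[of \<omega> G' k e p] G' e(1) by (simp add: good_filtration_def)
  qed
  obtain c where c: "c \<ge> 0" "\<And>i. F i \<subseteq> F' (i + c)" using shift[OF good] by blast
  obtain c' where c': "c' \<ge> 0" "\<And>i. F' i \<subseteq> F (i + c')" using shift[OF good(2,1)] by blast
  have fil: "filtration \<omega> M F" "filtration \<omega> M F'"
    using good by (simp_all add: good_filtration_def)
  let ?c = "c + c'"
  have sub: "F i \<subseteq> F' (i + ?c)" "F' i \<subseteq> F (i + ?c)" for i
    using c c'(1) filtrationD(3)[OF fil(2), of "i + c" "i + ?c"]
      c' c(1) filtrationD(3)[OF fil(1), of "i + c'" "i + ?c"] by (force simp: subset_iff)+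
  show ?thesis
    using Var_gr_annihilator_mono[OF \<omega> fil, of ?c] Var_gr_annihilator_mono[OF \<omega> fil(2,1), of ?c] sub c(1) c'(1)
    by (intro subset_antisym) simp_all
qed

lemma char_variety_eq:
  assumes \<omega>: "\<omega> \<in> Omega" and good: "good_filtration \<omega> M F"
  shows "char_variety \<omega> M = Var ring_of_type_algebra (gr_annihilator \<omega> F)"
proof -
  let ?F = "SOME F. good_filtration \<omega> M F"
  have G: "good_filtration \<omega> M ?F" by (rule someI[of "good_filtration \<omega> M" F, OF good])
  then have "filtration \<omega> M ?F" by (simp add: good_filtration_def)
  then have "char_variety \<omega> M = Var ring_of_type_algebra (gr_annihilator \<omega> ?F)"
    by (simp add: char_variety_def annihilator_gr_module gr_annihilator_def)
  then show ?thesis using Var_gr_annihilator_good[OF \<omega> G good] by simp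
qed

end

section \<open>Term orders and leading forms\<close>

text \<open>
  By unique factorization, sending the variables to distinct primes embeds the monomials into the
  natural numbers. The usual order pulls back to a total well-order compatible with multiplication,
  although the variables carry no order.
\<close>

lemma exists_multiplicative_rank:
  "\<exists>\<tau> :: ('i::finite \<Rightarrow>\<^sub>0 nat) \<Rightarrow> nat. inj \<tau> \<and> (\<forall>a b. \<tau> (a + b) = \<tau> a * \<tau> b) \<and> (\<forall>a. \<tau> a > 0)"
proof -
  obtain B :: "nat set" where B: "finite B" "card B = card (UNIV :: 'i set)" "B \<subseteq> {p. prime p}"
    using infinite_arbitrarily_large[OF primes_infinite] by blast
  then obtain p where "bij_betw p (UNIV :: 'i set) B"
    using finite_same_card_bij[of "UNIV :: 'i set" B] by auto
  then have inj: "inj p" and prime: "\<And>i. prime (p i)"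
    using B(3) by (auto simp: bij_betw_def)
  define \<tau> where "\<tau> a = (\<Prod>i\<in>UNIV. p i ^ Poly_Mapping.lookup a i)" for a :: "'i \<Rightarrow>\<^sub>0 nat"
  have mult: "multiplicity (p i) (\<tau> a) = Poly_Mapping.lookup a i" for a i
  proof -
    have "\<tau> a = (\<Prod>q\<in>range p. q ^ Poly_Mapping.lookup a (inv_into UNIV p q))"
      unfolding \<tau>_def by (subst prod.reindex[OF inj]) (simp add: inj)
    moreover have "multiplicity (p i) (\<Prod>q\<in>range p. q ^ Poly_Mapping.lookup a (inv_into UNIV p q))
        = Poly_Mapping.lookup a i"
      by (subst multiplicity_prod_prime_powers) (auto simp: prime inj)
    ultimately show ?thesis by simp
  qed
  have "inj \<tau>"
    by (rule injI, rule poly_mapping_eqI) (metis mult)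
  moreover have "\<tau> (a + b) = \<tau> a * \<tau> b" for a b
    by (simp add: \<tau>_def lookup_add power_add prod.distrib)
  moreover have "\<tau> a > 0" for a
    using prime by (auto simp: \<tau>_def prime_gt_0_nat intro!: prod_pos)
  ultimately show ?thesis by blast
qed

definition monomial_rank :: "('i::finite \<Rightarrow>\<^sub>0 nat) \<Rightarrow> nat"
  where "monomial_rank = (SOME \<tau>. inj \<tau> \<and> (\<forall>a b. \<tau> (a + b) = \<tau> a * \<tau> b) \<and> (\<forall>a. \<tau> a > 0))"

lemma monomial_rank:
  "inj (monomial_rank :: ('i::finite \<Rightarrow>\<^sub>0 nat) \<Rightarrow> nat)"
  "monomial_rank (a + b) = monomial_rank a * monomial_rank b" "monomial_rank a > 0"
  using someI_ex[OF exists_multiplicative_rank] unfolding monomial_rank_def[symmetric] by blast+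

text \<open>
  A term order on a free module that refines the \<open>\<omega>\<close>-weight: positions are compared by their keys
  lexicographically.
\<close>

definition position_key ::
    "('n::finite + 'n \<Rightarrow> nat) \<Rightarrow> ('n + 'n \<Rightarrow>\<^sub>0 nat) \<times> nat \<Rightarrow> nat \<times> nat \<times> nat"
  where "position_key \<omega> b = (wdot \<omega> (fst b), monomial_rank (fst b), snd b)"

lemma inj_position_key: "inj (position_key \<omega>)"
proof (rule injI)
  fix b b' assume "position_key \<omega> b = position_key \<omega> b'"
  then have "monomial_rank (fst b) = monomial_rank (fst b')" "snd b = snd b'"
    by (simp_all add: position_key_def)
  then show "b = b'"
    using injD[OF monomial_rank(1)] by (simp add: prod_eq_iff)
qed

lemma position_key_wdot_le: "position_key \<omega> b \<le> position_key \<omega> b' \<Longrightarrow> wdot \<omega> (fst b) \<le> wdot \<omega> (fst b')"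
  by (auto simp: position_key_def)

lemma position_key_shift:
  assumes "position_key \<omega> b \<le> position_key \<omega> b'"
  shows "position_key \<omega> (\<alpha> + fst b, snd b) \<le> position_key \<omega> (\<alpha> + fst b', snd b')"
  using assms monomial_rank(3)[of \<alpha>] by (auto simp: position_key_def monomial_rank(2))

lemma lookup_monomial_mult:
  fixes g :: "('i, 'a::field) mpoly"
  shows "Poly_Mapping.lookup (Poly_Mapping.single \<alpha> c * g) (\<alpha> + \<nu>) = c * Poly_Mapping.lookup g \<nu>"
  by (rule additive_eqI[where p = g])
     (auto simp: distrib_left lookup_add mult_single lookup_single when_def)

lemma keys_monomial_mult:
  "\<mu> \<in> Poly_Mapping.keys (Poly_Mapping.single \<alpha> c * g) \<Longrightarrow> \<exists>\<nu>\<in>Poly_Mapping.keys g. \<mu> = \<alpha> + \<nu>"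
  using Poly_Mapping.keys_mult[of "Poly_Mapping.single \<alpha> c" g] by (auto split: if_splits)

lemma star_zero [simp]: "star f 0 = 0"
proof -
  have "normal_op f \<circ> normal_op 0 = normal_op (0 :: ('a + 'a, 'b) mpoly)"
    using normal_op_linear(2)[of f 0 0] by (simp add: fun_eq_iff)
  then show ?thesis by (simp add: star_def)
qed

lemma star_constant:
  fixes f :: "('a::finite + 'a, 'b::field_char_0) mpoly"
  shows "star (Poly_Mapping.single 0 c) f = scale c f"
proof -
  have "normal_op (Poly_Mapping.single 0 c) = (scale c :: ('a, 'b) operator)"
  proof
    fix p :: "('a, 'b) mpoly"
    have "normal_op (scale c 1) p = scale c p"
      unfolding normal_op_scale normal_op_one ..
    moreover have "scale c 1 = (Poly_Mapping.single 0 c :: ('a + 'a, 'b) mpoly)"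
      using scale_single[of c 0 1] by simp
    ultimately show "normal_op (Poly_Mapping.single 0 c) p = scale c p" by simp
  qed
  then have "normal_op (Poly_Mapping.single 0 c) \<circ> normal_op f = normal_op (scale c f)"
    by (simp add: fun_eq_iff normal_op_scale)
  then show ?thesis by (simp add: star_def)
qed

lemma hom_part_add: "hom_part \<omega> (f + g) i = hom_part \<omega> f i + hom_part \<omega> g i"
  by (rule poly_mapping_eqI) (simp add: lookup_hom_part lookup_add)

lemma hom_part_diff: "hom_part \<omega> (f - g) i = hom_part \<omega> f i - hom_part \<omega> g i"
  by (rule poly_mapping_eqI) (simp add: lookup_hom_part lookup_minus)

lemma hom_part_zero [simp]: "hom_part \<omega> 0 i = 0"
  by (rule poly_mapping_eqI) (simp add: lookup_hom_part)

lemma hom_part_eq_zero: "f \<in> weight_le \<omega> (i - 1) \<Longrightarrow> hom_part \<omega> f i = 0"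
  by (rule poly_mapping_eqI) (force simp: lookup_hom_part weight_le_def in_keys_iff)

lemma diff_hom_part_weight_le: "f \<in> weight_le \<omega> i \<Longrightarrow> f - hom_part \<omega> f i \<in> weight_le \<omega> (i - 1)"
  by (force simp: weight_le_def in_keys_iff lookup_minus lookup_hom_part split: if_splits)

text \<open>
  For a vector whose components have weight at most \<open>i\<close> this is its leading form, or zero if all
  weights are smaller than \<open>i\<close>.
\<close>

definition weight_part ::
    "('n::finite + 'n \<Rightarrow> nat) \<Rightarrow> int \<Rightarrow> (nat \<Rightarrow> ('n + 'n, 'a::field) mpoly) \<Rightarrow> nat \<Rightarrow> ('n + 'n, 'a) mpoly"
  where "weight_part \<omega> i h = (\<lambda>j. hom_part \<omega> (h j) i)"

definition coefficient :: "(nat \<Rightarrow> ('i, 'a::field) mpoly) \<Rightarrow> ('i \<Rightarrow>\<^sub>0 nat) \<times> nat \<Rightarrow> 'a"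
  where "coefficient h b = Poly_Mapping.lookup (h (snd b)) (fst b)"

lemma weight_part_star_monomial:
  fixes h :: "nat \<Rightarrow> ('n::finite + 'n, 'a::field_char_0) mpoly"
  assumes \<omega>: "\<omega> \<in> Omega" and h: "\<And>j. h j \<in> weight_le \<omega> d"
  shows "star (Poly_Mapping.single \<alpha> c) (h j) - Poly_Mapping.single \<alpha> c * weight_part \<omega> d h j
    \<in> weight_le \<omega> (int (wdot \<omega> \<alpha>) + d - 1)"
proof -
  have "star (Poly_Mapping.single \<alpha> c) (h j) - Poly_Mapping.single \<alpha> c * h j \<in> weight_le \<omega> (int (wdot \<omega> \<alpha>) + d - 1)"
    by (intro star_diff_mult_weight_le \<omega> h weight_le_single) simp
  moreover have "Poly_Mapping.single \<alpha> c * (h j - weight_part \<omega> d h j) \<in> weight_le \<omega> (int (wdot \<omega> \<alpha>) + (d - 1))"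
    unfolding weight_part_def by (intro weight_le_monomial_mult diff_hom_part_weight_le h)
  ultimately have "(star (Poly_Mapping.single \<alpha> c) (h j) - Poly_Mapping.single \<alpha> c * h j)
      + Poly_Mapping.single \<alpha> c * (h j - weight_part \<omega> d h j) \<in> weight_le \<omega> (int (wdot \<omega> \<alpha>) + d - 1)"
    by (intro weight_le_add) (simp_all add: algebra_simps)
  then show ?thesis by (simp add: algebra_simps)
qed

text \<open>
  Leading positions are multiplicative for the noncommutative product too, since its correction terms
  have strictly smaller weight and hence strictly smaller key.
\<close>

lemma leading_position_star_monomial:
  fixes h :: "nat \<Rightarrow> ('n::finite + 'n, 'a::field_char_0) mpoly" and c :: 'a and \<alpha> :: "'n + 'n \<Rightarrow>\<^sub>0 nat"
  assumes \<omega>: "\<omega> \<in> Omega"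
    and lead: "\<And>b'. coefficient h b' \<noteq> 0 \<Longrightarrow> position_key \<omega> b' \<le> position_key \<omega> b"
  defines "h' \<equiv> \<lambda>j. star (Poly_Mapping.single \<alpha> c) (h j)"
  shows "coefficient h' (\<alpha> + fst b, snd b) = c * coefficient h b"
    and "\<And>b'. coefficient h' b' \<noteq> 0 \<Longrightarrow> position_key \<omega> b' \<le> position_key \<omega> (\<alpha> + fst b, snd b)"
proof -
  let ?d = "int (wdot \<omega> (fst b))"
  let ?x = "Poly_Mapping.single \<alpha> c :: ('n + 'n, 'a) mpoly"
  have h: "h j \<in> weight_le \<omega> ?d" for j
    unfolding weight_le_def
  proof safe
    fix \<nu> assume "\<nu> \<in> Poly_Mapping.keys (h j)"
    then have "coefficient h (\<nu>, j) \<noteq> 0" by (simp add: coefficient_def in_keys_iff)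
    from position_key_wdot_le[OF lead[OF this]] show "int (wdot \<omega> \<nu>) \<le> ?d" by simp
  qed
  have r: "h' j - ?x * h j \<in> weight_le \<omega> (int (wdot \<omega> \<alpha>) + ?d - 1)" for j
    unfolding h'_def by (intro star_diff_mult_weight_le \<omega> h weight_le_single) simp
  have "Poly_Mapping.lookup (h' (snd b) - ?x * h (snd b)) (\<alpha> + fst b) = 0"
    using r[of "snd b"] by (force simp: weight_le_def in_keys_iff)
  then show "coefficient h' (\<alpha> + fst b, snd b) = c * coefficient h b"
    by (simp add: coefficient_def lookup_minus lookup_monomial_mult)
  fix b' assume b': "coefficient h' b' \<noteq> 0"
  obtain \<mu> j where bj: "b' = (\<mu>, j)" by (cases b')
  have "Poly_Mapping.lookup ((h' j - ?x * h j) + ?x * h j) \<mu> \<noteq> 0"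
    using b' by (simp add: coefficient_def bj)
  then consider "\<mu> \<in> Poly_Mapping.keys (h' j - ?x * h j)" | "\<mu> \<in> Poly_Mapping.keys (?x * h j)"
    unfolding lookup_add in_keys_iff by fastforce
  then show "position_key \<omega> b' \<le> position_key \<omega> (\<alpha> + fst b, snd b)"
  proof cases
    case 1
    then have "int (wdot \<omega> \<mu>) \<le> int (wdot \<omega> \<alpha>) + ?d - 1"
      using r[of j] by (simp add: weight_le_def)
    then have "wdot \<omega> \<mu> < wdot \<omega> (\<alpha> + fst b)" by simp
    then show ?thesis by (simp add: bj position_key_def)
  next
    case 2
    then obtain \<nu> where \<nu>: "\<nu> \<in> Poly_Mapping.keys (h j)" "\<mu> = \<alpha> + \<nu>"
      using keys_monomial_mult by blast
    then have "coefficient h (\<nu>, j) \<noteq> 0" by (simp add: coefficient_def in_keys_iff)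
    from position_key_shift[OF lead[OF this], of \<alpha>] show ?thesis
      by (simp add: bj \<nu>)
  qed
qed

text \<open>
  The submodule over the commutative polynomial ring generated by \<open>G\<close>.
\<close>

inductive_set poly_span :: "(nat \<Rightarrow> ('i, 'a::field) mpoly) set \<Rightarrow> (nat \<Rightarrow> ('i, 'a) mpoly) set"
  for G where
    poly_span_zero: "(\<lambda>_. 0) \<in> poly_span G"
  | poly_span_step: "\<lbrakk>x \<in> poly_span G; g \<in> G\<rbrakk> \<Longrightarrow> (\<lambda>j. x j + Poly_Mapping.single \<alpha> c * g j) \<in> poly_span G"

lemma poly_span_add:
  assumes "x \<in> poly_span G" and "y \<in> poly_span G"
  shows "(\<lambda>j. x j + y j) \<in> poly_span G"
  using assms(2)
proof induction
  case poly_span_zero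
  then show ?case using assms(1) by simp
next
  case (poly_span_step y g \<alpha> c)
  from poly_span.poly_span_step[OF poly_span_step.IH poly_span_step.hyps(2), of \<alpha> c]
  show ?case by (simp add: add.assoc)
qed

lemma poly_span_sum:
  "(\<And>i. i \<in> I \<Longrightarrow> x i \<in> poly_span G) \<Longrightarrow> (\<lambda>j. \<Sum>i\<in>I. x i j) \<in> poly_span G"
proof (induction I rule: infinite_finite_induct)
  case (insert i I)
  then show ?case using poly_span_add[of "x i" G "\<lambda>j. \<Sum>i\<in>I. x i j"] by simp
qed (simp_all add: poly_span_zero)

text \<open>
  Every weight part arises by restricting \<open>h\<close> to a subset of its finite support.
\<close>

lemma finite_weight_parts:
  assumes "\<And>j. j \<ge> k \<Longrightarrow> h j = 0"
  shows "finite (range (\<lambda>(\<omega>, i). weight_part \<omega> i h))"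
proof (rule finite_surj)
  let ?K = "\<Union>j<k. Poly_Mapping.keys (h j)"
  let ?restrict = "\<lambda>U j. \<Sum>\<nu>\<in>Poly_Mapping.keys (h j) \<inter> U. Poly_Mapping.single \<nu> (Poly_Mapping.lookup (h j) \<nu>)"
  show "finite (Pow ?K)" by simp
  have "weight_part \<omega> i h = ?restrict {\<nu> \<in> ?K. int (wdot \<omega> \<nu>) = i}" for \<omega> i
  proof
    fix j
    have "Poly_Mapping.keys (h j) \<inter> {\<nu> \<in> ?K. int (wdot \<omega> \<nu>) = i} = {\<nu>\<in>Poly_Mapping.keys (h j). int (wdot \<omega> \<nu>) = i}"
      using assms[of j] by (cases "j < k") auto
    then show "weight_part \<omega> i h j = ?restrict {\<nu> \<in> ?K. int (wdot \<omega> \<nu>) = i} j"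
      by (simp add: weight_part_def hom_part_def)
  qed
  then show "range (\<lambda>(\<omega>, i). weight_part \<omega> i h) \<subseteq> ?restrict ` Pow ?K"
    by auto
qed

section \<open>The filtration given by generators\<close>

locale generated_weyl_module = weyl_module M
  for M :: "(('n::finite, 'a::field_char_0) operator, 'm) module" +
  fixes k :: nat and e :: "nat \<Rightarrow> 'm"
  assumes generator_closed: "j < k \<Longrightarrow> e j \<in> carrier M"
    and generated: "m \<in> carrier M \<Longrightarrow> \<exists>w. m = (\<Oplus>\<^bsub>M\<^esub>j\<in>{..<k}. act (w j) (e j))"
begin

definition ev :: "(nat \<Rightarrow> ('n + 'n, 'a) mpoly) \<Rightarrow> 'm"
  where "ev w = (\<Oplus>\<^bsub>M\<^esub>j\<in>{..<k}. act (w j) (e j))"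

lemma act_generator_closed: "(\<lambda>j. act (w j) (e j)) \<in> {..<k} \<rightarrow> carrier M"
  by (simp add: generator_closed)

lemma ev_closed [simp]: "ev w \<in> carrier M"
  unfolding ev_def by (rule M.finsum_closed[OF act_generator_closed])

lemma ev_cong: "(\<And>j. j < k \<Longrightarrow> v j = w j) \<Longrightarrow> ev v = ev w"
  unfolding ev_def by (rule M.finsum_cong') (auto simp: generator_closed)

lemma ev_add: "ev (\<lambda>j. v j + w j) = ev v \<oplus>\<^bsub>M\<^esub> ev w"
proof -
  have "ev (\<lambda>j. v j + w j) = (\<Oplus>\<^bsub>M\<^esub>j\<in>{..<k}. act (v j) (e j) \<oplus>\<^bsub>M\<^esub> act (w j) (e j))"
    unfolding ev_def by (rule M.finsum_cong') (auto simp: generator_closed act_add)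
  then show ?thesis
    unfolding ev_def using M.finsum_addf[OF act_generator_closed act_generator_closed] by simp
qed

lemma ev_star: "ev (\<lambda>j. star f (w j)) = act f (ev w)"
proof -
  have "ev (\<lambda>j. star f (w j)) = (\<Oplus>\<^bsub>M\<^esub>j\<in>{..<k}. act f (act (w j) (e j)))"
    unfolding ev_def by (rule M.finsum_cong') (auto simp: generator_closed act_star)
  then show ?thesis
    unfolding ev_def using act_finsum[OF finite_lessThan act_generator_closed] by simp
qed

lemma ev_scale: "ev (\<lambda>j. scale c (w j)) = act (Poly_Mapping.single 0 c) (ev w)"
  using ev_star[of "Poly_Mapping.single 0 c" w] by (simp add: star_constant)

lemma ev_zero [simp]: "ev (\<lambda>_. 0) = \<zero>\<^bsub>M\<^esub>"
  using ev_star[of 0 "\<lambda>_. 0"] by simp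

lemma ev_uminus: "ev (\<lambda>j. - w j) = \<ominus>\<^bsub>M\<^esub> ev w"
  using ev_add[of "\<lambda>j. - w j" w] by (intro M.minus_equality[symmetric]) auto

lemma ev_diff: "ev (\<lambda>j. v j - w j) = ev v \<ominus>\<^bsub>M\<^esub> ev w"
  using ev_add[of v "\<lambda>j. - w j"] by (simp add: ev_uminus a_minus_def)

definition unit_vector :: "nat \<Rightarrow> ('n + 'n, 'a) mpoly \<Rightarrow> nat \<Rightarrow> ('n + 'n, 'a) mpoly"
  where "unit_vector j f = (\<lambda>l. if l = j then f else 0)"

lemma ev_unit_vector:
  assumes "j < k"
  shows "ev (unit_vector j f) = act f (e j)"
proof -
  have "ev (unit_vector j f) = (\<Oplus>\<^bsub>M\<^esub>l\<in>{..<k}. if j = l then act f (e l) else \<zero>\<^bsub>M\<^esub>)"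
    unfolding ev_def unit_vector_def
    by (rule M.finsum_cong') (auto simp: generator_closed)
  also have "\<dots> = act f (e j)"
    using assms by (intro M.finsum_singleton) (auto simp: generator_closed)
  finally show ?thesis .
qed

definition standard_filtration :: "('n + 'n \<Rightarrow> nat) \<Rightarrow> int \<Rightarrow> 'm set"
  where "standard_filtration \<omega> i = {ev w | w. \<forall>j<k. w j \<in> weight_le \<omega> i}"

lemma standard_filtrationI: "(\<And>j. j < k \<Longrightarrow> w j \<in> weight_le \<omega> i) \<Longrightarrow> ev w \<in> standard_filtration \<omega> i"
  unfolding standard_filtration_def by blast

lemma standard_filtrationE:
  assumes "m \<in> standard_filtration \<omega> i"
  obtains w where "m = ev w" "\<And>j. j < k \<Longrightarrow> w j \<in> weight_le \<omega> i"
  using assms unfolding standard_filtration_def by blast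

lemma additive_subgroup_standard_filtration: "additive_subgroup (standard_filtration \<omega> i) M"
proof (intro additive_subgroup.intro M.add.subgroupI)
  show "standard_filtration \<omega> i \<subseteq> carrier M"
    by (auto elim: standard_filtrationE)
  show "standard_filtration \<omega> i \<noteq> {}"
    using standard_filtrationI[of "\<lambda>_. 0"] by auto
next
  fix x assume "x \<in> standard_filtration \<omega> i"
  then obtain w where w: "x = ev w" "\<And>j. j < k \<Longrightarrow> w j \<in> weight_le \<omega> i"
    by (elim standard_filtrationE) blast
  then show "\<ominus>\<^bsub>M\<^esub> x \<in> standard_filtration \<omega> i"
    unfolding w(1) ev_uminus[symmetric] by (intro standard_filtrationI weight_le_uminus)
next
  fix x y assume "x \<in> standard_filtration \<omega> i" "y \<in> standard_filtration \<omega> i"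
  then obtain v w where v: "x = ev v" "\<And>j. j < k \<Longrightarrow> v j \<in> weight_le \<omega> i"
    and w: "y = ev w" "\<And>j. j < k \<Longrightarrow> w j \<in> weight_le \<omega> i"
    by (elim standard_filtrationE) blast
  then show "x \<oplus>\<^bsub>M\<^esub> y \<in> standard_filtration \<omega> i"
    unfolding v(1) w(1) ev_add[symmetric] by (intro standard_filtrationI weight_le_add)
qed

lemma act_standard_filtration:
  assumes "\<omega> \<in> Omega" and "f \<in> weight_le \<omega> i" and "m \<in> standard_filtration \<omega> j"
  shows "act f m \<in> standard_filtration \<omega> (i + j)"
proof -
  obtain w where w: "m = ev w" "\<And>j'. j' < k \<Longrightarrow> w j' \<in> weight_le \<omega> j"
    using assms(3) by (elim standard_filtrationE) blast
  show ?thesis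
    unfolding w(1) ev_star[symmetric] by (intro standard_filtrationI star_weight_le assms w)
qed

lemma good_standard_filtration:
  assumes \<omega>: "\<omega> \<in> Omega"
  shows "good_filtration \<omega> M (standard_filtration \<omega>)"
proof -
  have mono: "standard_filtration \<omega> i \<subseteq> standard_filtration \<omega> (i + 1)" for i
  proof
    fix m assume "m \<in> standard_filtration \<omega> i"
    then obtain w where w: "m = ev w" "\<And>j. j < k \<Longrightarrow> w j \<in> weight_le \<omega> i"
      by (elim standard_filtrationE) blast
    show "m \<in> standard_filtration \<omega> (i + 1)"
      unfolding w(1) by (intro standard_filtrationI weight_le_mono[OF w(2)]) simp_all
  qed
  have "m \<in> (\<Union>i. standard_filtration \<omega> i)" if m: "m \<in> carrier M" for m
  proof -
    obtain w where w: "m = ev w" using generated[OF m] unfolding ev_def by blast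
    have "\<exists>i\<ge>0. \<forall>j<k. w j \<in> weight_le \<omega> i"
    proof (rule common_bound)
      fix j
      obtain i where i: "w j \<in> weight_le \<omega> i" using exists_weight_le by blast
      show "\<exists>i. \<forall>i'\<ge>i. w j \<in> weight_le \<omega> i'"
        by (intro exI[of _ i] allI impI weight_le_mono[OF i])
    qed
    then obtain i where "\<forall>j<k. w j \<in> weight_le \<omega> i" by blast
    then have "ev w \<in> standard_filtration \<omega> i" by (intro standard_filtrationI) simp
    then show ?thesis unfolding w by (rule UN_I[OF UNIV_I])
  qed
  moreover have "m \<in> carrier M" if "m \<in> (\<Union>i. standard_filtration \<omega> i)" for m
    using that additive_subgroup.a_subset[OF additive_subgroup_standard_filtration] by (elim UN_E) (rule subsetD)
  ultimately have union: "(\<Union>i. standard_filtration \<omega> i) = carrier M"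
    by (intro subset_antisym subsetI)
  have "w \<odot>\<^bsub>M\<^esub> m \<in> standard_filtration \<omega> (i + j)"
    if "w \<in> Fweyl \<omega> i" "m \<in> standard_filtration \<omega> j" for i j w m
  proof -
    obtain f where "w = normal_op f" "f \<in> weight_le \<omega> i"
      using \<open>w \<in> Fweyl \<omega> i\<close> unfolding Fweyl_eq by (elim imageE)
    then show ?thesis
      using act_standard_filtration[OF \<omega> _ \<open>m \<in> standard_filtration \<omega> j\<close>, of f i] by (simp add: act_def)
  qed
  then have "filtration \<omega> M (standard_filtration \<omega>)"
    unfolding filtration_def by (simp only: additive_subgroup_standard_filtration mono union simp_thms) blast
  moreover have "standard_filtration \<omega> i
      = {\<Oplus>\<^bsub>M\<^esub>j\<in>{..<k}. w j \<odot>\<^bsub>M\<^esub> e j | w. \<forall>j<k. w j \<in> Fweyl \<omega> (i - (\<lambda>_. 0) j)}" for i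
    using span_filtration_eq[of k e \<omega> i "\<lambda>_. 0"] generator_closed
    by (simp add: span_filtration_def standard_filtration_def ev_def)
  ultimately show ?thesis
    unfolding good_filtration_def
    by (intro conjI exI[of _ k] exI[of _ e] exI[of _ "\<lambda>_. 0"]) (simp_all add: generator_closed)
qed

text \<open>
  Commutators have lower weight, so an operator that lowers the degree on the generators lowers it on
  all of the filtration.
\<close>

lemma gr_annihilator_standard_filtration:
  assumes \<omega>: "\<omega> \<in> Omega"
  shows "gr_annihilator \<omega> (standard_filtration \<omega>)
    = {f. \<forall>i. \<forall>j<k. act (hom_part \<omega> f i) (e j) \<in> standard_filtration \<omega> (i - 1)}"
proof (intro subset_antisym subsetI CollectI allI impI)
  fix f i j assume f: "f \<in> gr_annihilator \<omega> (standard_filtration \<omega>)" and j: "j < k"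
  have "ev (unit_vector j 1) \<in> standard_filtration \<omega> 0"
    by (intro standard_filtrationI) (auto simp: unit_vector_def weight_le_def wdot_def)
  then have "e j \<in> standard_filtration \<omega> 0"
    using j by (simp add: ev_unit_vector generator_closed)
  then show "act (hom_part \<omega> f i) (e j) \<in> standard_filtration \<omega> (i - 1)"
    using f unfolding gr_annihilator_def by force
next
  fix f assume "f \<in> {f. \<forall>i. \<forall>j<k. act (hom_part \<omega> f i) (e j) \<in> standard_filtration \<omega> (i - 1)}"
  then have f: "\<And>i j. j < k \<Longrightarrow> act (hom_part \<omega> f i) (e j) \<in> standard_filtration \<omega> (i - 1)"
    by blast
  have "act (hom_part \<omega> f i) m \<in> standard_filtration \<omega> (i + d - 1)" if m: "m \<in> standard_filtration \<omega> d" for i d m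
  proof -
    let ?h = "hom_part \<omega> f i"
    obtain w where w: "m = ev w" "\<And>j. j < k \<Longrightarrow> w j \<in> weight_le \<omega> d"
      using m by (elim standard_filtrationE) blast
    have "act ?h (act (w j) (e j)) \<in> standard_filtration \<omega> (i + d - 1)" if j: "j < k" for j
    proof -
      let ?r = "star ?h (w j) - star (w j) ?h"
      have "star ?h (w j) - ?h * w j \<in> weight_le \<omega> (i + d - 1)"
        by (intro star_diff_mult_weight_le \<omega> hom_part_weight_le w(2) j)
      moreover have "star (w j) ?h - w j * ?h \<in> weight_le \<omega> (d + i - 1)"
        by (intro star_diff_mult_weight_le \<omega> hom_part_weight_le w(2) j)
      ultimately have "(star ?h (w j) - ?h * w j) - (star (w j) ?h - w j * ?h) \<in> weight_le \<omega> (i + d - 1)"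
        unfolding add.commute[of d i] by (rule weight_le_diff)
      then have "?r \<in> weight_le \<omega> (i + d - 1)" by (simp add: algebra_simps)
      then have "ev (unit_vector j ?r) \<in> standard_filtration \<omega> (i + d - 1)"
        by (intro standard_filtrationI) (simp add: unit_vector_def)
      then have "act ?r (e j) \<in> standard_filtration \<omega> (i + d - 1)"
        using j by (simp add: ev_unit_vector)
      moreover have "act (w j) (act ?h (e j)) \<in> standard_filtration \<omega> (d + (i - 1))"
        by (intro act_standard_filtration \<omega> w(2) j f)
      ultimately have "act (w j) (act ?h (e j)) \<oplus>\<^bsub>M\<^esub> act ?r (e j) \<in> standard_filtration \<omega> (i + d - 1)"
        by (intro additive_subgroup.a_closed[OF additive_subgroup_standard_filtration]) (simp_all add: algebra_simps)
      moreover have "act ?h (act (w j) (e j)) = act (w j) (act ?h (e j)) \<oplus>\<^bsub>M\<^esub> act ?r (e j)"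
        using act_add[OF generator_closed[OF j], of "star (w j) ?h" ?r]
        by (simp add: act_star generator_closed[OF j])
      ultimately show ?thesis by simp
    qed
    then show ?thesis
      unfolding w(1) ev_def act_finsum[OF finite_lessThan act_generator_closed]
      by (intro additive_subgroup_finsum[OF additive_subgroup_standard_filtration]) auto
  qed
  then show "f \<in> gr_annihilator \<omega> (standard_filtration \<omega>)"
    by (simp add: gr_annihilator_def)
qed

section \<open>Initial bases of the module of relations\<close>

text \<open>
  The kernel of the presentation of \<open>M\<close> by a free module of rank \<open>k\<close>; components beyond the first \<open>k\<close> are
  zero, so that every relation has finite support.
\<close>

definition relations :: "(nat \<Rightarrow> ('n + 'n, 'a) mpoly) set"
  where "relations = {h. (\<forall>j\<ge>k. h j = 0) \<and> ev h = \<zero>\<^bsub>M\<^esub>}"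

lemma relations_diff_scale:
  assumes "h \<in> relations" and "g \<in> relations"
  shows "(\<lambda>j. h j - scale c (g j)) \<in> relations"
  using assms by (auto simp: relations_def ev_diff ev_scale a_minus_def)

lemma relations_star: "h \<in> relations \<Longrightarrow> (\<lambda>j. star f (h j)) \<in> relations"
  by (auto simp: relations_def ev_star)

lemma relations_zero [simp]: "(\<lambda>_. 0) \<in> relations"
  by (simp add: relations_def)

lemma relations_add: "h \<in> relations \<Longrightarrow> g \<in> relations \<Longrightarrow> (\<lambda>j. h j + g j) \<in> relations"
  using relations_diff_scale[of h g "- 1"] by simp

lemma relation_support:
  assumes "h \<in> relations"
  shows "finite {b. coefficient h b \<noteq> 0}" and "coefficient h b \<noteq> 0 \<Longrightarrow> b \<in> UNIV \<times> {..<k}"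
proof -
  have zero: "h j = 0" if "k \<le> j" for j using assms that by (simp add: relations_def)
  show *: "b \<in> UNIV \<times> {..<k}" if "coefficient h b \<noteq> 0" for b
    using that zero[of "snd b"] by (cases "snd b < k") (auto simp: coefficient_def mem_Times_iff)
  have "{b. coefficient h b \<noteq> 0} \<subseteq> (\<Union>j<k. Poly_Mapping.keys (h j) \<times> {j})"
  proof
    fix b assume "b \<in> {b. coefficient h b \<noteq> 0}"
    then show "b \<in> (\<Union>j<k. Poly_Mapping.keys (h j) \<times> {j})"
      using *[of b] by (cases b) (auto simp: coefficient_def in_keys_iff)
  qed
  then show "finite {b. coefficient h b \<noteq> 0}"
    by (rule finite_subset) auto
qed

text \<open>
  The set of monomials of the initial module of the relations for the term order that refines \<open>\<omega>\<close>.
\<close>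

definition initial_positions :: "('n + 'n \<Rightarrow> nat) \<Rightarrow> (('n + 'n \<Rightarrow>\<^sub>0 nat) \<times> nat) set"
  where "initial_positions \<omega> = leading_positions (position_key \<omega>) (coefficient ` relations)"

lemma relation_has_initial_position:
  assumes "h \<in> relations" and "coefficient h b \<noteq> 0"
  shows "\<exists>b\<in>initial_positions \<omega>. coefficient h b \<noteq> 0 \<and>
    (\<forall>b'. coefficient h b' \<noteq> 0 \<longrightarrow> position_key \<omega> b' \<le> position_key \<omega> b)"
  unfolding initial_positions_def
  by (rule support_meets_leading_positions[where f = "coefficient h" and b = b])
     (use assms relation_support(1)[OF assms(1)] in simp_all)

lemma initial_positions_subset: "initial_positions \<omega> \<subseteq> UNIV \<times> {..<k}"
proof
  fix b assume "b \<in> initial_positions \<omega>"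
  then obtain h where "h \<in> relations" "coefficient h b \<noteq> 0"
    unfolding initial_positions_def leading_positions_def by (elim CollectE bexE imageE) auto
  then show "b \<in> UNIV \<times> {..<k}" by (rule relation_support(2))
qed

lemma initial_positions_upset:
  assumes \<omega>: "\<omega> \<in> Omega" and b: "b \<in> initial_positions \<omega>" and le: "pos_le b b'"
  shows "b' \<in> initial_positions \<omega>"
proof -
  obtain h where h: "h \<in> relations" "coefficient h b \<noteq> 0"
      "\<And>b'. coefficient h b' \<noteq> 0 \<Longrightarrow> position_key \<omega> b' \<le> position_key \<omega> b"
    using b by (auto simp: initial_positions_def leading_positions_def)
  obtain \<alpha> where \<alpha>: "b' = (\<alpha> + fst b, snd b)" using le by (auto simp: pos_le_def)
  let ?h = "\<lambda>j. star (Poly_Mapping.single \<alpha> 1) (h j)"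
  have "coefficient ?h b' = 1 * coefficient h b"
    unfolding \<alpha> by (rule leading_position_star_monomial(1)[OF \<omega>]) (rule h(3))
  then have "coefficient ?h b' \<noteq> 0" using h(2) by simp
  moreover have "position_key \<omega> b'' \<le> position_key \<omega> b'" if "coefficient ?h b'' \<noteq> 0" for b''
    unfolding \<alpha> by (rule leading_position_star_monomial(2)[OF \<omega> _ that]) (rule h(3))
  ultimately show ?thesis
    unfolding initial_positions_def leading_positions_def using relations_star[OF h(1)] by blast
qed

text \<open>
  The weight does not occur here: a reduced relation for \<open>\<omega>\<close> depends on \<open>\<omega>\<close> only through the set \<open>S\<close>.
  This is why finitely many sets of initial positions yield finitely many Groebner bases.
\<close>

definition is_reduced :: "(('n + 'n \<Rightarrow>\<^sub>0 nat) \<times> nat) set \<Rightarrow> ('n + 'n \<Rightarrow>\<^sub>0 nat) \<times> nat \<Rightarrow>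
    (nat \<Rightarrow> ('n + 'n, 'a) mpoly) \<Rightarrow> bool"
  where "is_reduced S b g \<longleftrightarrow>
    g \<in> relations \<and> coefficient g b = 1 \<and> (\<forall>b'\<in>S. b' \<noteq> b \<longrightarrow> coefficient g b' = 0)"

lemma reduced_relation_exists:
  assumes "b \<in> initial_positions \<omega>"
  shows "\<exists>g. is_reduced (initial_positions \<omega>) b g"
proof -
  have "\<exists>g\<in>coefficient ` relations. g b = 1 \<and> (\<forall>b'\<in>initial_positions \<omega>. b' \<noteq> b \<longrightarrow> g b' = 0)"
    unfolding initial_positions_def
  proof (rule reduced_vector_exists[where B = "UNIV \<times> {..<k}"])
    show "inj_on (position_key \<omega>) (UNIV \<times> {..<k})"
      by (rule inj_on_subset[OF inj_position_key]) simp
    show "b \<in> leading_positions (position_key \<omega>) (coefficient ` relations)"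
      using assms by (simp add: initial_positions_def)
    fix f g c assume "f \<in> coefficient ` relations" "g \<in> coefficient ` relations"
    then obtain h h' where hh': "f = coefficient h" "g = coefficient h'" "h \<in> relations" "h' \<in> relations"
      by blast
    then have "(\<lambda>b. f b - c * g b) = coefficient (\<lambda>j. h j - scale c (h' j))"
      by (simp add: fun_eq_iff coefficient_def lookup_minus)
    then show "(\<lambda>b. f b - c * g b) \<in> coefficient ` relations"
      using relations_diff_scale[OF hh'(3,4)] by simp
  qed (use relation_support in auto)
  then show ?thesis by (auto simp: is_reduced_def)
qed

lemma reduced_relation_leading:
  assumes "is_reduced (initial_positions \<omega>) b g" and "coefficient g b' \<noteq> 0"
  shows "position_key \<omega> b' \<le> position_key \<omega> b"
proof -
  have g: "g \<in> relations" "\<And>c. \<lbrakk>c \<in> initial_positions \<omega>; c \<noteq> b\<rbrakk> \<Longrightarrow> coefficient g c = 0"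
    using assms(1) by (auto simp: is_reduced_def)
  obtain c where "c \<in> initial_positions \<omega>" "coefficient g c \<noteq> 0"
      "\<forall>b'. coefficient g b' \<noteq> 0 \<longrightarrow> position_key \<omega> b' \<le> position_key \<omega> c"
    using relation_has_initial_position[OF g(1) assms(2)] by blast
  then show ?thesis using g(2)[of c] assms(2) by (cases "c = b") blast+
qed

text \<open>
  Reduced relations have supports that meet the initial positions in one point only, and no nonzero
  relation has a support that avoids them.
\<close>

lemma finite_initial_positions: "finite {initial_positions \<omega> | \<omega>. \<omega> \<in> Omega}"
proof (rule finite_family_of_transversal_upsets[OF dickson])
  let ?T = "{{b. coefficient h b \<noteq> 0} | h. h \<in> relations \<and> (\<exists>b. coefficient h b \<noteq> 0)}"
  show "finite T \<and> T \<subseteq> UNIV \<times> {..<k}" if "T \<in> ?T" for T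
    using that relation_support by blast
  show "\<exists>T\<in>?T. T \<inter> S = {b}" if S: "S \<in> {initial_positions \<omega> | \<omega>. \<omega> \<in> Omega}" and b: "b \<in> S" for S b
  proof -
    obtain \<omega> where "S = initial_positions \<omega>" using S by blast
    then obtain g where g: "is_reduced S b g"
      using reduced_relation_exists[of b \<omega>] b by blast
    then have "{b. coefficient g b \<noteq> 0} \<inter> S = {b}"
      using b by (auto simp: is_reduced_def)
    moreover have "g \<in> relations \<and> coefficient g b \<noteq> 0"
      using g by (simp add: is_reduced_def)
    then have "{b. coefficient g b \<noteq> 0} \<in> ?T" by blast
    ultimately show ?thesis by (rule bexI)
  qed
  show "T \<inter> S \<noteq> {}" if S: "S \<in> {initial_positions \<omega> | \<omega>. \<omega> \<in> Omega}" and T: "T \<in> ?T" for S T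
  proof -
    obtain \<omega> where \<omega>: "S = initial_positions \<omega>" using S by blast
    obtain h b where h: "T = {b. coefficient h b \<noteq> 0}" "h \<in> relations" "coefficient h b \<noteq> 0"
      using T by blast
    then obtain b' where "b' \<in> initial_positions \<omega>" "coefficient h b' \<noteq> 0"
      using relation_has_initial_position[OF h(2,3), of \<omega>] by blast
    then have "b' \<in> T \<inter> S" unfolding \<omega> h(1) by simp
    then show ?thesis by blast
  qed
  show "b' \<in> S" if S: "S \<in> {initial_positions \<omega> | \<omega>. \<omega> \<in> Omega}" and b: "b \<in> S" "pos_le b b'" for S b b'
  proof -
    obtain \<omega> where \<omega>: "S = initial_positions \<omega>" "\<omega> \<in> Omega" using S by blast
    show ?thesis using initial_positions_upset[OF \<omega>(2) _ b(2)] b(1) unfolding \<omega>(1) .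
  qed
  show "S \<subseteq> UNIV \<times> {..<k}" if S: "S \<in> {initial_positions \<omega> | \<omega>. \<omega> \<in> Omega}" for S
  proof -
    obtain \<omega> where \<omega>: "S = initial_positions \<omega>" using S by blast
    show ?thesis unfolding \<omega> by (rule initial_positions_subset)
  qed
qed

text \<open>
  The choice depends on \<open>S\<close> alone, as does the choice of reduced relations that follows, so that weights
  with the same initial positions share them.
\<close>

definition basis_positions where
  "basis_positions S = (SOME D. D \<subseteq> S \<and> finite D \<and> (\<forall>b\<in>S. \<exists>d\<in>D. pos_le d b))"

definition reduced_relation where
  "reduced_relation S b = (SOME g. is_reduced S b g)"

text \<open>
  Generators of the graded module of the relations: leading forms of a Groebner basis.
\<close>

definition initial_basis :: "('n + 'n \<Rightarrow> nat) \<Rightarrow> (nat \<Rightarrow> ('n + 'n, 'a) mpoly) set"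
  where "initial_basis \<omega> =
    (\<lambda>b. weight_part \<omega> (int (wdot \<omega> (fst b))) (reduced_relation (initial_positions \<omega>) b))
      ` basis_positions (initial_positions \<omega>)"

lemma basis_positions:
  fixes \<omega>
  defines "S \<equiv> initial_positions \<omega>"
  shows "basis_positions S \<subseteq> S" and "finite (basis_positions S)"
    and "b \<in> S \<Longrightarrow> \<exists>d\<in>basis_positions S. pos_le d b"
proof -
  have "\<exists>D\<subseteq>S. finite D \<and> (\<forall>b\<in>S. \<exists>d\<in>D. pos_le d b)"
    unfolding S_def by (rule almost_full_finite_base[OF dickson initial_positions_subset])
  from someI_ex[OF this, folded basis_positions_def]
  show "basis_positions S \<subseteq> S" "finite (basis_positions S)"
    "b \<in> S \<Longrightarrow> \<exists>d\<in>basis_positions S. pos_le d b" by blast+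
qed

lemma is_reduced_reduced_relation:
  assumes "b \<in> initial_positions \<omega>"
  shows "is_reduced (initial_positions \<omega>) b (reduced_relation (initial_positions \<omega>) b)"
  unfolding reduced_relation_def by (rule someI_ex[OF reduced_relation_exists[OF assms]])

lemma reduced_relation_weight_le:
  assumes "b \<in> initial_positions \<omega>"
  shows "reduced_relation (initial_positions \<omega>) b j \<in> weight_le \<omega> (int (wdot \<omega> (fst b)))"
  unfolding weight_le_def
proof safe
  fix \<nu> assume "\<nu> \<in> Poly_Mapping.keys (reduced_relation (initial_positions \<omega>) b j)"
  then have "coefficient (reduced_relation (initial_positions \<omega>) b) (\<nu>, j) \<noteq> 0"
    by (simp add: coefficient_def in_keys_iff)
  from position_key_wdot_le[OF reduced_relation_leading[OF is_reduced_reduced_relation[OF assms] this]]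
  show "int (wdot \<omega> \<nu>) \<le> int (wdot \<omega> (fst b))" by simp
qed

lemma finite_initial_bases: "finite (initial_basis ` Omega)"
proof (rule finite_subset)
  let ?Z = "\<Union>S\<in>{initial_positions \<omega> | \<omega>. \<omega> \<in> Omega}. \<Union>b\<in>basis_positions S.
    range (\<lambda>(\<omega>, i). weight_part \<omega> i (reduced_relation S b))"
  have "finite (range (\<lambda>(\<omega>, i). weight_part \<omega> i (reduced_relation S b)))"
    if "S \<in> {initial_positions \<omega> | \<omega>. \<omega> \<in> Omega}" "b \<in> basis_positions S" for S b
  proof (rule finite_weight_parts[of k])
    have "reduced_relation S b \<in> relations"
      using that is_reduced_reduced_relation basis_positions(1) unfolding is_reduced_def by blast
    then show "reduced_relation S b j = 0" if "k \<le> j" for j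
      using that by (simp add: relations_def)
  qed
  then show "finite (Pow ?Z)"
    using finite_initial_positions basis_positions(2) by (intro finite_Pow_iff[THEN iffD2] finite_UN_I) auto
  show "initial_basis ` Omega \<subseteq> Pow ?Z"
  proof (intro subsetI PowI)
    fix G x assume "G \<in> initial_basis ` Omega" "x \<in> G"
    then obtain \<omega> b where "\<omega> \<in> Omega" "b \<in> basis_positions (initial_positions \<omega>)"
        "x = weight_part \<omega> (int (wdot \<omega> (fst b))) (reduced_relation (initial_positions \<omega>) b)"
      unfolding initial_basis_def by (elim imageE) auto
    then show "x \<in> ?Z"
      by (intro UN_I[of "initial_positions \<omega>"] UN_I[of b] range_eqI[of _ _ "(\<omega>, int (wdot \<omega> (fst b)))"]) auto
  qed
qed

text \<open>
  Division by the reduced relations: subtracting a multiple of one of them removes the leading position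
  of \<open>h\<close> and changes the part of weight \<open>d\<close> by a multiple of an element of the initial basis. Once
  the part of weight \<open>d\<close> is gone nothing remains to be shown.
\<close>

lemma weight_part_of_relation_in_span:
  assumes \<omega>: "\<omega> \<in> Omega" and h: "h \<in> relations" and d: "\<And>j. h j \<in> weight_le \<omega> d"
  shows "weight_part \<omega> d h \<in> poly_span (initial_basis \<omega>)"
proof -
  let ?S = "initial_positions \<omega>" and ?\<kappa> = "position_key \<omega>"
  have "weight_part \<omega> d h \<in> poly_span (initial_basis \<omega>)"
    if "h \<in> relations" "\<And>j. h j \<in> weight_le \<omega> d" "\<And>b. coefficient h b \<noteq> 0 \<Longrightarrow> ?\<kappa> b < x" for x h
    using that
  proof (induction x arbitrary: h rule: less_induct)
    case (less x)
    show ?case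
    proof (cases "\<exists>b. coefficient h b \<noteq> 0 \<and> int (wdot \<omega> (fst b)) = d")
      case False
      have "weight_part \<omega> d h = (\<lambda>_. 0)"
      proof (rule ext, rule poly_mapping_eqI)
        fix j \<nu>
        show "Poly_Mapping.lookup (weight_part \<omega> d h j) \<nu> = Poly_Mapping.lookup 0 \<nu>"
          using False by (auto simp: weight_part_def lookup_hom_part coefficient_def)
      qed
      then show ?thesis by (simp add: poly_span_zero)
    next
      case True
      then obtain b0 where b0: "coefficient h b0 \<noteq> 0" "int (wdot \<omega> (fst b0)) = d" by blast
      obtain b where b: "b \<in> ?S" "coefficient h b \<noteq> 0" "\<And>b'. coefficient h b' \<noteq> 0 \<Longrightarrow> ?\<kappa> b' \<le> ?\<kappa> b"
        using relation_has_initial_position[OF less.prems(1) b0(1)] by blast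
      have "fst b \<in> Poly_Mapping.keys (h (snd b))"
        using b(2) by (simp add: coefficient_def in_keys_iff)
      then have "int (wdot \<omega> (fst b)) \<le> d"
        using less.prems(2)[of "snd b"] by (simp add: weight_le_def)
      then have db: "int (wdot \<omega> (fst b)) = d"
        using position_key_wdot_le[OF b(3)[OF b0(1)]] b0(2) by simp
      obtain c where c: "c \<in> basis_positions ?S" "pos_le c b"
        using basis_positions(3)[OF b(1)] by blast
      then have cS: "c \<in> ?S" using basis_positions(1) by blast
      obtain \<alpha> where \<alpha>: "b = (\<alpha> + fst c, snd c)" using c(2) by (auto simp: pos_le_def)
      let ?g = "reduced_relation ?S c" and ?x = "Poly_Mapping.single \<alpha> (coefficient h b)"
      have g: "is_reduced ?S c ?g" by (rule is_reduced_reduced_relation[OF cS])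
      let ?p = "\<lambda>j. star ?x (?g j)"
      define h' where "h' = (\<lambda>j. h j - ?p j)"
      have "coefficient ?p (\<alpha> + fst c, snd c) = coefficient h b * coefficient ?g c"
        by (rule leading_position_star_monomial(1)[OF \<omega>]) (rule reduced_relation_leading[OF g])
      then have p: "coefficient ?p b = coefficient h b"
        using g unfolding \<alpha>[symmetric] by (simp add: is_reduced_def)
      have p': "?\<kappa> b' \<le> ?\<kappa> b" if "coefficient ?p b' \<noteq> 0" for b'
        by (subst \<alpha>, rule leading_position_star_monomial(2)[OF \<omega> _ that]) (rule reduced_relation_leading[OF g])
      have h': "h' \<in> relations"
        using relations_diff_scale[OF less.prems(1) relations_star[of ?g ?x], of 1] g
        by (simp add: h'_def is_reduced_def)
      have coeff: "coefficient h' b' = coefficient h b' - coefficient ?p b'" for b'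
        by (simp add: h'_def coefficient_def lookup_minus)
      have dc: "int (wdot \<omega> \<alpha>) + int (wdot \<omega> (fst c)) = d"
        using db by (simp add: \<alpha>)
      have pw: "?p j \<in> weight_le \<omega> d" for j
        using star_weight_le[OF \<omega> weight_le_single reduced_relation_weight_le[OF cS], of \<alpha> "int (wdot \<omega> \<alpha>)"] dc
        by simp
      have "weight_part \<omega> d h' \<in> poly_span (initial_basis \<omega>)"
      proof (rule less.IH[of "?\<kappa> b"])
        show "?\<kappa> b < x" using less.prems(3) b(2) by blast
        show "h' j \<in> weight_le \<omega> d" for j
          unfolding h'_def by (intro weight_le_diff less.prems(2) pw)
        fix b' assume b': "coefficient h' b' \<noteq> 0"
        then have "?\<kappa> b' \<le> ?\<kappa> b"
          using b(3)[of b'] p'[of b'] unfolding coeff by fastforce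
        moreover have "b' \<noteq> b" using b' p by (auto simp: coeff)
        ultimately show "?\<kappa> b' < ?\<kappa> b"
          using injD[OF inj_position_key, of \<omega> b' b] by fastforce
      qed (rule h')
      then have "(\<lambda>j. weight_part \<omega> d h' j + ?x * weight_part \<omega> (int (wdot \<omega> (fst c))) ?g j)
          \<in> poly_span (initial_basis \<omega>)"
        by (rule poly_span_step) (use c(1) in \<open>auto simp: initial_basis_def\<close>)
      moreover have "weight_part \<omega> d h j = weight_part \<omega> d h' j + ?x * weight_part \<omega> (int (wdot \<omega> (fst c))) ?g j" for j
      proof -
        let ?q = "?x * weight_part \<omega> (int (wdot \<omega> (fst c))) ?g j"
        have "?p j - ?q \<in> weight_le \<omega> (d - 1)"
          unfolding dc[symmetric] by (rule weight_part_star_monomial[OF \<omega> reduced_relation_weight_le[OF cS]])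
        then have "hom_part \<omega> (?p j) d = hom_part \<omega> ?q d"
          using hom_part_eq_zero[of "?p j - ?q"] by (simp add: hom_part_diff)
        moreover have "homogeneous \<omega> (int (wdot \<omega> \<alpha>) + int (wdot \<omega> (fst c))) ?q"
          unfolding weight_part_def
          by (intro homogeneous_mult homogeneous_hom_part) (auto simp: homogeneous_def split: if_splits)
        then have "hom_part \<omega> ?q d = ?q"
          using hom_part_homogeneous[of \<omega> d ?q d] by (simp add: dc)
        ultimately show ?thesis
          by (simp add: weight_part_def h'_def hom_part_diff)
      qed
      then have "weight_part \<omega> d h = (\<lambda>j. weight_part \<omega> d h' j + ?x * weight_part \<omega> (int (wdot \<omega> (fst c))) ?g j)"
        by blast
      ultimately show ?thesis by metis
    qed
  qed
  \<comment> \<open>The key \<open>(Suc (nat d), 0, 0)\<close> exceeds the keys of all positions of weight at most \<open>d\<close>.\<close>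
  note in_span = this
  show ?thesis
  proof (rule in_span[OF h d])
    fix b assume "coefficient h b \<noteq> 0"
    then have "fst b \<in> Poly_Mapping.keys (h (snd b))"
      by (simp add: coefficient_def in_keys_iff)
    then have "int (wdot \<omega> (fst b)) \<le> d"
      using d[of "snd b"] by (simp add: weight_le_def)
    then show "?\<kappa> b < (Suc (nat d), 0, 0)" by (auto simp: position_key_def)
  qed
qed

lemma span_lifts_to_relations:
  assumes \<omega>: "\<omega> \<in> Omega" and x: "x \<in> poly_span (initial_basis \<omega>)"
  shows "\<exists>h\<in>relations. \<forall>j. h j - hom_part \<omega> (x j) i \<in> weight_le \<omega> (i - 1)"
  using x
proof induction
  case poly_span_zero
  show ?case by (intro bexI[of _ "\<lambda>_. 0"]) simp_all
next
  case (poly_span_step x g \<alpha> c)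
  let ?S = "initial_positions \<omega>"
  obtain h where h: "h \<in> relations" "\<And>j. h j - hom_part \<omega> (x j) i \<in> weight_le \<omega> (i - 1)"
    using poly_span_step.IH by blast
  obtain b where b: "b \<in> basis_positions ?S" "g = weight_part \<omega> (int (wdot \<omega> (fst b))) (reduced_relation ?S b)"
    using poly_span_step.hyps(2) by (auto simp: initial_basis_def)
  then have bS: "b \<in> ?S" using basis_positions(1) by blast
  let ?r = "reduced_relation ?S b" and ?x = "Poly_Mapping.single \<alpha> c"
  let ?d = "int (wdot \<omega> \<alpha>) + int (wdot \<omega> (fst b))"
  have hom: "homogeneous \<omega> ?d (?x * g j)" for j
    unfolding b(2) weight_part_def
    by (intro homogeneous_mult homogeneous_hom_part) (auto simp: homogeneous_def split: if_splits)
  show ?case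
  proof (cases "i = ?d")
    case False
    then show ?thesis
      using h by (intro bexI[of _ h]) (simp_all add: hom_part_add hom_part_homogeneous[OF hom])
  next
    case True
    have "(h j + star ?x (?r j)) - hom_part \<omega> (x j + ?x * g j) i \<in> weight_le \<omega> (i - 1)" for j
    proof -
      have "star ?x (?r j) - ?x * g j \<in> weight_le \<omega> (i - 1)"
        unfolding b(2) True by (rule weight_part_star_monomial[OF \<omega> reduced_relation_weight_le[OF bS]])
      moreover have "hom_part \<omega> (?x * g j) i = ?x * g j"
        using hom_part_homogeneous[OF hom] True by simp
      then have "(h j + star ?x (?r j)) - hom_part \<omega> (x j + ?x * g j) i
          = (h j - hom_part \<omega> (x j) i) + (star ?x (?r j) - ?x * g j)"
        unfolding hom_part_add by simp
      ultimately show ?thesis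
        using weight_le_add[OF h(2)[of j]] by metis
    qed
    moreover have "(\<lambda>j. h j + star ?x (?r j)) \<in> relations"
      using is_reduced_reduced_relation[OF bS] unfolding is_reduced_def
      by (intro relations_add h(1) relations_star) simp
    ultimately show ?thesis
      by (intro bexI[of _ "\<lambda>j. h j + star ?x (?r j)"]) simp_all
  qed
qed

text \<open>
  The graded module of \<open>M\<close> is the quotient of the free module over the polynomial ring by the submodule
  generated by the initial basis, so its annihilator is read off from the unit vectors.
\<close>

lemma gr_annihilator_eq_span:
  assumes \<omega>: "\<omega> \<in> Omega"
  shows "gr_annihilator \<omega> (standard_filtration \<omega>)
    = {f. \<forall>j<k. unit_vector j f \<in> poly_span (initial_basis \<omega>)}"
  unfolding gr_annihilator_standard_filtration[OF \<omega>]
proof (intro subset_antisym subsetI CollectI allI impI)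
  fix f j
  assume f: "f \<in> {f. \<forall>i. \<forall>j<k. act (hom_part \<omega> f i) (e j) \<in> standard_filtration \<omega> (i - 1)}" and j: "j < k"
  have "unit_vector j (hom_part \<omega> f i) \<in> poly_span (initial_basis \<omega>)" for i
  proof -
    let ?u = "unit_vector j (hom_part \<omega> f i)"
    have "act (hom_part \<omega> f i) (e j) \<in> standard_filtration \<omega> (i - 1)" using f j by blast
    then obtain v where v: "act (hom_part \<omega> f i) (e j) = ev v" "\<And>j. j < k \<Longrightarrow> v j \<in> weight_le \<omega> (i - 1)"
      by (elim standard_filtrationE) blast
    \<comment> \<open>Relations vanish beyond \<open>k\<close>, which a representation of an element need not do.\<close>
    define w where "w = (\<lambda>l. if l < k then v l else 0)"
    have w: "w l \<in> weight_le \<omega> (i - 1)" for l using v(2) by (simp add: w_def)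
    have "ev w = ev v" by (rule ev_cong) (simp add: w_def)
    then have "ev (\<lambda>l. ?u l - w l) = \<zero>\<^bsub>M\<^esub>"
      using v(1) j by (simp add: ev_diff ev_unit_vector a_minus_def M.r_neg)
    then have rel: "(\<lambda>l. ?u l - w l) \<in> relations"
      using j by (auto simp: relations_def w_def unit_vector_def)
    have "?u l - w l \<in> weight_le \<omega> i" for l
      by (intro weight_le_diff weight_le_mono[OF w]) (auto simp: unit_vector_def hom_part_weight_le)
    from weight_part_of_relation_in_span[OF \<omega> rel this]
    have "weight_part \<omega> i (\<lambda>l. ?u l - w l) \<in> poly_span (initial_basis \<omega>)" .
    moreover have "weight_part \<omega> i (\<lambda>l. ?u l - w l) = ?u"
      using hom_part_eq_zero[OF w] hom_part_homogeneous[OF homogeneous_hom_part, of \<omega> f i i]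
      by (auto simp: weight_part_def hom_part_diff unit_vector_def fun_eq_iff)
    ultimately show ?thesis by simp
  qed
  then have "(\<lambda>l. \<Sum>i\<in>{i. hom_part \<omega> f i \<noteq> 0}. unit_vector j (hom_part \<omega> f i) l) \<in> poly_span (initial_basis \<omega>)"
    by (rule poly_span_sum)
  moreover have "(\<lambda>l. \<Sum>i\<in>{i. hom_part \<omega> f i \<noteq> 0}. unit_vector j (hom_part \<omega> f i) l) = unit_vector j f"
    by (auto simp: unit_vector_def fun_eq_iff sum_hom_part)
  ultimately show "unit_vector j f \<in> poly_span (initial_basis \<omega>)" by simp
next
  fix f i j
  assume f: "f \<in> {f. \<forall>j<k. unit_vector j f \<in> poly_span (initial_basis \<omega>)}" and j: "j < k"
  let ?u = "unit_vector j (hom_part \<omega> f i)"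
  have u: "hom_part \<omega> (unit_vector j f l) i = ?u l" for l by (simp add: unit_vector_def)
  obtain h where h: "h \<in> relations" "\<And>l. h l - ?u l \<in> weight_le \<omega> (i - 1)"
    using span_lifts_to_relations[OF \<omega>, of "unit_vector j f" i] f j unfolding u by blast
  have "ev (\<lambda>l. - (h l - ?u l)) \<in> standard_filtration \<omega> (i - 1)"
    by (intro standard_filtrationI weight_le_uminus h)
  moreover have "ev (\<lambda>l. - (h l - ?u l)) = act (hom_part \<omega> f i) (e j)"
    using h(1) j generator_closed[OF j]
    by (simp add: ev_diff ev_unit_vector relations_def a_minus_def)
  ultimately show "act (hom_part \<omega> f i) (e j) \<in> standard_filtration \<omega> (i - 1)" by simp
qed

section \<open>Finiteness\<close>

lemma finite_char_varieties: "finite {char_variety \<omega> M | \<omega>. \<omega> \<in> Omega}"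
proof (rule finite_subset)
  let ?V = "\<lambda>G. Var ring_of_type_algebra {f. \<forall>j<k. unit_vector j f \<in> poly_span G}"
  show "{char_variety \<omega> M | \<omega>. \<omega> \<in> Omega} \<subseteq> ?V ` initial_basis ` Omega"
    using char_variety_eq[OF _ good_standard_filtration] gr_annihilator_eq_span by auto
  show "finite (?V ` initial_basis ` Omega)"
    using finite_initial_bases by simp
qed

end

theorem theorem4p4:
  fixes M :: "(('n::finite, 'a::field_char_0) operator, 'm) module"
  assumes "left_module weyl M" and "fin_generated weyl M"
  shows "finite {char_variety \<omega> M | \<omega>. \<omega> \<in> Omega}"
proof -
  interpret weyl_module M
    using assms(1) by (rule weyl_module.intro)
  obtain A where A: "finite A" "A \<subseteq> carrier M"
      "\<And>m. m \<in> carrier M \<Longrightarrow> \<exists>r\<in>A \<rightarrow> carrier weyl. m = (\<Oplus>\<^bsub>M\<^esub>a\<in>A. r a \<odot>\<^bsub>M\<^esub> a)"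
    using assms(2) unfolding fin_generated_def by blast
  obtain e where e: "bij_betw e {0..<card A} A"
    using ex_bij_betw_nat_finite[OF A(1)] by blast
  then have inj: "inj_on e {..<card A}" and image: "e ` {..<card A} = A"
    by (simp_all add: bij_betw_def atLeast0LessThan)
  have "generated_weyl_module M (card A) e"
  proof
    show "e j \<in> carrier M" if "j < card A" for j
      using that image A(2) by blast
    fix m assume "m \<in> carrier M"
    then obtain r where r: "r \<in> A \<rightarrow> carrier weyl" "m = (\<Oplus>\<^bsub>M\<^esub>a\<in>A. r a \<odot>\<^bsub>M\<^esub> a)"
      using A(3) by blast
    have "\<forall>a\<in>A. \<exists>c. r a = normal_op c"
      using r(1) unfolding carrier_weyl by blast
    then obtain c where c: "\<And>a. a \<in> A \<Longrightarrow> r a = normal_op (c a)" by metis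
    have "m = (\<Oplus>\<^bsub>M\<^esub>a\<in>e ` {..<card A}. act (c a) a)"
      unfolding r(2) image by (rule M.finsum_cong') (use c A(2) in \<open>auto simp: act_def[symmetric]\<close>)
    also have "\<dots> = (\<Oplus>\<^bsub>M\<^esub>j\<in>{..<card A}. act (c (e j)) (e j))"
      by (rule M.finsum_reindex[OF _ inj]) (use image A(2) in auto)
    finally show "\<exists>w. m = (\<Oplus>\<^bsub>M\<^esub>j\<in>{..<card A}. act (w j) (e j))"
      by (intro exI[of _ "\<lambda>j. c (e j)"])
  qed
  then show ?thesis by (rule generated_weyl_module.finite_char_varieties)
qed

end
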